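(* Let $b,\omega:\mathbb{R}\to\mathbb{R}$ be uniformly continuous with $0<b_0\le b(t)\le b_1$ and $0\le\omega_0\le\omega(t)\le\omega_1<\pi^2$. Then the skew product multivalued semiflow $\Pi$ possesses a global compact invariant attractor $\mathbb{A}\subset\mathcal{X}$, and $\mathbb{A}=\bigcup_{\sigma\in\Sigma}\mathcal{A}_\sigma(0)\times\{\sigma\}$, where $\{\mathcal{A}_\sigma(t)\}_{t\in\mathbb{R}}$ is the pullback attractor of the process $U_\sigma$.
   Context: $H=L^2(0,1)$, $V=H_0^1(0,1)$, $A=-d^2/dx^2$, $D(A)=H^2(0,1)\cap V$, $H_0(s)=\{-1\}$ ($s<0$), $[-1,1]$ ($s=0$), $\{1\}$ ($s>0$). $\Sigma$ is the closure in $C(\mathbb{R},\mathbb{R}^2)$ (uniform convergence on compacts, with a metric $\rho$) of $\{(b(\cdot+t),\omega(\cdot+t)):t\in\mathbb{R}\}$, $\theta_s\sigma=\sigma(\cdot+s)$. For $\sigma=(\bar b,\bar\omega)\in\Sigma$, $\mathcal{D}_{\tau,\sigma}(x)$ is the set of solutions of $\partial_t u-\partial_{xx}u\in\bar b(t)H_0(u)+\bar\omega(t)u$ on $(\tau,\infty)\times(0,1)$, Dirichlet conditions, $u(\tau)=x$ (a solution is $u\in C([\tau,\infty),H)$, $u(\tau)=x$, absolutely continuous on each $[T_1,T_2]$, $\tau<T_1<T_2$, $u(t)\in D(A)$ a.e., with some $r\in L^2_{loc}(\tau,\infty;H)$, $r(t)(x')\in\bar b(t)H_0(u(t)(x'))+\bar\omega(t)u(t)(x')$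 a.e., $du/dt+Au=r$ a.e.). $U_\sigma(t,\tau,x)=\{u(t):u\in\mathcal{D}_{\tau,\sigma}(x)\}$; its pullback attractor (known to exist) is the minimal family of compact sets $\mathcal{A}_\sigma(t)$ with $\mathcal{A}_\sigma(t)=U_\sigma(t,s,\mathcal{A}_\sigma(s))$ for $t\ge s$ that pullback attracts bounded sets ($\operatorname{dist}(U_\sigma(t,s,B),\mathcal{A}_\sigma(t))\to0$ as $s\to-\infty$). $\mathcal{X}=H\times\Sigma$ with metric $\|x_1-x_2\|+\rho(\sigma_1,\sigma_2)$, and $\Pi(t,(x,\sigma))=\{(u(t),\theta_t\sigma):u\in\mathcal{D}_{0,\sigma}(x)\}$, $t\ge0$. A global compact invariant attractor of $\Pi$ is a compact set $\mathbb{A}\subset\mathcal{X}$ with $\Pi(t,\mathbb{A})=\mathbb{A}$ for all $t\ge0$ and $\operatorname{dist}_{\mathcal{X}}(\Pi(t,\mathbb{B}),\mathbb{A})\to0$ as $t\to\infty$ for every bounded $\mathbb{B}\subset\mathcal{X}$. *)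

theory Defs
  imports "HOL-Analysis.Analysis"
begin

text \<open>Elements of H are represented by functions real => real; two functions
  represent the same element of H iff they agree a.e. on [0,1].\<close>

definition inH :: "(real \<Rightarrow> real) \<Rightarrow> bool" where
  "inH f \<longleftrightarrow> set_borel_measurable lebesgue {0..1} f
      \<and> set_integrable lebesgue {0..1} (\<lambda>x. (f x)^2)"

definition normH :: "(real \<Rightarrow> real) \<Rightarrow> real" where
  "normH f = sqrt (LINT x:{0..1}|lebesgue. (f x)^2)"

definition distH :: "(real \<Rightarrow> real) \<Rightarrow> (real \<Rightarrow> real) \<Rightarrow> real" where
  "distH f g = normH (\<lambda>x. f x - g x)"

definition eqH :: "(real \<Rightarrow> real) \<Rightarrow> (real \<Rightarrow> real) \<Rightarrow> bool" where
  "eqH f g \<longleftrightarrow> (AE x in lebesgue. x \<in> {0..1} \<longrightarrow> f x = g x)"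

definition boundedH :: "(real \<Rightarrow> real) set \<Rightarrow> bool" where
  "boundedH B \<longleftrightarrow> (\<forall>f\<in>B. inH f) \<and> (\<exists>R. \<forall>f\<in>B. normH f \<le> R)"

definition compactH :: "(real \<Rightarrow> real) set \<Rightarrow> bool" where
  "compactH K \<longleftrightarrow> (\<forall>f\<in>K. inH f) \<and>
     (\<forall>s::nat \<Rightarrow> real \<Rightarrow> real. (\<forall>n. s n \<in> K) \<longrightarrow>
        (\<exists>l\<in>K. \<exists>r. strict_mono r \<and> (\<lambda>n. distH (s (r n)) l) \<longlonglongrightarrow> 0))"

section \<open>The operator A = -d^2/dx^2 with D(A) = H^2(0,1) \<inter> H^1_0(0,1)\<close>

text \<open>\<open>opA f v\<close>: f \<in> D(A) and A f = v (in H). The representative g of f is C^1 on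
  [0,1], vanishes at 0 and 1, and g' is absolutely continuous with g'' = -v \<in> L2.\<close>
definition opA :: "(real \<Rightarrow> real) \<Rightarrow> (real \<Rightarrow> real) \<Rightarrow> bool" where
  "opA f v \<longleftrightarrow> inH f \<and> inH v \<and>
     (\<exists>g g1. eqH f g \<and> g 0 = 0 \<and> g 1 = 0 \<and>
        (\<forall>x\<in>{0..1}. (g has_real_derivative g1 x) (at x within {0..1})) \<and>
        (\<forall>x\<in>{0..1}. g1 x = g1 0 - (LINT s:{0..x}|lebesgue. v s)))"

definition H0 :: "real \<Rightarrow> real set" where
  "H0 s = (if s < 0 then {-1} else if s = 0 then {-1..1} else {1})"

definition abs_cont_H :: "(real \<Rightarrow> real \<Rightarrow> real) \<Rightarrow> real \<Rightarrow> real \<Rightarrow> bool" where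
  "abs_cont_H u a b \<longleftrightarrow>
     (\<forall>\<epsilon>>0. \<exists>\<delta>>0. \<forall>(n::nat) (s::nat \<Rightarrow> real) (e::nat \<Rightarrow> real).
        (\<forall>i<n. a \<le> s i \<and> s i \<le> e i \<and> e i \<le> b) \<and>
        (\<forall>i<n. \<forall>j<n. i \<noteq> j \<longrightarrow> e i \<le> s j \<or> e j \<le> s i) \<and>
        (\<Sum>i<n. e i - s i) < \<delta>
        \<longrightarrow> (\<Sum>i<n. distH (u (e i)) (u (s i))) < \<epsilon>)"

definition has_H_derivative :: "(real \<Rightarrow> real \<Rightarrow> real) \<Rightarrow> (real \<Rightarrow> real) \<Rightarrow> real \<Rightarrow> bool" where
  "has_H_derivative u d t \<longleftrightarrow> inH d \<and>
     ((\<lambda>h. distH (\<lambda>x. (u (t + h) x - u t x) / h) d) \<longlongrightarrow> 0) (at 0)"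

text \<open>\<open>solution \<tau> \<sigma> x u\<close>: u \<in> D_{\<tau>,\<sigma>}(x), where \<sigma> t = (b t, \<omega> t).\<close>
definition solution ::
  "real \<Rightarrow> (real \<Rightarrow> real \<times> real) \<Rightarrow> (real \<Rightarrow> real) \<Rightarrow> (real \<Rightarrow> real \<Rightarrow> real) \<Rightarrow> bool" where
  "solution \<tau> \<sigma> x u \<longleftrightarrow>
     inH x \<and> (\<forall>t\<ge>\<tau>. inH (u t)) \<and>
     (\<forall>t\<ge>\<tau>. ((\<lambda>s. distH (u s) (u t)) \<longlongrightarrow> 0) (at t within {\<tau>..})) \<and>
     eqH (u \<tau>) x \<and>
     (\<forall>T1 T2. \<tau> < T1 \<and> T1 < T2 \<longrightarrow> abs_cont_H u T1 T2) \<and>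
     (\<exists>r :: real \<Rightarrow> real \<Rightarrow> real.
        (\<forall>T>\<tau>. set_borel_measurable (lborel \<Otimes>\<^sub>M lborel) ({\<tau>..T} \<times> {0..1}) (\<lambda>p. r (fst p) (snd p))
               \<and> set_integrable (lborel \<Otimes>\<^sub>M lborel) ({\<tau>..T} \<times> {0..1}) (\<lambda>p. (r (fst p) (snd p))^2)) \<and>
        (AE t in lborel. t > \<tau> \<longrightarrow>
            (AE y in lebesgue. y \<in> {0..1} \<longrightarrow>
               (\<exists>h\<in>H0 (u t y). r t y = fst (\<sigma> t) * h + snd (\<sigma> t) * u t y))) \<and>
        (AE t in lborel. t > \<tau> \<longrightarrow>
            (\<exists>d v. has_H_derivative u d t \<and> opA (u t) v \<and> eqH (\<lambda>y. d y + v y) (r t))))"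

definition U :: "(real \<Rightarrow> real \<times> real) \<Rightarrow> real \<Rightarrow> real \<Rightarrow> (real \<Rightarrow> real) set \<Rightarrow> (real \<Rightarrow> real) set" where
  "U \<sigma> t \<tau> A = {u t | u x. x \<in> A \<and> solution \<tau> \<sigma> x u}"

definition pullback_attracts :: "(real \<Rightarrow> real \<times> real) \<Rightarrow> (real \<Rightarrow> (real \<Rightarrow> real) set) \<Rightarrow> bool" where
  "pullback_attracts \<sigma> P \<longleftrightarrow>
     (\<forall>t B. boundedH B \<longrightarrow>
        (\<forall>\<epsilon>>0. \<exists>s0\<le>t. \<forall>s\<le>s0. \<forall>y\<in>U \<sigma> t s B. \<exists>a\<in>P t. distH y a < \<epsilon>))"

definition pullback_attractor :: "(real \<Rightarrow> real \<times> real) \<Rightarrow> (real \<Rightarrow> (real \<Rightarrow> real) set) \<Rightarrow> bool" where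
  "pullback_attractor \<sigma> P \<longleftrightarrow>
     (\<forall>t. compactH (P t)) \<and>
     (\<forall>t s. s \<le> t \<longrightarrow> P t = U \<sigma> t s (P s)) \<and>
     pullback_attracts \<sigma> P \<and>
     (\<forall>Q. (\<forall>t. compactH (Q t)) \<and> pullback_attracts \<sigma> Q \<longrightarrow>
          (\<forall>t. \<forall>y\<in>P t. \<exists>z\<in>Q t. eqH y z))"

text \<open>Metric of uniform convergence on compacts in C(R,R^2).\<close>
definition rho :: "(real \<Rightarrow> real \<times> real) \<Rightarrow> (real \<Rightarrow> real \<times> real) \<Rightarrow> real" where
  "rho f g = (\<Sum>n. (1/2)^(Suc n) *
      min 1 (SUP t\<in>{- real (Suc n)..real (Suc n)}. norm (f t - g t)))"

definition theta :: "real \<Rightarrow> (real \<Rightarrow> real \<times> real) \<Rightarrow> (real \<Rightarrow> real \<times> real)" where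
  "theta s \<sigma> = (\<lambda>t. \<sigma> (t + s))"

definition Hull :: "(real \<Rightarrow> real) \<Rightarrow> (real \<Rightarrow> real) \<Rightarrow> (real \<Rightarrow> real \<times> real) set" where
  "Hull b \<omega> = {\<sigma>. continuous_on UNIV \<sigma> \<and>
     (\<exists>ts::nat \<Rightarrow> real. (\<lambda>k. rho (theta (ts k) (\<lambda>s. (b s, \<omega> s))) \<sigma>) \<longlonglongrightarrow> 0)}"

type_synonym xpt = "(real \<Rightarrow> real) \<times> (real \<Rightarrow> real \<times> real)"

definition Xspace :: "(real \<Rightarrow> real) \<Rightarrow> (real \<Rightarrow> real) \<Rightarrow> xpt set" where
  "Xspace b \<omega> = {p. inH (fst p) \<and> snd p \<in> Hull b \<omega>}"

definition distX :: "xpt \<Rightarrow> xpt \<Rightarrow> real" where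
  "distX p q = distH (fst p) (fst q) + rho (snd p) (snd q)"

definition Pi :: "real \<Rightarrow> xpt \<Rightarrow> xpt set" where
  "Pi t p = {(u t, theta t (snd p)) | u. solution 0 (snd p) (fst p) u}"

definition Pi_set :: "real \<Rightarrow> xpt set \<Rightarrow> xpt set" where
  "Pi_set t S = (\<Union>p\<in>S. Pi t p)"

definition boundedX :: "(real \<Rightarrow> real) \<Rightarrow> (real \<Rightarrow> real) \<Rightarrow> xpt set \<Rightarrow> bool" where
  "boundedX b \<omega> S \<longleftrightarrow> S \<subseteq> Xspace b \<omega> \<and> (\<exists>R. \<forall>p\<in>S. \<forall>q\<in>S. distX p q \<le> R)"

definition compactX :: "(real \<Rightarrow> real) \<Rightarrow> (real \<Rightarrow> real) \<Rightarrow> xpt set \<Rightarrow> bool" where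
  "compactX b \<omega> K \<longleftrightarrow> K \<subseteq> Xspace b \<omega> \<and>
     (\<forall>s::nat \<Rightarrow> xpt. (\<forall>n. s n \<in> K) \<longrightarrow>
        (\<exists>l\<in>K. \<exists>r. strict_mono r \<and> (\<lambda>n. distX (s (r n)) l) \<longlonglongrightarrow> 0))"

definition global_attractor :: "(real \<Rightarrow> real) \<Rightarrow> (real \<Rightarrow> real) \<Rightarrow> xpt set \<Rightarrow> bool" where
  "global_attractor b \<omega> AA \<longleftrightarrow>
     compactX b \<omega> AA \<and>
     (\<forall>t\<ge>0. Pi_set t AA = AA) \<and>
     (\<forall>BB. boundedX b \<omega> BB \<longrightarrow>
        (\<forall>\<epsilon>>0. \<exists>T. \<forall>t\<ge>T. \<forall>y\<in>Pi_set t BB. \<exists>a\<in>AA. distX y a < \<epsilon>))"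

end

theory Submission
  imports Defs "HOL-Complex_Analysis.Great_Picard"
begin

text \<open>Expand a solution in the sine basis of \<open>L\<^sup>2(0,1)\<close>, with eigenvalues \<open>\<lambda>\<^sub>k = ((k+1)\<pi>)\<^sup>2\<close>.
  A strong solution with right-hand side \<open>r\<close> is the same as an \<open>H\<close>-valued function whose coefficients
  satisfy the integrated equations \<open>u\<^sub>k' = r\<^sub>k - \<lambda>\<^sub>k u\<^sub>k\<close>; in this form restriction, translation,
  concatenation and passage to the limit are easy. Since \<open>\<omega> \<le> \<omega>1 < \<pi>\<^sup>2 \<le> \<lambda>\<^sub>k\<close>, the energy
  \<open>\<parallel>u\<parallel>\<^sup>2\<close> decays exponentially to a fixed level, and the smoothing estimate for
  \<open>\<Sum>k. \<lambda>\<^sub>k u\<^sub>k\<^sup>2\<close> makes bounded families of trajectories relatively compact. In the limit the right-hand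
  sides only converge weakly; convex combinations of them converge strongly, and the inclusion,
  being a subgradient inequality, survives convex combinations. Hence trajectories starting at times
  tending to \<open>-\<infinity>\<close> subconverge to complete bounded trajectories, also when the symbol varies in the
  compact hull. The sections at time \<open>t\<close> of the complete bounded trajectories of \<open>\<sigma>\<close> therefore form the
  pullback attractor, and the sections at time \<open>0\<close>, taken over all symbols, form the global
  attractor. Forward existence of solutions is never needed: only points on complete
  trajectories have to be continued.\<close>

section \<open>Square integrable functions\<close>

definition L2 :: "'a measure \<Rightarrow> ('a \<Rightarrow> real) \<Rightarrow> bool" where
  "L2 M f \<longleftrightarrow> f \<in> borel_measurable M \<and> integrable M (\<lambda>x. (f x)^2)"

definition nrm :: "'a measure \<Rightarrow> ('a \<Rightarrow> real) \<Rightarrow> real" where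
  "nrm M f = sqrt (\<integral>x. (f x)^2 \<partial>M)"

lemma L2_sq_integrable: "L2 M f \<Longrightarrow> integrable M (\<lambda>x. (f x)^2)"
  by (simp add: L2_def)

lemma nrm_nonneg [simp]: "nrm M f \<ge> 0"
  by (simp add: nrm_def)

lemma nrm_power2: "(nrm M f)^2 = (\<integral>x. (f x)^2 \<partial>M)"
  by (simp add: nrm_def)

lemma L2_mult_integrable:
  assumes "L2 M f" "L2 M g"
  shows "integrable M (\<lambda>x. f x * g x)"
proof (rule Bochner_Integration.integrable_bound)
  show "integrable M (\<lambda>x. (f x)^2 + (g x)^2)"
    using assms by (simp add: L2_def)
  show "(\<lambda>x. f x * g x) \<in> borel_measurable M"
    using assms by (auto simp: L2_def intro: borel_measurable_times)
  have "\<bar>a * b\<bar> \<le> a^2 + b^2" for a b :: real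
    using sum_squares_bound[of "\<bar>a\<bar>" "\<bar>b\<bar>"] abs_ge_zero[of "a*b"] unfolding abs_mult power2_abs by linarith
  then show "AE x in M. norm (f x * g x) \<le> norm ((f x)^2 + (g x)^2)"
    by (simp add: abs_mult)
qed

lemma L2_cmult: "L2 M f \<Longrightarrow> L2 M (\<lambda>x. c * f x)"
  by (auto simp: L2_def power_mult_distrib intro: borel_measurable_times)

lemma L2_add:
  assumes "L2 M f" "L2 M g"
  shows "L2 M (\<lambda>x. f x + g x)"
proof -
  have "integrable M (\<lambda>x. (f x)^2 + (g x)^2 + 2 * (f x * g x))"
    using assms L2_mult_integrable[OF assms] by (simp add: L2_def)
  then have "integrable M (\<lambda>x. (f x + g x)^2)"
    by (simp add: power2_sum mult.assoc)
  then show ?thesis using assms by (auto simp: L2_def intro: borel_measurable_add)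
qed

lemma L2_diff: "L2 M f \<Longrightarrow> L2 M g \<Longrightarrow> L2 M (\<lambda>x. f x - g x)"
  using L2_add[of M f "\<lambda>x. (-1) * g x"] L2_cmult[of M g "-1"] by simp

lemma L2_zero [simp]: "L2 M (\<lambda>x. 0)"
  by (simp add: L2_def)

lemma L2_sum: "(\<And>i. i \<in> I \<Longrightarrow> L2 M (f i)) \<Longrightarrow> L2 M (\<lambda>x. \<Sum>i\<in>I. f i x)"
  by (induction I rule: infinite_finite_induct) (auto intro: L2_add)

lemma L2_Cauchy_Schwarz_sq:
  assumes "L2 M f" "L2 M g"
  shows "(\<integral>x. f x * g x \<partial>M)^2 \<le> (\<integral>x. (f x)^2 \<partial>M) * (\<integral>x. (g x)^2 \<partial>M)"
proof -
  define a b c where "a = (\<integral>x. (f x)^2 \<partial>M)" "b = (\<integral>x. f x * g x \<partial>M)" "c = (\<integral>x. (g x)^2 \<partial>M)"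
  note int = L2_mult_integrable[OF assms] L2_sq_integrable[OF assms(1)] L2_sq_integrable[OF assms(2)]
  have q: "a * t^2 + 2 * b * t + c \<ge> 0" for t
  proof -
    have "0 \<le> (\<integral>x. (t * f x + g x)^2 \<partial>M)" by simp
    also have "\<dots> = (\<integral>x. t^2 * (f x)^2 + 2 * t * (f x * g x) + (g x)^2 \<partial>M)"
      by (intro Bochner_Integration.integral_cong) (auto simp: power2_eq_square algebra_simps)
    also have "\<dots> = a * t^2 + 2 * b * t + c"
      unfolding a_b_c_def using int by simp
    finally show ?thesis .
  qed
  have "a \<ge> 0" by (simp add: a_b_c_def)
  have "b^2 \<le> a * c"
  proof (cases "a = 0")
    case True
    have "b = 0"
    proof (rule ccontr)
      assume "b \<noteq> 0"
      then show False using q[of "- (c + 1) / (2 * b)"] True by (simp add: field_simps)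
    qed
    then show ?thesis using True by simp
  next
    case False
    then have "a > 0" using \<open>a \<ge> 0\<close> by simp
    then show ?thesis using q[of "- b / a"]
      by (simp add: field_simps power2_eq_square)
  qed
  then show ?thesis by (simp add: a_b_c_def)
qed

lemma L2_Cauchy_Schwarz:
  assumes "L2 M f" "L2 M g"
  shows "\<bar>\<integral>x. f x * g x \<partial>M\<bar> \<le> nrm M f * nrm M g"
  using real_sqrt_le_mono[OF L2_Cauchy_Schwarz_sq[OF assms]]
  by (simp add: nrm_def real_sqrt_mult)

lemma nrm_triangle:
  assumes "L2 M f" "L2 M g"
  shows "nrm M (\<lambda>x. f x + g x) \<le> nrm M f + nrm M g"
proof -
  have "(\<integral>x. (f x + g x)^2 \<partial>M) = (\<integral>x. (f x)^2 + (g x)^2 + 2 * (f x * g x) \<partial>M)"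
    by (simp add: power2_sum mult.assoc)
  also have "\<dots> = (nrm M f)^2 + (nrm M g)^2 + 2 * (\<integral>x. f x * g x \<partial>M)"
    using L2_mult_integrable[OF assms] assms by (simp add: nrm_power2 L2_sq_integrable)
  also have "\<dots> \<le> (nrm M f + nrm M g)^2"
    using L2_Cauchy_Schwarz[OF assms] by (simp add: power2_sum abs_le_iff)
  finally have "(nrm M (\<lambda>x. f x + g x))^2 \<le> (nrm M f + nrm M g)^2"
    by (simp add: nrm_power2)
  then show ?thesis by (rule power2_le_imp_le) simp
qed

lemma nrm_minus_commute: "nrm M (\<lambda>x. f x - g x) = nrm M (\<lambda>x. g x - f x)"
  by (simp add: nrm_def power2_commute)

lemma L2_complete:
  assumes L: "\<And>n. L2 M (f n)"
    and C: "\<And>e. e > 0 \<Longrightarrow> \<exists>N. \<forall>m\<ge>N. \<forall>n\<ge>N. (\<integral>x. (f m x - f n x)^2 \<partial>M) < e"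
  obtains g where "L2 M g" "(\<lambda>n. \<integral>x. (f n x - g x)^2 \<partial>M) \<longlonglongrightarrow> 0"
proof -
  have [measurable]: "f n \<in> borel_measurable M" for n using L by (simp add: L2_def)
  have Ld: "integrable M (\<lambda>x. (f m x - f n x)^2)" for m n
    using L2_diff[OF L L] by (simp add: L2_def)
  have "\<forall>j. \<exists>N. \<forall>m\<ge>N. \<forall>n\<ge>N. (\<integral>x. (f m x - f n x)^2 \<partial>M) < (1/4)^j"
    using C by simp
  then obtain K where K: "\<And>j m n. m \<ge> K j \<Longrightarrow> n \<ge> K j \<Longrightarrow> (\<integral>x. (f m x - f n x)^2 \<partial>M) < (1/4)^j"
    by metis
  define k where "k j = (\<Sum>i\<le>j. K i) + j" for j
  have kj: "j \<le> k j" for j by (simp add: k_def)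
  have "K j \<le> (\<Sum>i\<le>j. K i)" for j by (intro member_le_sum) auto
  then have kK: "K j \<le> k j" "K j \<le> k (Suc j)" for j
    by (simp_all add: k_def le_SucI trans_le_add1)
  define d where "d j x = f (k (Suc j)) x - f (k j) x" for j x
  have [measurable]: "d j \<in> borel_measurable M" for j by (simp add: d_def[abs_def])
  have dint: "integrable M (\<lambda>x. (d j x)^2)" for j by (simp add: d_def Ld)
  have dsmall: "(\<integral>x. (d j x)^2 \<partial>M) \<le> (1/4)^j" for j
    unfolding d_def using K[OF kK(2) kK(1)] by (rule less_imp_le)
  have nn: "(\<integral>\<^sup>+x. ennreal (2^j * (d j x)^2) \<partial>M) \<le> ennreal ((1/2)^j)" for j
  proof -
    have "(\<integral>\<^sup>+x. ennreal (2^j * (d j x)^2) \<partial>M) = ennreal (\<integral>x. 2^j * (d j x)^2 \<partial>M)"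
      using dint by (intro nn_integral_eq_integral) auto
    also have "\<dots> \<le> ennreal ((1/2)^j)"
    proof (rule ennreal_leI)
      have "(\<integral>x. 2^j * (d j x)^2 \<partial>M) \<le> 2^j * (1/4)^j"
        using dsmall[of j] by simp
      also have "\<dots> = (1/2)^j" by (simp add: power_mult_distrib[symmetric])
      finally show "(\<integral>x. 2^j * (d j x)^2 \<partial>M) \<le> (1/2)^j" .
    qed
    finally show ?thesis .
  qed
  have "(\<integral>\<^sup>+x. (\<Sum>j. ennreal (2^j * (d j x)^2)) \<partial>M) = (\<Sum>j. \<integral>\<^sup>+x. ennreal (2^j * (d j x)^2) \<partial>M)"
    by (rule nn_integral_suminf) simp
  also have "\<dots> \<le> (\<Sum>j. ennreal ((1/2)^j))"
    using nn by (intro suminf_le) auto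
  also have "\<dots> = ennreal (\<Sum>j. (1/2)^j)"
    by (intro suminf_ennreal2) (auto intro: summable_geometric)
  also have "\<dots> < \<infinity>" by simp
  finally have "AE x in M. (\<Sum>j. ennreal (2^j * (d j x)^2)) \<noteq> \<infinity>"
    by (intro nn_integral_PInf_AE) auto
  moreover have "convergent (\<lambda>j. f (k j) x)" if "(\<Sum>j. ennreal (2^j * (d j x)^2)) \<noteq> \<infinity>" for x
  proof -
    have "summable (\<lambda>j. 2^j * (d j x)^2)"
      using that by (intro summable_suminf_not_top) auto
    then have s: "summable (\<lambda>j. (1/2)^j + 2^j * (d j x)^2)"
      by (intro summable_add) (auto intro: summable_geometric)
    have "norm (d j x) \<le> (1/2)^j + 2^j * (d j x)^2" for j
    proof -
      have "2 * \<bar>d j x\<bar> \<le> (1/2)^j + 2^j * (d j x)^2"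
      proof -
        have "0 \<le> (1/2)^j * (1 - 2^j * \<bar>d j x\<bar>)^2" by simp
        also have "\<dots> = (1/2)^j - 2 * \<bar>d j x\<bar> + 2^j * (d j x)^2"
        proof -
          have "(1/2::real)^j * 2^j = 1" by (simp add: power_mult_distrib[symmetric])
          moreover have "a * (1 - b * t)^2 = a - 2 * (a * b) * t + (a * b) * b * t^2" for a b t :: real
            by (simp add: power2_eq_square algebra_simps)
          ultimately have "(1/2)^j * (1 - 2^j * t)^2 = (1/2)^j - 2 * t + 2^j * t^2" for t :: real
            by simp
          then show ?thesis by simp
        qed
        finally show ?thesis by simp
      qed
      then show ?thesis using abs_ge_zero[of "d j x"] by simp
    qed
    then have "summable (\<lambda>j. d j x)"
      by (intro summable_comparison_test[OF _ s]) auto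
    then have "convergent (\<lambda>n. \<Sum>j<n. d j x)" by (simp add: summable_iff_convergent)
    then obtain l where "(\<lambda>n. \<Sum>j<n. d j x) \<longlonglongrightarrow> l" by (auto simp: convergent_def)
    then have "(\<lambda>n. (\<Sum>j<n. d j x) + f (k 0) x) \<longlonglongrightarrow> l + f (k 0) x" by (intro tendsto_intros)
    moreover have "(\<Sum>j<n. d j x) + f (k 0) x = f (k n) x" for n
      using sum_lessThan_telescope[of "\<lambda>j. f (k j) x" n] by (simp add: d_def)
    ultimately show ?thesis by (auto simp: convergent_def)
  qed
  ultimately have AEc: "AE x in M. convergent (\<lambda>j. f (k j) x)" by auto
  define g where "g x = lim (\<lambda>j. f (k j) x)" for x
  have [measurable]: "g \<in> borel_measurable M" unfolding g_def[abs_def] by measurable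
  have AEl: "AE x in M. (\<lambda>j. f (k j) x) \<longlonglongrightarrow> g x"
    using AEc unfolding g_def by (auto simp: convergent_LIMSEQ_iff)
  have est: "(\<integral>x. (f m x - g x)^2 \<partial>M) \<le> e \<and> L2 M (\<lambda>x. f m x - g x)"
    if e: "e > 0" and N: "\<forall>m\<ge>N. \<forall>n\<ge>N. (\<integral>x. (f m x - f n x)^2 \<partial>M) < e" and m: "m \<ge> N" for e N m
  proof -
    have "(\<integral>\<^sup>+x. ennreal ((f m x - g x)^2) \<partial>M) = (\<integral>\<^sup>+x. liminf (\<lambda>j. ennreal ((f m x - f (k j) x)^2)) \<partial>M)"
    proof (rule nn_integral_cong_AE, use AEl in eventually_elim)
      fix x assume "(\<lambda>j. f (k j) x) \<longlonglongrightarrow> g x"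
      then have "(\<lambda>j. ennreal ((f m x - f (k j) x)^2)) \<longlonglongrightarrow> ennreal ((f m x - g x)^2)"
        by (intro tendsto_intros)
      then show "ennreal ((f m x - g x)^2) = liminf (\<lambda>j. ennreal ((f m x - f (k j) x)^2))"
        by (rule lim_imp_Liminf[OF trivial_limit_sequentially, symmetric])
    qed
    also have "\<dots> \<le> liminf (\<lambda>j. \<integral>\<^sup>+x. ennreal ((f m x - f (k j) x)^2) \<partial>M)"
      by (rule nn_integral_liminf) simp
    also have "\<dots> \<le> liminf (\<lambda>j. ennreal e)"
    proof (rule Liminf_mono)
      have "(\<integral>\<^sup>+x. ennreal ((f m x - f (k j) x)^2) \<partial>M) \<le> ennreal e" if "j \<ge> N" for j
      proof -
        have "k j \<ge> N" using that kj[of j] by simp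
        then have "(\<integral>x. (f m x - f (k j) x)^2 \<partial>M) < e" using N m by blast
        then show ?thesis using Ld[of m "k j"]
          by (subst nn_integral_eq_integral) (auto intro: ennreal_leI)
      qed
      then show "eventually (\<lambda>j. (\<integral>\<^sup>+x. ennreal ((f m x - f (k j) x)^2) \<partial>M) \<le> ennreal e) sequentially"
        by (auto simp: eventually_sequentially)
    qed
    also have "\<dots> = ennreal e" by (simp add: Liminf_const)
    finally have le: "(\<integral>\<^sup>+x. ennreal ((f m x - g x)^2) \<partial>M) \<le> ennreal e" .
    have i: "integrable M (\<lambda>x. (f m x - g x)^2)"
      by (rule integrableI_nonneg) (use le in \<open>auto simp: top_unique less_top[symmetric]\<close>)
    then have "(\<integral>x. (f m x - g x)^2 \<partial>M) \<le> e"
      using le e by (subst (asm) nn_integral_eq_integral) (auto simp: ennreal_le_iff)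
    then show ?thesis using i by (simp add: L2_def)
  qed
  show ?thesis
  proof (rule that[of g])
    obtain N where N: "\<forall>m\<ge>N. \<forall>n\<ge>N. (\<integral>x. (f m x - f n x)^2 \<partial>M) < 1" using C[of 1] by auto
    have "L2 M (\<lambda>x. f N x - g x)" using est[OF zero_less_one N order.refl] by blast
    then have "L2 M (\<lambda>x. f N x - (f N x - g x))" by (rule L2_diff[OF L])
    then show "L2 M g" by simp
    show "(\<lambda>n. \<integral>x. (f n x - g x)^2 \<partial>M) \<longlonglongrightarrow> 0"
    proof (rule LIMSEQ_I)
      fix r :: real assume "r > 0"
      then obtain N where N: "\<forall>m\<ge>N. \<forall>n\<ge>N. (\<integral>x. (f m x - f n x)^2 \<partial>M) < r/2" using C[of "r/2"] by auto
      have "norm ((\<integral>x. (f n x - g x)^2 \<partial>M) - 0) < r" if "n \<ge> N" for n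
        using est[OF _ N that] \<open>r > 0\<close> by simp
      then show "\<exists>no. \<forall>n\<ge>no. norm ((\<integral>x. (f n x - g x)^2 \<partial>M) - 0) < r" by blast
    qed
  qed
qed

lemma L2_AE_subseq:
  assumes "\<And>n. L2 M (f n)" "(\<lambda>n. \<integral>x. (f n x)^2 \<partial>M) \<longlonglongrightarrow> 0"
  obtains r :: "nat \<Rightarrow> nat" where "strict_mono r" "AE x in M. (\<lambda>n. f (r n) x) \<longlonglongrightarrow> 0"
proof -
  obtain r :: "nat \<Rightarrow> nat" where r: "strict_mono r" "AE x in M. (\<lambda>n. (f (r n) x)^2) \<longlonglongrightarrow> 0"
    using tendsto_L1_AE_subseq[of M "\<lambda>n x. (f n x)^2"] assms by (auto simp: L2_def)
  have "AE x in M. (\<lambda>n. f (r n) x) \<longlonglongrightarrow> 0"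
    using r(2)
  proof eventually_elim
    fix x assume "(\<lambda>n. (f (r n) x)^2) \<longlonglongrightarrow> 0"
    then have "(\<lambda>n. sqrt ((f (r n) x)^2)) \<longlonglongrightarrow> sqrt 0" by (intro tendsto_intros)
    then show "(\<lambda>n. f (r n) x) \<longlonglongrightarrow> 0" by (simp add: tendsto_rabs_zero_iff)
  qed
  then show ?thesis using r(1) that by blast
qed

section \<open>Convex combinations of tails of a sequence\<close>

definition tail_weights :: "nat \<Rightarrow> nat \<Rightarrow> (nat \<Rightarrow> real) \<Rightarrow> bool" where
  "tail_weights n N w \<longleftrightarrow> (\<forall>i. w i \<ge> 0) \<and> (\<forall>i<n. w i = 0) \<and> (\<forall>i\<ge>N. w i = 0) \<and> (\<Sum>i<N. w i) = 1"

lemma tail_weights_sum_extend: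
  assumes "tail_weights n N w" "N \<le> N'"
  shows "(\<Sum>i<N'. w i * a i) = (\<Sum>i<N. w i * (a i :: real))"
  using assms by (intro sum.mono_neutral_right) (auto simp: tail_weights_def)

lemma tail_weights_sum_bound:
  assumes w: "tail_weights n N w" and a: "\<And>i. i \<ge> n \<Longrightarrow> a i \<le> (c::real)"
  shows "(\<Sum>i<N. w i * a i) \<le> c"
proof -
  have "(\<Sum>i<N. w i * a i) \<le> (\<Sum>i<N. w i * c)"
  proof (rule sum_mono)
    fix i
    show "w i * a i \<le> w i * c"
      using w a[of i] by (cases "i < n") (auto simp: tail_weights_def intro: mult_left_mono)
  qed
  also have "\<dots> = c" using w by (simp add: tail_weights_def sum_distrib_right[symmetric])
  finally show ?thesis .
qed

lemma tail_weights_sum_abs: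
  assumes w: "tail_weights n N w"
  shows "\<bar>(\<Sum>i<N. w i * a i) - c\<bar> \<le> (\<Sum>i<N. w i * \<bar>a i - (c::real)\<bar>)"
proof -
  have "(\<Sum>i<N. w i * a i) - c = (\<Sum>i<N. w i * a i) - (\<Sum>i<N. w i) * c"
    using w by (simp add: tail_weights_def)
  also have "\<dots> = (\<Sum>i<N. w i * (a i - c))"
    by (simp add: sum_distrib_right sum_subtractf right_diff_distrib)
  finally have "\<bar>(\<Sum>i<N. w i * a i) - c\<bar> \<le> (\<Sum>i<N. \<bar>w i * (a i - c)\<bar>)" by simp
  also have "\<dots> = (\<Sum>i<N. w i * \<bar>a i - c\<bar>)"
    using w by (simp add: abs_mult tail_weights_def)
  finally show ?thesis .
qed

lemma tail_weights_tendsto: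
  assumes w: "\<And>n. tail_weights n (N n) (w n)" and a: "a \<longlonglongrightarrow> (l::real)"
  shows "(\<lambda>n. \<Sum>i<N n. w n i * a i) \<longlonglongrightarrow> l"
proof (rule LIMSEQ_I)
  fix e :: real assume "e > 0"
  then obtain n0 where n0: "\<And>i. i \<ge> n0 \<Longrightarrow> \<bar>a i - l\<bar> < e/2" using LIMSEQ_D[OF a, of "e/2"] by auto
  have "norm ((\<Sum>i<N n. w n i * a i) - l) < e" if "n \<ge> n0" for n
  proof -
    have "(\<Sum>i<N n. w n i * \<bar>a i - l\<bar>) \<le> e/2"
      using n0 that by (intro tail_weights_sum_bound[OF w]) (auto intro: less_imp_le)
    then show ?thesis using tail_weights_sum_abs[OF w[of n], of a l] \<open>e > 0\<close> by simp
  qed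
  then show "\<exists>no. \<forall>n\<ge>no. norm ((\<Sum>i<N n. w n i * a i) - l) < e" by blast
qed

lemma tail_weights_Jensen:
  assumes w: "tail_weights n N w"
  shows "(\<Sum>i<N. w i * a i)^2 \<le> (\<Sum>i<N. w i * (a i :: real)^2)"
proof -
  have "(\<Sum>i<N. sqrt (w i) * (sqrt (w i) * a i))^2 \<le> (\<Sum>i<N. (sqrt (w i))^2) * (\<Sum>i<N. (sqrt (w i) * a i)^2)"
    by (rule Cauchy_Schwarz_ineq_sum)
  then show ?thesis using w
    by (simp add: tail_weights_def power_mult_distrib mult.assoc[symmetric])
qed

text \<open>A substitute for weak compactness (Mazur): convex combinations of the tails with almost minimal
  norm form a Cauchy sequence by the parallelogram law.\<close>
lemma convex_tails_convergent:
  assumes L: "\<And>n. L2 M (f n)" and C: "\<And>n. (\<integral>x. (f n x)^2 \<partial>M) \<le> C"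
  obtains w N g where "\<And>n. tail_weights n (N n) (w n)" "L2 M g"
    "(\<lambda>n. \<integral>x. ((\<Sum>i<N n. w n i * f i x) - g x)^2 \<partial>M) \<longlonglongrightarrow> 0"
proof -
  define h where "h N w x = (\<Sum>i<N. w i * f i x)" for N :: nat and w x
  have Lh: "L2 M (h N w)" for N w unfolding h_def by (intro L2_sum L2_cmult L)
  define S where "S n = {(\<integral>x. (h N w x)^2 \<partial>M) |N w. tail_weights n N w}" for n
  define d where "d n = Inf (S n)" for n
  have bdd: "bdd_below (S n)" for n by (rule bdd_belowI[of _ 0]) (auto simp: S_def)
  have dl: "d n \<le> (\<integral>x. (h N w x)^2 \<partial>M)" if "tail_weights n N w" for n N w
    unfolding d_def using that by (intro cInf_lower bdd) (auto simp: S_def)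
  have unit: "tail_weights n (Suc n) (\<lambda>i. if i = n then 1 else 0)" for n
    by (auto simp: tail_weights_def)
  have ne: "S n \<noteq> {}" for n using unit[of n] by (auto simp: S_def)
  have dC: "d n \<le> C" for n
  proof -
    have "h (Suc n) (\<lambda>i. if i = n then 1 else 0) = f n"
      by (auto simp: h_def fun_eq_iff if_distrib[of "\<lambda>a. a * _"] cong: if_cong)
    then show ?thesis using dl[OF unit[of n]] C[of n] by simp
  qed
  have "incseq d"
  proof (rule incseq_SucI)
    fix n
    show "d n \<le> d (Suc n)" unfolding d_def
    proof (rule cInf_superset_mono[OF ne bdd])
      have m: "tail_weights (Suc n) N w \<Longrightarrow> tail_weights n N w" for N w by (simp add: tail_weights_def)
      show "S (Suc n) \<subseteq> S n"
      proof
        fix y assume "y \<in> S (Suc n)"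
        then obtain N w where "y = (\<integral>x. (h N w x)^2 \<partial>M)" "tail_weights (Suc n) N w"
          unfolding S_def by auto
        then show "y \<in> S n" unfolding S_def using m by (intro CollectI exI conjI)
      qed
    qed
  qed
  then obtain D where D: "d \<longlonglongrightarrow> D" using incseq_convergent[of d C] dC by blast
  define ep where "ep n = 1 / real (Suc n)" for n
  have epos: "ep n > 0" for n by (simp add: ep_def)
  have epm: "ep m \<le> ep n" if "n \<le> m" for n m using that by (simp add: ep_def field_simps)
  have "\<forall>n. \<exists>N w. tail_weights n N w \<and> (\<integral>x. (h N w x)^2 \<partial>M) < d n + ep n"
  proof
    fix n
    have "Inf (S n) < d n + ep n" using epos[of n] by (simp add: d_def)
    then show "\<exists>N w. tail_weights n N w \<and> (\<integral>x. (h N w x)^2 \<partial>M) < d n + ep n"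
      using ne[of n] bdd[of n] by (subst (asm) cInf_less_iff) (auto simp: S_def)
  qed
  then obtain N w where w: "\<And>n. tail_weights n (N n) (w n)"
    and wl: "\<And>n. (\<integral>x. (h (N n) (w n) x)^2 \<partial>M) < d n + ep n" by metis
  define H where "H n = h (N n) (w n)" for n
  have LH: "L2 M (H n)" for n unfolding H_def by (rule Lh)
  have key: "(\<integral>x. (H n x - H m x)^2 \<partial>M) \<le> 2 * (d m - d n) + 4 * ep n" if nm: "n \<le> m" for n m
  proof -
    define K where "K = max (N n) (N m)"
    define v where "v i = (w n i + w m i) / 2" for i
    have s: "(\<Sum>i<K. w n i) = 1" "(\<Sum>i<K. w m i) = 1"
      using tail_weights_sum_extend[OF w[of n], of K "\<lambda>_. 1"] tail_weights_sum_extend[OF w[of m], of K "\<lambda>_. 1"]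
        w[of n] w[of m] by (auto simp: K_def tail_weights_def)
    have "tail_weights n K v"
      using w[of n] w[of m] nm s
      by (auto simp: tail_weights_def v_def K_def sum_divide_distrib[symmetric] sum.distrib)
    then have "d n \<le> (\<integral>x. (h K v x)^2 \<partial>M)" by (rule dl)
    moreover have "h K v x = (H n x + H m x) / 2" for x
    proof -
      have "H n x = h K (w n) x" "H m x = h K (w m) x"
        unfolding H_def h_def K_def
        by (auto intro!: tail_weights_sum_extend[OF w, symmetric])
      then have "(H n x + H m x) / 2 = (\<Sum>i<K. (w n i * f i x + w m i * f i x) / 2)"
        by (simp add: h_def sum.distrib sum_divide_distrib add_divide_distrib)
      then show ?thesis unfolding h_def v_def by (simp add: distrib_right)
    qed
    ultimately have a: "4 * d n \<le> (\<integral>x. (H n x + H m x)^2 \<partial>M)" by (simp add: power_divide)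
    have "(\<integral>x. (H n x - H m x)^2 \<partial>M) + (\<integral>x. (H n x + H m x)^2 \<partial>M)
        = (\<integral>x. (H n x - H m x)^2 + (H n x + H m x)^2 \<partial>M)"
      using L2_sq_integrable[OF L2_diff[OF LH LH]] L2_sq_integrable[OF L2_add[OF LH LH]] by simp
    also have "\<dots> = (\<integral>x. 2 * (H n x)^2 + 2 * (H m x)^2 \<partial>M)"
      by (intro Bochner_Integration.integral_cong) (auto simp: power2_eq_square algebra_simps)
    also have "\<dots> = 2 * (\<integral>x. (H n x)^2 \<partial>M) + 2 * (\<integral>x. (H m x)^2 \<partial>M)"
      using L2_sq_integrable[OF LH] by simp
    also have "\<dots> \<le> 2 * (d n + ep n) + 2 * (d m + ep n)"
    proof -
      have "(\<integral>x. (H n x)^2 \<partial>M) \<le> d n + ep n" unfolding H_def by (rule less_imp_le[OF wl])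
      moreover have "(\<integral>x. (H m x)^2 \<partial>M) \<le> d m + ep m" unfolding H_def by (rule less_imp_le[OF wl])
      moreover note epm[OF nm]
      ultimately show ?thesis by (intro add_mono mult_left_mono) auto
    qed
    finally show ?thesis using a unfolding distrib_left right_diff_distrib by linarith
  qed
  have "\<exists>N. \<forall>m\<ge>N. \<forall>n\<ge>N. (\<integral>x. (H m x - H n x)^2 \<partial>M) < e" if "e > 0" for e
  proof -
    have "\<forall>\<^sub>F n in sequentially. \<bar>d n - D\<bar> < e / 8"
      using tendstoD[OF D, of "e/8"] that by (simp add: dist_real_def)
    moreover have "(\<lambda>n. 4 * ep n) \<longlonglongrightarrow> 0"
      using tendsto_mult[OF tendsto_const[of 4] LIMSEQ_inverse_real_of_nat] by (simp add: ep_def divide_inverse)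
    then have "\<forall>\<^sub>F n in sequentially. 4 * ep n < e / 2"
      by (rule order_tendstoD(2)) (use that in simp)
    ultimately have "\<forall>\<^sub>F n in sequentially. \<bar>d n - D\<bar> < e / 8 \<and> 4 * ep n < e / 2"
      by (rule eventually_conj)
    then obtain N where N: "\<And>n. n \<ge> N \<Longrightarrow> \<bar>d n - D\<bar> < e / 8 \<and> 4 * ep n < e / 2"
      by (auto simp: eventually_sequentially)
    have "(\<integral>x. (H n x - H m x)^2 \<partial>M) < e" if "n \<ge> N" "n \<le> m" for n m
      using key[OF that(2)] N[OF that(1)] N[OF order.trans[OF that]] that unfolding abs_less_iff right_diff_distrib by linarith
    moreover have "(\<integral>x. (H n x - H m x)^2 \<partial>M) = (\<integral>x. (H m x - H n x)^2 \<partial>M)" for n m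
      by (subst power2_commute) simp
    ultimately have "(\<integral>x. (H m x - H n x)^2 \<partial>M) < e" if "n \<ge> N" "m \<ge> N" for n m
      using that by (metis nle_le)
    then show ?thesis by blast
  qed
  then obtain g where "L2 M g" "(\<lambda>n. \<integral>x. (H n x - g x)^2 \<partial>M) \<longlonglongrightarrow> 0"
    by (rule L2_complete[OF LH])
  then show ?thesis using that[of N w g] w by (simp add: H_def h_def)
qed

section \<open>Absolute continuity\<close>

definition intervals :: "real \<Rightarrow> real \<Rightarrow> nat \<Rightarrow> (nat \<Rightarrow> real) \<Rightarrow> (nat \<Rightarrow> real) \<Rightarrow> bool" where
  "intervals a b n s e \<longleftrightarrow> (\<forall>i<n. a \<le> s i \<and> s i \<le> e i \<and> e i \<le> b) \<and>
     (\<forall>i<n. \<forall>j<n. i \<noteq> j \<longrightarrow> e i \<le> s j \<or> e j \<le> s i)"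

definition ac :: "(real \<Rightarrow> real \<Rightarrow> real) \<Rightarrow> real \<Rightarrow> real \<Rightarrow> bool" where
  "ac D a b \<longleftrightarrow> (\<forall>\<epsilon>>0. \<exists>\<delta>>0. \<forall>n s e. intervals a b n s e \<and> (\<Sum>i<n. e i - s i) < \<delta>
      \<longrightarrow> (\<Sum>i<n. D (s i) (e i)) < \<epsilon>)"

lemma ac_dominated:
  assumes ac: "ac D a b" and L: "L \<ge> 0"
    and le: "\<And>s e. a \<le> s \<Longrightarrow> s \<le> e \<Longrightarrow> e \<le> b \<Longrightarrow> D' s e \<le> L * (D s e + (e - s))"
  shows "ac D' a b"
  unfolding ac_def
proof (intro allI impI)
  fix \<epsilon> :: real assume "\<epsilon> > 0"
  define \<eta> where "\<eta> = \<epsilon> / (2 * (L + 1))"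
  have eta: "\<eta> > 0" using \<open>\<epsilon> > 0\<close> L by (simp add: \<eta>_def)
  have "L * (2 * \<eta>) < (L + 1) * (2 * \<eta>)" using eta by simp
  also have "\<dots> = \<epsilon>" using L by (simp add: \<eta>_def field_simps)
  finally have small: "L * (2 * \<eta>) < \<epsilon>" .
  obtain \<delta> where "\<delta> > 0" and \<delta>: "\<And>n s e. intervals a b n s e \<Longrightarrow> (\<Sum>i<n. e i - s i) < \<delta>
      \<Longrightarrow> (\<Sum>i<n. D (s i) (e i)) < \<eta>"
    using ac eta unfolding ac_def by meson
  show "\<exists>\<delta>>0. \<forall>n s e. intervals a b n s e \<and> (\<Sum>i<n. e i - s i) < \<delta> \<longrightarrow> (\<Sum>i<n. D' (s i) (e i)) < \<epsilon>"
  proof (intro exI[of _ "min \<delta> \<eta>"] conjI allI impI; (elim conjE)?)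
    show "min \<delta> \<eta> > 0" using eta \<open>\<delta> > 0\<close> by simp
    fix n s e assume i: "intervals a b n s e" and sm: "(\<Sum>i<n. e i - s i) < min \<delta> \<eta>"
    have "(\<Sum>i<n. D' (s i) (e i)) \<le> (\<Sum>i<n. L * (D (s i) (e i) + (e i - s i)))"
      using i by (intro sum_mono le) (auto simp: intervals_def)
    also have "\<dots> = L * ((\<Sum>i<n. D (s i) (e i)) + (\<Sum>i<n. e i - s i))"
      by (simp add: sum_distrib_left[symmetric] sum.distrib)
    also have "\<dots> \<le> L * (2 * \<eta>)"
      using \<delta>[OF i] sm L by (intro mult_left_mono) auto
    finally show "(\<Sum>i<n. D' (s i) (e i)) < \<epsilon>" using small by simp
  qed
qed

lemma sum_integral_intervals_le:
  fixes G :: "real \<Rightarrow> real"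
  assumes i: "intervals a b n s e" and G: "G integrable_on {a..b}" and G0: "\<And>x. G x \<ge> 0"
  shows "(\<Sum>i<n. integral {s i..e i} G) \<le> integral {a..b} G"
proof -
  define H where "H i x = (if x \<in> {s i<..<e i} then G x else 0)" for i x
  have sub: "{s i<..<e i} \<subseteq> {a..b}" if "i < n" for i using i that by (force simp: intervals_def)
  have Gs: "G integrable_on {s i..e i}" if "i < n" for i
    using i that by (intro integrable_subinterval_real[OF G]) (auto simp: intervals_def)
  have Hi: "H i integrable_on {a..b}" if "i < n" for i
  proof -
    have "G integrable_on {s i<..<e i}" using Gs[OF that] by (simp add: integrable_on_open_interval_real)
    then show ?thesis unfolding H_def integrable_restrict_Int
      using sub[OF that] by (simp add: Int_absorb2)
  qed
  have "(\<Sum>i<n. integral {s i..e i} G) = (\<Sum>i<n. integral {a..b} (H i))"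
  proof (intro sum.cong refl)
    fix i assume "i \<in> {..<n}"
    then show "integral {s i..e i} G = integral {a..b} (H i)"
      unfolding H_def integral_restrict_Int integral_open_interval_real[of "s i"]
      using sub[of i] by (simp add: Int_absorb2)
  qed
  also have "\<dots> = integral {a..b} (\<lambda>x. \<Sum>i<n. H i x)"
    using Hi by (intro integral_sum[symmetric]) auto
  also have "\<dots> \<le> integral {a..b} G"
  proof (rule integral_le)
    show "(\<lambda>x. \<Sum>i<n. H i x) integrable_on {a..b}" using Hi by (intro integrable_sum) auto
    fix x
    show "(\<Sum>i<n. H i x) \<le> G x"
    proof (cases "\<exists>i<n. x \<in> {s i<..<e i}")
      case True
      then obtain i where i': "i < n" "x \<in> {s i<..<e i}" by auto
      have "(\<Sum>j<n. H j x) = (\<Sum>j\<in>{i}. H j x)"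
      proof (rule sum.mono_neutral_right)
        show "\<forall>j\<in>{..<n} - {i}. H j x = 0"
        proof
          fix j assume "j \<in> {..<n} - {i}"
          then have "e i \<le> s j \<or> e j \<le> s i" using i i' by (auto simp: intervals_def)
          then show "H j x = 0" using i' by (auto simp: H_def)
        qed
      qed (use i' in auto)
      then show ?thesis using i' by (simp add: H_def)
    next
      case False
      then have "(\<Sum>i<n. H i x) = 0" by (intro sum.neutral) (auto simp: H_def)
      then show ?thesis using G0 by simp
    qed
  qed (rule G)
  finally show ?thesis .
qed

lemma ac_sqrt_integral:
  fixes G :: "real \<Rightarrow> real"
  assumes G: "G integrable_on {a..b}" and G0: "\<And>x. G x \<ge> 0"
    and le: "\<And>s e. a \<le> s \<Longrightarrow> s \<le> e \<Longrightarrow> e \<le> b \<Longrightarrow> (D s e)^2 \<le> (e - s) * integral {s..e} G"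
  shows "ac D a b"
  unfolding ac_def
proof (intro allI impI)
  fix \<epsilon> :: real assume "\<epsilon> > 0"
  define C where "C = integral {a..b} G + 1"
  have C: "C > 0" using integral_nonneg[OF G] G0 by (simp add: C_def add_nonneg_pos)
  show "\<exists>\<delta>>0. \<forall>n s e. intervals a b n s e \<and> (\<Sum>i<n. e i - s i) < \<delta> \<longrightarrow> (\<Sum>i<n. D (s i) (e i)) < \<epsilon>"
  proof (intro exI[of _ "\<epsilon>^2 / C"] conjI allI impI; (elim conjE)?)
    show "\<epsilon>^2 / C > 0" using C \<open>\<epsilon> > 0\<close> by simp
    fix n s e assume i: "intervals a b n s e" and sm: "(\<Sum>i<n. e i - s i) < \<epsilon>^2 / C"
    define p q where "p i = sqrt (e i - s i)" "q i = sqrt (integral {s i..e i} G)" for i :: nat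
    have nn: "e i - s i \<ge> 0" "integral {s i..e i} G \<ge> 0" if "i < n" for i
    proof -
      show "e i - s i \<ge> 0" using i that by (auto simp: intervals_def)
      have "G integrable_on {s i..e i}"
        using i that by (intro integrable_subinterval_real[OF G]) (auto simp: intervals_def)
      then show "integral {s i..e i} G \<ge> 0" using G0 by (intro integral_nonneg) auto
    qed
    have "(\<Sum>i<n. D (s i) (e i)) \<le> (\<Sum>i<n. p i * q i)"
    proof (rule sum_mono)
      fix j assume j: "j \<in> {..<n}"
      then have "(D (s j) (e j))^2 \<le> (e j - s j) * integral {s j..e j} G"
        using i by (intro le) (auto simp: intervals_def)
      then have "sqrt ((D (s j) (e j))^2) \<le> sqrt ((e j - s j) * integral {s j..e j} G)"
        by (rule real_sqrt_le_mono)
      then show "D (s j) (e j) \<le> p j * q j" by (simp add: p_q_def real_sqrt_mult)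
    qed
    also have "\<dots> < \<epsilon>"
    proof (rule power2_less_imp_less)
      have "(\<Sum>i<n. p i * q i)^2 \<le> (\<Sum>i<n. (p i)^2) * (\<Sum>i<n. (q i)^2)"
        by (rule Cauchy_Schwarz_ineq_sum)
      also have "\<dots> = (\<Sum>i<n. e i - s i) * (\<Sum>i<n. integral {s i..e i} G)"
        using nn by (simp add: p_q_def)
      also have "\<dots> \<le> (\<Sum>i<n. e i - s i) * C"
        using sum_integral_intervals_le[OF i G G0] nn
        by (intro mult_left_mono sum_nonneg) (auto simp: C_def)
      also have "\<dots> < \<epsilon>^2" using sm C by (simp add: field_simps)
      finally show "(\<Sum>i<n. p i * q i)^2 < \<epsilon>^2" .
    qed (use \<open>\<epsilon> > 0\<close> in simp)
    finally show "(\<Sum>i<n. D (s i) (e i)) < \<epsilon>" .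
  qed
qed

lemma sum_length_intervals_le:
  assumes i: "intervals a b n s e" and T: "T \<in> lmeasurable"
    and sub: "\<And>i. i < n \<Longrightarrow> {s i<..<e i} \<subseteq> T"
  shows "(\<Sum>i<n. e i - s i) \<le> measure lebesgue T"
proof -
  have "(\<Sum>i<n. e i - s i) = (\<Sum>i<n. measure lebesgue {s i<..<e i})"
    using i by (intro sum.cong) (auto simp: intervals_def)
  also have "\<dots> = measure lebesgue (\<Union>i<n. {s i<..<e i})"
  proof (rule measure_finite_Union[symmetric])
    show "disjoint_family_on (\<lambda>i. {s i<..<e i}) {..<n}"
      using i by (fastforce simp: disjoint_family_on_def intervals_def)
  qed (use i in \<open>auto simp: intervals_def\<close>)
  also have "\<dots> \<le> measure lebesgue T"
    using sub T by (intro measure_mono_fmeasurable) auto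
  finally show ?thesis .
qed

theorem ac_has_integral_derivative:
  fixes f f' :: "real \<Rightarrow> real"
  assumes ac: "ac (\<lambda>s e. \<bar>f e - f s\<bar>) a b" and ab: "a \<le> b" and N: "negligible N"
    and d: "\<And>x. x \<in> {a..b} - N \<Longrightarrow> (f has_real_derivative f' x) (at x within {a..b})"
  shows "(f' has_integral (f b - f a)) {a..b}"
proof -
  define g where "g x = (if x \<in> N then 0 else f' x)" for x
  have "(g has_integral (f b - f a)) {a..b}"
    unfolding has_integral_factor_content_real
  proof (intro allI impI)
    fix e :: real assume e: "e > 0"
    show "\<exists>d. gauge d \<and> (\<forall>p. p tagged_division_of {a..b} \<and> d fine p \<longrightarrow>
        norm ((\<Sum>(x, k)\<in>p. measure lborel k *\<^sub>R g x) - (f b - f a)) \<le> e * measure lborel {a..b})"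
    proof (cases "a = b")
      case True
      have "norm ((\<Sum>(x, k)\<in>p. measure lborel k *\<^sub>R g x) - (f b - f a)) \<le> e * measure lborel {a..b}"
        if ptd: "p tagged_division_of {a..b}" for p
      proof -
        have "(\<Sum>(x, k)\<in>p. measure lborel k *\<^sub>R g x) = 0"
        proof (rule sum.neutral, safe)
          fix x k assume "(x, k) \<in> p"
          note xkp = this
          obtain u v where "k = cbox u v" using tagged_division_ofD(4)[OF ptd xkp] by auto
          moreover have "k \<subseteq> {b..b}" using tagged_division_ofD(3)[OF ptd xkp] True by simp
          ultimately obtain u v where "k = cbox u v" "k \<subseteq> {b..b}" by auto
          then have "k = {u..v}" "k \<subseteq> {b}" by auto
          then have "measure lborel k = 0" by (cases "u < v") (auto simp: subset_singleton_iff Icc_eq_Icc)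
          then show "measure lborel k *\<^sub>R g x = 0" by simp
        qed
        then show ?thesis using True by simp
      qed
      then show ?thesis by (intro exI[of _ "\<lambda>_. UNIV"]) (auto simp: gauge_def)
    next
      case False
      then have ab': "a < b" using ab by simp
      define \<eta> where "\<eta> = e * (b - a) / 2"
      have "\<eta> > 0" using ab' e by (simp add: \<eta>_def)
      then obtain \<delta> where "\<delta> > 0" and \<delta>: "\<And>n s e. intervals a b n s e \<Longrightarrow> (\<Sum>i<n. e i - s i) < \<delta>
          \<Longrightarrow> (\<Sum>i<n. \<bar>f (e i) - f (s i)\<bar>) < \<eta>"
        using ac unfolding ac_def by meson
      have Nn: "N \<in> null_sets lebesgue" using N by (simp add: negligible_iff_null_sets)
      then obtain T where T: "open T" "N \<subseteq> T" "T - N \<in> lmeasurable" "emeasure lebesgue (T - N) < ennreal \<delta>"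
        using sets_lebesgue_outer_open[of N \<delta>] \<open>\<delta> > 0\<close> by (auto simp: null_sets_def)
      have TT: "T = (T - N) \<union> N" using T by auto
      have "T \<in> lmeasurable" unfolding TT[symmetric] using T(3) Nn TT
        by (metis fmeasurable.Un negligible_iff_measure negligible_iff_null_sets)
      have mT: "measure lebesgue T < \<delta>"
      proof -
        have "emeasure lebesgue T = emeasure lebesgue (T - N)"
          using emeasure_Un_null_set[of "T - N" lebesgue N] T(3) Nn TT by auto
        then have "emeasure lebesgue T < ennreal \<delta>" using T by simp
        then show ?thesis
          using \<open>T \<in> lmeasurable\<close> \<open>\<delta> > 0\<close> by (simp add: emeasure_eq_measure2 ennreal_less_iff)
      qed
      have "\<exists>r>0. \<forall>y\<in>{a..b}. \<bar>y - x\<bar> < r \<longrightarrow> \<bar>f y - f x - f' x * (y - x)\<bar> \<le> e/2 * \<bar>y - x\<bar>"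
        if x: "x \<in> {a..b} - N" for x
      proof -
        have "(f has_derivative (\<lambda>h. f' x * h)) (at x within {a..b})"
          using d[OF x] by (simp add: has_field_derivative_def)
        then show ?thesis using e x
          unfolding has_derivative_within_alt
          by (auto simp: dest!: spec[of _ "e/2"])
      qed
      then obtain r where r: "\<And>x. x \<in> {a..b} - N \<Longrightarrow> r x > 0"
        "\<And>x y. x \<in> {a..b} - N \<Longrightarrow> y \<in> {a..b} \<Longrightarrow> \<bar>y - x\<bar> < r x \<Longrightarrow> \<bar>f y - f x - f' x * (y - x)\<bar> \<le> e/2 * \<bar>y - x\<bar>"
        by metis
      define d where "d x = (if x \<in> N then T else if x \<in> {a..b} then ball x (r x) else UNIV)" for x
      have gd: "gauge d" unfolding gauge_def d_def using r(1) T by auto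
      have bound: "norm ((\<Sum>(x, k)\<in>p. measure lborel k *\<^sub>R g x) - (f b - f a)) \<le> e * measure lborel {a..b}"
        if p: "p tagged_division_of {a..b}" and fine: "d fine p" for p
      proof -
        note pD = tagged_division_ofD[OF p]
        have pI: "\<exists>u v. k = {u..v} \<and> u \<le> v \<and> u \<le> x \<and> x \<le> v \<and> a \<le> u \<and> v \<le> b \<and> k \<subseteq> d x"
          if xkp: "(x, k) \<in> p" for x k
        proof -
          obtain u v where "k = cbox u v" using pD(4)[OF xkp] by auto
          moreover have "x \<in> k" "k \<subseteq> {a..b}" "k \<subseteq> d x" using pD(2,3) xkp fine by (auto simp: fine_def)
          ultimately show ?thesis by (intro exI[of _ u] exI[of _ v]) auto
        qed
        define \<phi> where "\<phi> = (\<lambda>(x, k). measure lborel k *\<^sub>R g x - (f (Sup k) - f (Inf k)))"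
        define p1 where "p1 = {z\<in>p. fst z \<notin> N}"
        define p2 where "p2 = {z\<in>p. fst z \<in> N \<and> measure lborel (snd z) \<noteq> 0}"
        have fin: "finite p" "finite p1" "finite p2" using pD(1) by (auto simp: p1_def p2_def)
        have "(\<Sum>(x, k)\<in>p. measure lborel k *\<^sub>R g x) - (f b - f a) = (\<Sum>z\<in>p. \<phi> z)"
          unfolding additive_tagged_division_1[OF ab p, of f, symmetric]
          by (simp add: \<phi>_def sum_subtractf[symmetric] case_prod_unfold)
        also have "\<dots> = (\<Sum>z\<in>p1 \<union> p2. \<phi> z)"
        proof (rule sum.mono_neutral_right)
          show "\<forall>z\<in>p - (p1 \<union> p2). \<phi> z = 0"
          proof
            fix z assume z: "z \<in> p - (p1 \<union> p2)"
            obtain x k where xk: "z = (x, k)" by force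
            then have "measure lborel k = 0" "(x, k) \<in> p" using z by (auto simp: p1_def p2_def)
            with pI[of x k] obtain u v where "k = {u..v}" "u = v" by fastforce
            then show "\<phi> z = 0" using xk by (simp add: \<phi>_def)
          qed
        qed (use fin in \<open>auto simp: p1_def p2_def\<close>)
        also have "\<dots> = (\<Sum>z\<in>p1. \<phi> z) + (\<Sum>z\<in>p2. \<phi> z)"
          by (rule sum.union_disjoint) (use fin in \<open>auto simp: p1_def p2_def\<close>)
        finally have split: "(\<Sum>(x, k)\<in>p. measure lborel k *\<^sub>R g x) - (f b - f a) = (\<Sum>z\<in>p1. \<phi> z) + (\<Sum>z\<in>p2. \<phi> z)" .
        have "\<bar>\<Sum>z\<in>p1. \<phi> z\<bar> \<le> (\<Sum>z\<in>p1. e/2 * measure lborel (snd z))"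
        proof (rule order.trans[OF sum_abs sum_mono])
          fix z assume "z \<in> p1"
          then obtain x k where xk: "z = (x, k)" "(x, k) \<in> p" "x \<notin> N" by (cases z) (auto simp: p1_def)
          obtain u v where uv: "k = {u..v}" "u \<le> v" "u \<le> x" "x \<le> v" "a \<le> u" "v \<le> b" "k \<subseteq> d x"
            using pI[OF xk(2)] by blast
          then have x: "x \<in> {a..b} - N" using xk by auto
          have "u \<in> ball x (r x)" "v \<in> ball x (r x)" using uv x by (auto simp: d_def subset_iff)
          then have "\<bar>f u - f x - f' x * (u - x)\<bar> \<le> e/2 * \<bar>u - x\<bar>" "\<bar>f v - f x - f' x * (v - x)\<bar> \<le> e/2 * \<bar>v - x\<bar>"
            using r(2)[OF x, of u] r(2)[OF x, of v] uv by (auto simp: dist_real_def)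
          moreover have "\<phi> z = (f u - f x - f' x * (u - x)) - (f v - f x - f' x * (v - x))"
            using uv xk x by (simp add: \<phi>_def g_def algebra_simps)
          moreover have "e/2 * \<bar>u - x\<bar> + e/2 * \<bar>v - x\<bar> = e/2 * measure lborel (snd z)"
          proof -
            have "\<bar>u - x\<bar> + \<bar>v - x\<bar> = measure lborel (snd z)" using uv xk by simp
            then show ?thesis unfolding distrib_left[symmetric] by simp
          qed
          ultimately show "\<bar>\<phi> z\<bar> \<le> e/2 * measure lborel (snd z)" by linarith
        qed
        also have "\<dots> \<le> (\<Sum>z\<in>p. e/2 * measure lborel (snd z))"
          using e fin by (intro sum_mono2) (auto simp: p1_def)
        also have "\<dots> = e/2 * (b - a)"
          using additive_content_tagged_division[of p a b] p ab
          unfolding sum_distrib_left[symmetric] by (simp add: case_prod_unfold)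
        finally have b1: "\<bar>\<Sum>z\<in>p1. \<phi> z\<bar> \<le> e/2 * (b - a)" .
        obtain h where h: "bij_betw h {..<card p2} p2"
          using ex_bij_betw_nat_finite[OF fin(3)] by (auto simp: atLeast0LessThan)
        define s where "s i = Inf (snd (h i))" for i
        define t where "t i = Sup (snd (h i))" for i
        have hp: "\<exists>x. h i = (x, {s i..t i}) \<and> (x, {s i..t i}) \<in> p \<and> x \<in> N \<and> s i < t i \<and> a \<le> s i \<and> t i \<le> b \<and> {s i..t i} \<subseteq> T"
          if "i < card p2" for i
        proof -
          have "h i \<in> p2" using h that by (auto simp: bij_betw_def)
          then obtain x k where xk: "h i = (x, k)" "(x, k) \<in> p" "x \<in> N" "measure lborel k \<noteq> 0"
            by (cases "h i") (auto simp: p2_def)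
          obtain u v where uv: "k = {u..v}" "u \<le> v" "u \<le> x" "x \<le> v" "a \<le> u" "v \<le> b" "k \<subseteq> d x"
            using pI[OF xk(2)] by blast
          then show ?thesis using xk by (auto simp: s_def t_def d_def)
        qed
        have iv: "intervals a b (card p2) s t"
          unfolding intervals_def
        proof (intro conjI allI impI)
          fix i j assume ij: "i < card p2" "j < card p2" "i \<noteq> j"
          then have "h i \<noteq> h j" using h by (auto simp: bij_betw_def inj_on_def)
          then have "interior {s i..t i} \<inter> interior {s j..t j} = {}"
            using hp[OF ij(1)] hp[OF ij(2)] pD(5) by metis
          then have disj: "{s i<..<t i} \<inter> {s j<..<t j} = {}" by (simp add: interior_atLeastAtMost_real)
          show "t i \<le> s j \<or> t j \<le> s i"
          proof (rule ccontr)
            assume "\<not> ?thesis"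
            then have "max (s i) (s j) < min (t i) (t j)" using hp[OF ij(1)] hp[OF ij(2)] by auto
            from dense[OF this] obtain m where "max (s i) (s j) < m" "m < min (t i) (t j)" by blast
            then have "m \<in> {s i<..<t i} \<inter> {s j<..<t j}" by simp
            then show False using disj by blast
          qed
        qed (use hp in fastforce)+
        have "(\<Sum>i<card p2. t i - s i) \<le> measure lebesgue T"
        proof (rule sum_length_intervals_le[OF iv \<open>T \<in> lmeasurable\<close>])
          fix i assume "i < card p2"
          then have "{s i..t i} \<subseteq> T" using hp by blast
          then show "{s i<..<t i} \<subseteq> T" using greaterThanLessThan_subseteq_atLeastAtMost_iff by (meson order.refl order.trans)
        qed
        then have "(\<Sum>i<card p2. \<bar>f (t i) - f (s i)\<bar>) < \<eta>" using \<delta>[OF iv] mT by simp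
        moreover have "(\<Sum>z\<in>p2. \<bar>\<phi> z\<bar>) = (\<Sum>i<card p2. \<bar>f (t i) - f (s i)\<bar>)"
        proof -
          have "(\<Sum>z\<in>p2. \<bar>\<phi> z\<bar>) = (\<Sum>i<card p2. \<bar>\<phi> (h i)\<bar>)"
            using sum.reindex_bij_betw[OF h, of "\<lambda>z. \<bar>\<phi> z\<bar>"] by simp
          also have "\<dots> = (\<Sum>i<card p2. \<bar>f (t i) - f (s i)\<bar>)"
          proof (intro sum.cong refl)
            fix i assume "i \<in> {..<card p2}"
            then obtain x where "h i = (x, {s i..t i})" "x \<in> N" "s i < t i" using hp by blast
            then show "\<bar>\<phi> (h i)\<bar> = \<bar>f (t i) - f (s i)\<bar>" by (simp add: \<phi>_def g_def abs_minus_commute)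
          qed
          finally show ?thesis .
        qed
        ultimately have "\<bar>\<Sum>z\<in>p2. \<phi> z\<bar> < \<eta>" using sum_abs[of \<phi> p2] by linarith
        then show ?thesis unfolding split using b1 ab' by (simp add: \<eta>_def field_simps)
      qed
      show ?thesis
        by (intro exI[of _ d] conjI allI impI gd bound) (elim conjE; assumption)+
    qed
  qed
  moreover have "f' x = g x" if "x \<in> {a..b} - N" for x using that unfolding g_def by auto
  ultimately show ?thesis using has_integral_spike[OF N] by blast
qed

lemma ac_add:
  assumes "ac D a b" "ac D' a b"
  shows "ac (\<lambda>s e. D s e + D' s e) a b"
  unfolding ac_def
proof (intro allI impI)
  fix \<epsilon> :: real assume "\<epsilon> > 0"
  then have e: "\<epsilon> / 2 > 0" by simp
  obtain d where d: "d > 0" "\<And>n s e. intervals a b n s e \<Longrightarrow> (\<Sum>i<n. e i - s i) < d \<Longrightarrow> (\<Sum>i<n. D (s i) (e i)) < \<epsilon>/2"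
    using assms(1) e unfolding ac_def by meson
  obtain d' where d': "d' > 0" "\<And>n s e. intervals a b n s e \<Longrightarrow> (\<Sum>i<n. e i - s i) < d' \<Longrightarrow> (\<Sum>i<n. D' (s i) (e i)) < \<epsilon>/2"
    using assms(2) e unfolding ac_def by meson
  have "(\<Sum>i<n. D (s i) (e i) + D' (s i) (e i)) < \<epsilon>"
    if "intervals a b n s e" "(\<Sum>i<n. e i - s i) < min d d'" for n s e
    using d(2)[OF that(1)] d'(2)[OF that(1)] that(2) by (simp add: sum.distrib)
  then show "\<exists>\<delta>>0. \<forall>n s e. intervals a b n s e \<and> (\<Sum>i<n. e i - s i) < \<delta> \<longrightarrow> (\<Sum>i<n. D (s i) (e i) + D' (s i) (e i)) < \<epsilon>"
    using d(1) d'(1) by (intro exI[of _ "min d d'"]) auto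
qed

lemma ac_mult:
  fixes f g :: "real \<Rightarrow> real"
  assumes f: "ac (\<lambda>s e. \<bar>f e - f s\<bar>) a b" and g: "ac (\<lambda>s e. \<bar>g e - g s\<bar>) a b"
    and B: "\<And>x. x \<in> {a..b} \<Longrightarrow> \<bar>f x\<bar> \<le> B" "\<And>x. x \<in> {a..b} \<Longrightarrow> \<bar>g x\<bar> \<le> B"
  shows "ac (\<lambda>s e. \<bar>f e * g e - f s * g s\<bar>) a b"
proof (rule ac_dominated[OF ac_add[OF f g], of "\<bar>B\<bar>"])
  fix s e assume se: "a \<le> s" "s \<le> e" "e \<le> b"
  have "f e * g e - f s * g s = (f e - f s) * g e + f s * (g e - g s)" by (simp add: algebra_simps)
  then have "\<bar>f e * g e - f s * g s\<bar> \<le> \<bar>f e - f s\<bar> * \<bar>g e\<bar> + \<bar>f s\<bar> * \<bar>g e - g s\<bar>"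
    by (metis abs_mult abs_triangle_ineq)
  also have "\<dots> \<le> \<bar>f e - f s\<bar> * \<bar>B\<bar> + \<bar>B\<bar> * \<bar>g e - g s\<bar>"
    using B[of e] B[of s] se by (intro add_mono mult_left_mono mult_right_mono) auto
  also have "\<dots> \<le> \<bar>B\<bar> * (\<bar>f e - f s\<bar> + \<bar>g e - g s\<bar> + (e - s))"
    using mult_nonneg_nonneg[of "\<bar>B\<bar>" "e - s"] se by (simp add: algebra_simps)
  finally show "\<bar>f e * g e - f s * g s\<bar> \<le> \<bar>B\<bar> * (\<bar>f e - f s\<bar> + \<bar>g e - g s\<bar> + (e - s))" .
qed simp

section \<open>Differentiation of the integral\<close>

lemma integral_right_derivative_AE:
  fixes f :: "real \<Rightarrow> real"
  assumes f: "\<And>x y. f integrable_on {x..y}"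
  obtains N where "negligible N"
    "\<And>x e. x \<notin> N \<Longrightarrow> e > 0 \<Longrightarrow> \<exists>d>0. \<forall>h. 0 < h \<and> h < d \<longrightarrow> \<bar>integral {x..x + h} f / h - f x\<bar> < e"
proof -
  obtain N where N: "negligible N" "\<And>x e. x \<notin> N \<Longrightarrow> 0 < e \<Longrightarrow> \<exists>d>0. \<forall>h. 0 < h \<and> h < d \<longrightarrow>
       norm (integral (cbox x (x + h *\<^sub>R One)) f /\<^sub>R h ^ DIM(real) - f x) < e"
    by (rule integrable_ccontinuous_explicit[of f]) (use f in auto)
  show ?thesis
    by (rule that[OF N(1)]) (use N(2) in \<open>simp add: divide_inverse mult.commute\<close>)
qed

lemma integral_has_derivative_AE:
  fixes f :: "real \<Rightarrow> real"
  assumes f: "f integrable_on {a..b}"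
  obtains N where "negligible N"
    "\<And>x. x \<in> {a<..<b} - N \<Longrightarrow> ((\<lambda>t. integral {a..t} f) has_real_derivative f x) (at x)"
proof -
  define F where "F x = (if x \<in> {a..b} then f x else 0)" for x
  have F: "F integrable_on {x..y}" for x y
    unfolding F_def integrable_restrict_Int by (simp, rule integrable_subinterval_real[OF f]) auto
  have F': "(\<lambda>x. F (-x)) integrable_on {x..y}" for x y
    using F[of "-y" "-x"] by (subst (asm) Henstock_Kurzweil_Integration.integrable_reflect_real[symmetric]) simp
  obtain N1 where N1: "negligible N1"
    "\<And>x e. x \<notin> N1 \<Longrightarrow> e > 0 \<Longrightarrow> \<exists>d>0. \<forall>h. 0 < h \<and> h < d \<longrightarrow> \<bar>integral {x..x + h} F / h - F x\<bar> < e"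
    using integral_right_derivative_AE[OF F] by blast
  obtain N2 where N2: "negligible N2"
    "\<And>x e. x \<notin> N2 \<Longrightarrow> e > 0 \<Longrightarrow> \<exists>d>0. \<forall>h. 0 < h \<and> h < d \<longrightarrow>
       \<bar>integral {x..x + h} (\<lambda>x. F (-x)) / h - F (-x)\<bar> < e"
    using integral_right_derivative_AE[OF F'] by blast
  have "negligible (N1 \<union> uminus ` N2)"
    using N1(1) N2(1)
    by (intro negligible_Un negligible_differentiable_image_negligible) (auto intro!: derivative_intros simp: differentiable_on_def)
  moreover have "((\<lambda>t. integral {a..t} f) has_real_derivative f x) (at x)"
    if x: "x \<in> {a<..<b} - (N1 \<union> uminus ` N2)" for x
    unfolding has_field_derivative_iff
  proof (rule tendstoI)
    fix e :: real assume e: "e > 0"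
    have xN: "x \<notin> N1" "-x \<notin> N2" and ax: "a < x" "x < b" using x by (auto simp: image_iff)
    obtain d1 where d1: "d1 > 0" "\<And>h. 0 < h \<Longrightarrow> h < d1 \<Longrightarrow> \<bar>integral {x..x + h} F / h - F x\<bar> < e"
      using N1(2)[OF xN(1) e] by blast
    obtain d2 where d2: "d2 > 0" "\<And>h. 0 < h \<Longrightarrow> h < d2 \<Longrightarrow> \<bar>integral {-x..-x + h} (\<lambda>x. F (-x)) / h - F x\<bar> < e"
      using N2(2)[OF xN(2) e] by auto
    define d where "d = min (min d1 d2) (min (x - a) (b - x))"
    have "d > 0" using d1 d2 ax by (simp add: d_def)
    have FI: "integral {a..t} f = integral {a..t} F" if "t \<le> b" for t
      using that by (intro integral_cong) (auto simp: F_def)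
    have "dist ((integral {a..y} f - integral {a..x} f) / (y - x)) (f x) < e"
      if y: "y \<noteq> x" "dist y x < d" for y
    proof -
      have yb: "a < y" "y < b" "\<bar>y - x\<bar> < d1" "\<bar>y - x\<bar> < d2"
        using y by (auto simp: d_def dist_real_def)
      have fx: "f x = F x" using ax by (simp add: F_def)
      show ?thesis
      proof (cases "x < y")
        case True
        have "integral {a..y} F - integral {a..x} F = integral {x..y} F"
          using Henstock_Kurzweil_Integration.integral_combine[of a x y F] ax True F by (simp add: algebra_simps)
        then show ?thesis using d1(2)[of "y - x"] yb True ax by (simp add: dist_real_def FI fx)
      next
        case False
        then have yx: "y < x" using y by simp
        have "integral {a..y} F - integral {a..x} F = - integral {y..x} F"
          using Henstock_Kurzweil_Integration.integral_combine[of a y x F] yb yx F by (simp add: algebra_simps)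
        moreover have "integral {-x..-y} (\<lambda>x. F (-x)) = integral {y..x} F" by (rule Henstock_Kurzweil_Integration.integral_reflect_real)
        ultimately have "(integral {a..y} F - integral {a..x} F) / (y - x) = integral {-x..-x + (x - y)} (\<lambda>x. F (-x)) / (x - y)"
          by (metis minus_diff_eq minus_divide_divide uminus_add_conv_diff add.commute diff_add_cancel)
        then show ?thesis using d2(2)[of "x - y"] yb yx ax by (simp add: dist_real_def FI fx)
      qed
    qed
    then show "\<forall>\<^sub>F y in at x. dist ((integral {a..y} f - integral {a..x} f) / (y - x)) (f x) < e"
      using \<open>d > 0\<close> by (auto simp: eventually_at)
  qed
  ultimately show ?thesis using that by blast
qed

section \<open>Square integrable functions on an interval\<close>

lemma L2_on_continuous:
  assumes "continuous_on {a..b} (f :: real \<Rightarrow> real)"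
  shows "L2 (lebesgue_on {a..b}) f"
  unfolding L2_def
proof
  show "f \<in> borel_measurable (lebesgue_on {a..b})"
    by (rule borel_measurable_integrable[OF continuous_imp_integrable_real[OF assms]])
  show "integrable (lebesgue_on {a..b}) (\<lambda>x. (f x)^2)"
    by (rule continuous_imp_integrable_real) (intro continuous_intros assms)
qed

lemma L2_on_integrable:
  assumes "L2 (lebesgue_on {a..b}) (f :: real \<Rightarrow> real)"
  shows "integrable (lebesgue_on {a..b}) f" "f integrable_on {a..b}" "(\<lambda>x. (f x)^2) integrable_on {a..b}"
proof -
  have "L2 (lebesgue_on {a..b}) (\<lambda>x. 1 :: real)" by (rule L2_on_continuous) (rule continuous_on_const)
  from L2_mult_integrable[OF assms this] show i: "integrable (lebesgue_on {a..b}) f"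
    unfolding mult_1_right .
  have S: "{a..b} \<in> sets lebesgue" by simp
  show "f integrable_on {a..b}" "(\<lambda>x. (f x)^2) integrable_on {a..b}"
    by (rule integrable_on_lebesgue_on[OF i S], rule integrable_on_lebesgue_on[OF L2_sq_integrable[OF assms] S])
qed

lemma integrable_lebesgue_on_iff:
  "S \<in> sets lebesgue \<Longrightarrow> integrable (lebesgue_on S) (f :: _ \<Rightarrow> real) \<longleftrightarrow> set_integrable lebesgue S f"
  unfolding set_integrable_def by (rule integrable_restrict_space) simp

lemma L2_on_subset:
  assumes "L2 (lebesgue_on {a..b}) (f :: real \<Rightarrow> real)" "a \<le> c" "d \<le> b"
  shows "L2 (lebesgue_on {c..d}) f"
proof -
  have sub: "{c..d} \<subseteq> {a..b}" using assms by auto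
  have m: "f \<in> borel_measurable (lebesgue_on {a..b})" and i: "integrable (lebesgue_on {a..b}) (\<lambda>x. (f x)^2)"
    using assms(1) unfolding L2_def by blast+
  have "set_integrable lebesgue {a..b} (\<lambda>x. (f x)^2)" using i by (subst (asm) integrable_lebesgue_on_iff) simp_all
  then have "set_integrable lebesgue {c..d} (\<lambda>x. (f x)^2)"
    by (rule set_integrable_subset) (use sub in simp_all)
  then show ?thesis unfolding L2_def using measurable_restrict_mono[OF m sub]
    by (subst integrable_lebesgue_on_iff) simp_all
qed

lemma L2_on_integral_sq_le:
  assumes f: "L2 (lebesgue_on {a..b}) (f :: real \<Rightarrow> real)" and ab: "a \<le> b"
  shows "(integral {a..b} f)^2 \<le> (b - a) * integral {a..b} (\<lambda>x. (f x)^2)"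
proof -
  note i = L2_on_integrable[OF f]
  have "(\<integral>x. f x * 1 \<partial>lebesgue_on {a..b})^2 \<le> (\<integral>x. (f x)^2 \<partial>lebesgue_on {a..b}) * (\<integral>x. 1^2 \<partial>lebesgue_on {a..b})"
    by (rule L2_Cauchy_Schwarz_sq[OF f]) (auto intro: L2_on_continuous)
  then show ?thesis
    using i(1) L2_sq_integrable[OF f] ab
    by (simp add: lebesgue_integral_eq_integral continuous_imp_integrable_real mult.commute measure_restrict_space)
qed

lemma ac_indefinite_integral:
  assumes f: "L2 (lebesgue_on {a..b}) f" and F: "\<And>x. x \<in> {a..b} \<Longrightarrow> F x = c + integral {a..x} f"
  shows "ac (\<lambda>s e. \<bar>F e - F s\<bar>) a b"
proof (rule ac_sqrt_integral)
  show "(\<lambda>x. (f x)^2) integrable_on {a..b}" by (rule L2_on_integrable[OF f])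
  fix s e assume se: "a \<le> s" "s \<le> e" "e \<le> b"
  have fe: "f integrable_on {a..e}" using L2_on_integrable(2)[OF L2_on_subset[OF f _ se(3)]] by simp
  have "F e - F s = integral {s..e} f" using F[of s] F[of e] se Henstock_Kurzweil_Integration.integral_combine[OF se(1,2) fe] by simp
  then show "\<bar>F e - F s\<bar>^2 \<le> (e - s) * integral {s..e} (\<lambda>x. (f x)^2)"
    using L2_on_integral_sq_le[OF L2_on_subset[OF f se(1,3)] se(2)] by simp
qed auto

lemma continuous_on_Icc_bounded:
  assumes "continuous_on {a..b} (f :: real \<Rightarrow> real)"
  obtains B where "\<And>x. x \<in> {a..b} \<Longrightarrow> \<bar>f x\<bar> \<le> B"
proof -
  have "bounded (f ` {a..b})" by (rule compact_imp_bounded[OF compact_continuous_image[OF assms compact_Icc]])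
  then obtain B where "\<forall>x\<in>{a..b}. \<bar>f x\<bar> \<le> B" unfolding bounded_iff by auto
  then show ?thesis using that by blast
qed

lemma continuous_on_indefinite_integral:
  fixes f F :: "real \<Rightarrow> real"
  assumes f: "L2 (lebesgue_on {a..b}) f" and F: "\<And>x. x \<in> {a..b} \<Longrightarrow> F x = c + integral {a..x} f"
  shows "continuous_on {a..b} F"
proof -
  have "f integrable_on {a..b}" by (rule L2_on_integrable[OF f])
  then have "continuous_on {a..b} (\<lambda>x. integral {a..x} f)" by (rule indefinite_integral_continuous_1)
  then have "continuous_on {a..b} (\<lambda>x. c + integral {a..x} f)" by (intro continuous_intros)
  moreover have "continuous_on {a..b} F \<longleftrightarrow> continuous_on {a..b} (\<lambda>x. c + integral {a..x} f)"
    by (rule continuous_on_cong[OF refl]) (rule F)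
  ultimately show ?thesis by simp
qed

lemma indefinite_integral_AE_derivative:
  fixes f :: "real \<Rightarrow> real"
  assumes f: "L2 (lebesgue_on {a..b}) f" and F: "\<And>x. x \<in> {a..b} \<Longrightarrow> F x = c + integral {a..x} f"
  obtains N where "negligible N" "\<And>x. x \<in> {a..b} - N \<Longrightarrow> (F has_real_derivative f x) (at x within {a..b})"
    "N \<supseteq> {a, b}"
proof -
  obtain N where N: "negligible N" "\<And>x. x \<in> {a<..<b} - N \<Longrightarrow> ((\<lambda>t. integral {a..t} f) has_real_derivative f x) (at x)"
    using integral_has_derivative_AE[OF L2_on_integrable(2)[OF f]] by blast
  show ?thesis
  proof (rule that[of "N \<union> {a, b}"])
    show "negligible (N \<union> {a, b})" using N(1) by (intro negligible_Un) auto
    fix x assume x: "x \<in> {a..b} - (N \<union> {a, b})"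
    then have "((\<lambda>t. c + integral {a..t} f) has_real_derivative 0 + f x) (at x)"
      by (intro DERIV_add DERIV_const N(2)) auto
    then have "((\<lambda>t. c + integral {a..t} f) has_real_derivative f x) (at x within {a..b})"
      using has_field_derivative_at_within by auto
    then show "(F has_real_derivative f x) (at x within {a..b})"
      by (rule has_field_derivative_transform_within[OF _ zero_less_one]) (use x F in auto)
  qed auto
qed

lemma integration_by_parts_L2:
  fixes v w :: "real \<Rightarrow> real"
  assumes v: "L2 (lebesgue_on {a..b}) v" and V: "\<And>x. x \<in> {a..b} \<Longrightarrow> V x = c + integral {a..x} v"
    and w: "L2 (lebesgue_on {a..b}) w" and W: "\<And>x. x \<in> {a..b} \<Longrightarrow> W x = c' + integral {a..x} w"
    and ab: "a \<le> b"
  shows "((\<lambda>x. v x * W x + V x * w x) has_integral (V b * W b - V a * W a)) {a..b}"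
proof -
  have cV: "continuous_on {a..b} V" by (rule continuous_on_indefinite_integral[OF v V])
  have cW: "continuous_on {a..b} W" by (rule continuous_on_indefinite_integral[OF w W])
  obtain B1 where B1: "\<And>x. x \<in> {a..b} \<Longrightarrow> \<bar>V x\<bar> \<le> B1"
    using continuous_on_Icc_bounded[OF cV] by blast
  obtain B2 where B2: "\<And>x. x \<in> {a..b} \<Longrightarrow> \<bar>W x\<bar> \<le> B2"
    using continuous_on_Icc_bounded[OF cW] by blast
  obtain N1 where N1: "negligible N1" "\<And>x. x \<in> {a..b} - N1 \<Longrightarrow> (V has_real_derivative v x) (at x within {a..b})"
    using indefinite_integral_AE_derivative[OF v V] by metis
  obtain N2 where N2: "negligible N2" "\<And>x. x \<in> {a..b} - N2 \<Longrightarrow> (W has_real_derivative w x) (at x within {a..b})"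
    using indefinite_integral_AE_derivative[OF w W] by metis
  have "ac (\<lambda>s e. \<bar>V e * W e - V s * W s\<bar>) a b"
    by (rule ac_mult[OF ac_indefinite_integral[OF v V] ac_indefinite_integral[OF w W], of "max B1 B2"])
      (auto intro: order.trans[OF B1] order.trans[OF B2])
  then have "((\<lambda>x. v x * W x + w x * V x) has_integral (V b * W b - V a * W a)) {a..b}"
    by (rule ac_has_integral_derivative[OF _ ab negligible_Un[OF N1(1) N2(1)]])
      (intro DERIV_mult N1(2) N2(2); auto)
  then show ?thesis by (simp add: mult.commute)
qed

section \<open>The sine basis of \<open>L\<^sup>2(0,1)\<close>\<close>

abbreviation I01 :: "real measure" where "I01 \<equiv> lebesgue_on {0..1}"

definition sine :: "nat \<Rightarrow> real \<Rightarrow> real" where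
  "sine k x = sqrt 2 * sin (real (Suc k) * pi * x)"

definition cosine :: "nat \<Rightarrow> real \<Rightarrow> real" where
  "cosine k x = sqrt 2 * (real (Suc k) * pi) * cos (real (Suc k) * pi * x)"

definition lam :: "nat \<Rightarrow> real" where "lam k = (real (Suc k) * pi)^2"

definition coef :: "(real \<Rightarrow> real) \<Rightarrow> nat \<Rightarrow> real" where
  "coef f k = (\<integral>x. f x * sine k x \<partial>I01)"

lemma lam_pos [simp]: "lam k > 0" by (simp add: lam_def)

lemma lam_ge: "lam k \<ge> pi^2"
proof -
  have "pi \<le> real (Suc k) * pi" by simp
  then show ?thesis unfolding lam_def by (intro power_mono) auto
qed

lemma lam_ge_1: "lam k \<ge> 1"
proof -
  have "1 \<le> pi^2" using pi_gt3 by (intro one_le_power) auto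
  then show ?thesis using lam_ge[of k] by linarith
qed

lemma lam_ge_Suc: "lam k \<ge> real (Suc k)"
proof -
  have "1 \<le> pi^2" using pi_gt3 by (intro one_le_power) auto
  then have "real (Suc k)^2 * 1 \<le> real (Suc k)^2 * pi^2" by (intro mult_left_mono) auto
  moreover have "real (Suc k) \<le> real (Suc k)^2" by (simp add: power2_eq_square)
  ultimately show ?thesis unfolding lam_def power_mult_distrib by linarith
qed

lemma continuous_on_sine [continuous_intros]: "continuous_on S (sine k)"
  unfolding sine_def[abs_def] by (intro continuous_intros)

lemma continuous_on_cosine [continuous_intros]: "continuous_on S (cosine k)"
  unfolding cosine_def[abs_def] by (intro continuous_intros)

lemma L2_sine [simp]: "L2 I01 (sine k)"
  by (intro L2_on_continuous continuous_intros)

lemma sine_bound: "\<bar>sine k x\<bar> \<le> 2"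
proof -
  have "sqrt 2 \<le> sqrt 4" by (rule real_sqrt_le_mono) simp
  then have "sqrt 2 \<le> 2" by simp
  then have "sqrt 2 * \<bar>sin (real (Suc k) * pi * x)\<bar> \<le> 2 * 1"
    by (intro mult_mono) auto
  then show ?thesis by (simp add: sine_def abs_mult)
qed

lemma sine_0 [simp]: "sine k 0 = 0" and sine_1 [simp]: "sine k 1 = 0"
  using sin_npi[of "Suc k"] by (simp_all add: sine_def)

lemma sine_deriv: "(sine k has_real_derivative cosine k x) (at x within S)"
  unfolding sine_def[abs_def] cosine_def by (auto intro!: derivative_eq_intros)

lemma cosine_deriv: "(cosine k has_real_derivative - lam k * sine k x) (at x within S)"
  unfolding sine_def cosine_def[abs_def] lam_def
  by (auto intro!: derivative_eq_intros simp: power2_eq_square)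

lemma integral_cosine: "0 \<le> x \<Longrightarrow> integral {0..x} (cosine k) = sine k x"
  using fundamental_theorem_of_calculus[of 0 x "sine k" "cosine k"] sine_deriv
  by (auto simp: has_real_derivative_iff_has_vector_derivative intro!: integral_unique)

lemma integral_lam_sine: "0 \<le> x \<Longrightarrow> integral {0..x} (\<lambda>y. - lam k * sine k y) = cosine k x - cosine k 0"
  using fundamental_theorem_of_calculus[of 0 x "cosine k" "\<lambda>y. - lam k * sine k y"] cosine_deriv
  by (intro integral_unique) (auto simp: has_real_derivative_iff_has_vector_derivative)

lemma has_integral_cos_int:
  assumes "n \<noteq> (0::int)"
  shows "((\<lambda>x. cos (of_int n * pi * x)) has_integral 0) {0..1}"
proof -
  have "((\<lambda>x. cos (of_int n * pi * x)) has_integral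
      (sin (of_int n * pi * 1) / (of_int n * pi) - sin (of_int n * pi * 0) / (of_int n * pi))) {0..1}"
    by (rule fundamental_theorem_of_calculus)
      (use assms in \<open>auto intro!: derivative_eq_intros simp: has_real_derivative_iff_has_vector_derivative[symmetric]\<close>)
  moreover have "sin (of_int n * pi) = 0" by (metis mult.commute sin_npi_int)
  ultimately show ?thesis by simp
qed

lemma I01_integral_eq: "integrable I01 f \<Longrightarrow> (\<integral>x. f x \<partial>I01) = integral {0..1} (f :: real \<Rightarrow> real)"
  by (rule lebesgue_integral_eq_integral) auto

lemma sine_orthonormal: "(\<integral>x. sine j x * sine k x \<partial>I01) = (if j = k then 1 else 0)"
proof -
  have e: "sine j x * sine k x = cos (of_int (int j - int k) * pi * x) - cos (of_int (int j + int k + 2) * pi * x)" for x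
  proof -
    have "sine j x * sine k x = 2 * (sin (real (Suc j) * pi * x) * sin (real (Suc k) * pi * x))"
      by (simp add: sine_def)
    also have "\<dots> = cos (real (Suc j) * pi * x - real (Suc k) * pi * x) - cos (real (Suc j) * pi * x + real (Suc k) * pi * x)"
      by (simp only: sin_times_sin) simp
    finally show ?thesis by (simp add: algebra_simps)
  qed
  have 1: "((\<lambda>x. cos (of_int (int j - int k) * pi * x)) has_integral (if j = k then 1 else 0)) {0..1::real}"
    using has_integral_cos_int[of "int j - int k"] has_integral_const_real[of "1::real" 0 1] by auto
  have "((\<lambda>x. sine j x * sine k x) has_integral (if j = k then 1 else 0) - 0) {0..1}"
    unfolding e by (intro has_integral_diff 1 has_integral_cos_int) auto
  then show ?thesis
    using I01_integral_eq[OF L2_mult_integrable[OF L2_sine L2_sine, of j k]] by (simp add: integral_unique)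
qed

lemma coef_add: "L2 I01 f \<Longrightarrow> L2 I01 g \<Longrightarrow> coef (\<lambda>x. f x + g x) k = coef f k + coef g k"
  by (simp add: coef_def distrib_right L2_mult_integrable)

lemma coef_diff: "L2 I01 f \<Longrightarrow> L2 I01 g \<Longrightarrow> coef (\<lambda>x. f x - g x) k = coef f k - coef g k"
  by (simp add: coef_def left_diff_distrib L2_mult_integrable)

lemma coef_cmult: "coef (\<lambda>x. c * f x) k = c * coef f k"
  by (simp add: coef_def mult.assoc)

lemma coef_sum: "(\<And>i. i \<in> I \<Longrightarrow> L2 I01 (f i)) \<Longrightarrow> coef (\<lambda>x. \<Sum>i\<in>I. f i x) k = (\<Sum>i\<in>I. coef (f i) k)"
  by (simp add: coef_def sum_distrib_right L2_mult_integrable)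

lemma coef_sine: "coef (sine j) k = (if j = k then 1 else 0)"
  by (simp add: coef_def sine_orthonormal)

lemma coef_cong_AE: "AE x in I01. f x = g x \<Longrightarrow> L2 I01 f \<Longrightarrow> L2 I01 g \<Longrightarrow> coef f k = coef g k"
  unfolding coef_def
  using borel_measurable_integrable[OF L2_mult_integrable[OF _ L2_sine]]
  by (intro integral_cong_AE) (auto elim: eventually_mono)

lemma coef_bound: "L2 I01 f \<Longrightarrow> \<bar>coef f k\<bar> \<le> nrm I01 f"
  using L2_Cauchy_Schwarz[of I01 f "sine k"] sine_orthonormal[of k k]
  by (simp add: coef_def nrm_def power2_eq_square)

lemma AE_zero_of_integrals_zero:
  fixes g :: "real \<Rightarrow> real"
  assumes g: "g integrable_on {0..1}" and z: "\<And>a. a \<in> {0..1} \<Longrightarrow> integral {0..a} g = 0"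
  shows "AE x in I01. g x = 0"
proof -
  obtain N where N: "negligible N" "\<And>x. x \<in> {0<..<1} - N \<Longrightarrow> ((\<lambda>t. integral {0..t} g) has_real_derivative g x) (at x)"
    using integral_has_derivative_AE[OF g] by blast
  have "g x = 0" if x: "x \<in> {0<..<1} - N" for x
  proof -
    have "((\<lambda>t. 0) has_real_derivative g x) (at x)"
      by (rule has_field_derivative_transform_within_open[OF N(2)[OF x], of "{0<..<1}"]) (use x z in auto)
    then show ?thesis using DERIV_unique[OF _ DERIV_const] by blast
  qed
  note gz = this
  have "{x \<in> {0..1}. g x \<noteq> 0} \<subseteq> N \<union> {0, 1}"
  proof
    fix x assume "x \<in> {x \<in> {0..1}. g x \<noteq> 0}"
    then show "x \<in> N \<union> {0, 1}" using gz[of x] by (cases "x \<in> {0<..<1}") auto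
  qed
  moreover have "negligible (N \<union> {0, 1})" using N(1) by (intro negligible_Un) auto
  ultimately have "negligible {x \<in> {0..1}. g x \<noteq> 0}" by (rule negligible_subset[rotated])
  then have "{x \<in> {0..1}. g x \<noteq> 0} \<in> null_sets lebesgue" by (simp add: negligible_iff_null_sets)
  then have "AE x in lebesgue. x \<notin> {x \<in> {0..1}. g x \<noteq> 0}" by (rule AE_not_in)
  then show ?thesis by (subst AE_restrict_space_iff) auto
qed

text \<open>The functions \<open>sin (\<pi> x) p(cos (\<pi> x))\<close> with a polynomial \<open>p\<close> lie in the span of the sines,
  and \<open>x \<mapsto> cos (\<pi> x)\<close> is a homeomorphism of \<open>[0,1]\<close> onto \<open>[-1,1]\<close>, so that
  Weierstrass' theorem applies.\<close>
lemma sine_complete: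
  assumes f: "L2 I01 f" and z: "\<And>k. coef f k = 0"
  shows "AE x in I01. f x = 0"
proof -
  define S where "S n x = sin (real n * pi * x)" for n :: nat and x :: real
  define C where "C x = cos (pi * x)" for x :: real
  have Lc: "L2 I01 h" if "continuous_on UNIV h" for h
    using continuous_on_subset[OF that] by (intro L2_on_continuous) auto
  have cS: "continuous_on T (S n)" for n T unfolding S_def[abs_def] by (intro continuous_intros)
  have cC: "continuous_on T C" for T unfolding C_def[abs_def] by (intro continuous_intros)
  have int: "integrable I01 (\<lambda>x. f x * h x)" if "continuous_on {0..1} h" for h
    by (intro L2_mult_integrable f L2_on_continuous that)
  have S0: "(\<integral>x. f x * S n x \<partial>I01) = 0" for n
  proof (cases n)
    case (Suc k)
    have "coef f k = (\<integral>x. sqrt 2 * (f x * S n x) \<partial>I01)"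
      unfolding coef_def sine_def S_def Suc by (simp add: mult_ac)
    also have "\<dots> = sqrt 2 * (\<integral>x. f x * S n x \<partial>I01)" by simp
    finally show ?thesis using z[of k] by simp
  qed (simp add: S_def)
  have SC: "(\<integral>x. f x * (S n x * C x ^ j) \<partial>I01) = 0" for n j
  proof (induction j arbitrary: n)
    case (Suc j)
    show ?case
    proof (cases n)
      case (Suc m)
      have "S n x * C x = (S (Suc n) x + S m x) / 2" for x
      proof -
        have "S (Suc n) x = sin (real n * pi * x + pi * x)" "S m x = sin (real n * pi * x - pi * x)"
          unfolding S_def Suc by (simp_all add: algebra_simps)
        then show ?thesis by (simp add: sin_add sin_diff S_def C_def)
      qed
      note SC2 = this
      have "f x * (S n x * C x ^ Suc j) = (f x * (S (Suc n) x * C x ^ j) + f x * (S m x * C x ^ j)) / 2" for x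
      proof -
        have "f x * (S n x * C x ^ Suc j) = f x * ((S n x * C x) * C x ^ j)" by simp
        also have "\<dots> = f x * ((S (Suc n) x + S m x) / 2 * C x ^ j)" by (simp only: SC2)
        also have "\<dots> = (f x * (S (Suc n) x * C x ^ j) + f x * (S m x * C x ^ j)) / 2"
          by (simp add: distrib_left distrib_right)
        finally show ?thesis .
      qed
      then have "(\<integral>x. f x * (S n x * C x ^ Suc j) \<partial>I01)
          = (\<integral>x. (f x * (S (Suc n) x * C x ^ j) + f x * (S m x * C x ^ j)) / 2 \<partial>I01)"
        by (intro Bochner_Integration.integral_cong refl)
      also have "\<dots> = ((\<integral>x. f x * (S (Suc n) x * C x ^ j) \<partial>I01) + (\<integral>x. f x * (S m x * C x ^ j) \<partial>I01)) / 2"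
        by (subst integral_divide_zero, subst Bochner_Integration.integral_add)
          (auto intro!: int continuous_intros cS cC)
      finally show ?thesis using Suc.IH by simp
    qed (simp add: S_def)
  qed (simp add: S0)
  define g where "g x = f x * S 1 x" for x
  have gint: "integrable I01 g" unfolding g_def by (intro int cS)
  have poly: "(\<integral>x. g x * p (C x) \<partial>I01) = 0" if rp: "real_polynomial_function p" for p
  proof -
    obtain a n where p: "p = (\<lambda>x. \<Sum>i\<le>n. a i * x ^ i)" using rp unfolding real_polynomial_function_iff_sum by auto
    have "(\<integral>x. g x * p (C x) \<partial>I01) = (\<integral>x. (\<Sum>i\<le>n. a i * (f x * (S 1 x * C x ^ i))) \<partial>I01)"
      unfolding p g_def sum_distrib_left
      by (intro Bochner_Integration.integral_cong sum.cong refl) (simp only: mult_ac)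
    also have "\<dots> = (\<Sum>i\<le>n. (\<integral>x. a i * (f x * (S 1 x * C x ^ i)) \<partial>I01))"
      by (intro Bochner_Integration.integral_sum integrable_mult_right int continuous_intros cS cC)
    also have "\<dots> = 0" by (simp add: SC)
    finally show ?thesis .
  qed
  have gq: "(\<integral>x. g x * q x \<partial>I01) = 0" if q: "continuous_on {0..1} q" for q
  proof -
    define Q where "Q y = q (arccos y / pi)" for y
    have QC: "Q (C x) = q x" if "x \<in> {0..1}" for x
    proof -
      have "arccos (cos (pi * x)) = pi * x" using that by (intro arccos_cos) (auto simp: mult_le_cancel_left1)
      then show ?thesis by (simp add: Q_def C_def)
    qed
    have cQ: "continuous_on {-1..1} Q"
      unfolding Q_def
      by (rule continuous_on_compose2[OF q]) (auto intro!: continuous_intros continuous_on_arccos' simp: arccos_lbound arccos_ubound divide_le_eq)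
    define B where "B = (\<integral>x. \<bar>g x\<bar> \<partial>I01)"
    have "\<bar>\<integral>x. g x * q x \<partial>I01\<bar> \<le> e * (B + 1)" if e: "e > 0" for e
    proof -
      obtain p where p: "real_polynomial_function p" "\<And>x. x \<in> {-1..1} \<Longrightarrow> \<bar>Q x - p x\<bar> < e"
        using Stone_Weierstrass_real_polynomial_function[OF compact_Icc cQ e] by blast
      have cp: "continuous_on T p" for T
        using p(1) by (simp add: continuous_real_polymonial_function continuous_at_imp_continuous_on)
      have cpC: "continuous_on {0..1} (\<lambda>x. p (C x))" by (rule continuous_on_compose2[OF cp[of UNIV] cC]) auto
      have i1: "integrable I01 (\<lambda>x. g x * h x)" if "continuous_on {0..1} h" for h
        using int[of "\<lambda>x. S 1 x * h x"] that by (simp add: g_def mult.assoc continuous_intros cS)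
      have "(\<integral>x. g x * q x \<partial>I01) = (\<integral>x. g x * q x \<partial>I01) - (\<integral>x. g x * p (C x) \<partial>I01)"
        using poly[OF p(1)] by simp
      also have "\<dots> = (\<integral>x. g x * q x - g x * p (C x) \<partial>I01)"
        by (intro Bochner_Integration.integral_diff[symmetric] i1 q cpC)
      also have "\<bar>\<dots>\<bar> \<le> (\<integral>x. e * \<bar>g x\<bar> \<partial>I01)"
      proof (rule order.trans[OF integral_abs_bound integral_mono])
        fix x assume "x \<in> space I01"
        then have x: "x \<in> {0..1}" by (simp add: space_restrict_space)
        then have "\<bar>q x - p (C x)\<bar> < e" using p(2)[of "C x"] QC[OF x] by (simp add: C_def)
        then have "\<bar>g x\<bar> * \<bar>q x - p (C x)\<bar> \<le> \<bar>g x\<bar> * e" by (intro mult_left_mono) auto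
        then show "\<bar>g x * q x - g x * p (C x)\<bar> \<le> e * \<bar>g x\<bar>"
          by (simp add: abs_mult[symmetric] right_diff_distrib mult.commute)
      qed (use gint i1[OF q] i1[OF cpC] in auto)
      also have "\<dots> = e * B" by (simp add: B_def)
      also have "\<dots> \<le> e * (B + 1)" using e by simp
      finally show ?thesis .
    qed note bnd = this
    have "B \<ge> 0" by (simp add: B_def)
    have "\<bar>\<integral>x. g x * q x \<partial>I01\<bar> \<le> 0 + e" if "e > 0" for e
      using bnd[of "e / (B + 1)"] that \<open>B \<ge> 0\<close> by simp
    then have "\<bar>\<integral>x. g x * q x \<partial>I01\<bar> \<le> 0" by (rule field_le_epsilon)
    then show ?thesis by simp
  qed
  have "AE x in I01. g x = 0"
  proof (rule AE_zero_of_integrals_zero)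
    show "g integrable_on {0..1}" by (rule integrable_on_lebesgue_on[OF gint]) simp
    fix a :: real assume a: "a \<in> {0..1}"
    define q where "q n x = max 0 (min 1 (1 - real n * (x - a)))" for n x
    have cq: "continuous_on {0..1} (q n)" for n unfolding q_def[abs_def] by (intro continuous_intros)
    have lim: "(\<lambda>n. q n x) \<longlonglongrightarrow> indicator {0..a} x" if x: "x \<in> {0..1}" for x
    proof (cases "x \<le> a")
      case True
      then have "real n * (x - a) \<le> 0" for n by (simp add: mult_nonneg_nonpos)
      then have "q n x = 1" for n using order.trans[of "real n * (x - a)" 0 1] by (simp add: q_def min_def max_def)
      then show ?thesis using True x by simp
    next
      case False
      then obtain n0 :: nat where n0: "real n0 * (x - a) > 1" using reals_Archimedean3[of "x - a"] by auto
      have "q n x = 0" if "n \<ge> n0" for n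
      proof -
        have "real n0 * (x - a) \<le> real n * (x - a)" using that False by (intro mult_right_mono) auto
        then show ?thesis using n0 by (simp add: q_def)
      qed
      then have "(\<lambda>n. q n x) \<longlonglongrightarrow> 0" by (intro tendsto_eventually) (auto simp: eventually_sequentially)
      then show ?thesis using False by simp
    qed
    have "(\<lambda>n. \<integral>x. g x * q n x \<partial>I01) \<longlonglongrightarrow> (\<integral>x. g x * indicator {0..a} x \<partial>I01)"
    proof (rule integral_dominated_convergence[where w = "\<lambda>x. \<bar>g x\<bar>"])
      show "(\<lambda>x. g x * q i x) \<in> borel_measurable I01" for i
        using borel_measurable_integrable[OF gint] borel_measurable_integrable[OF continuous_imp_integrable_real[OF cq]]
        by (rule borel_measurable_times)
      show "(\<lambda>x. g x * indicator {0..a} x) \<in> borel_measurable I01"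
        using borel_measurable_integrable[OF gint]
        using a by (intro borel_measurable_times borel_measurable_indicator) (auto simp: sets_restrict_space_iff)
      show "AE x in I01. (\<lambda>i. g x * q i x) \<longlonglongrightarrow> g x * indicator {0..a} x"
        using lim by (intro AE_I2 tendsto_intros) (simp add: space_restrict_space)
      have "\<bar>q i x\<bar> \<le> 1" for i x by (simp add: q_def)
      then show "AE x in I01. norm (g x * q i x) \<le> \<bar>g x\<bar>" for i
        by (auto simp: abs_mult mult_left_le)
    qed (use gint in auto)
    then have "(\<integral>x. g x * indicator {0..a} x \<partial>I01) = 0"
      using gq[OF cq] by (simp add: LIMSEQ_const_iff)
    moreover have "(\<integral>x. g x * indicator {0..a} x \<partial>I01) = integral {0..a} g"
    proof -
      have "integrable I01 (\<lambda>x. g x * indicator {0..a} x)"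
        by (rule integrable_real_mult_indicator[OF _ gint]) (use a in \<open>auto simp: sets_restrict_space_iff\<close>)
      then have "(\<integral>x. g x * indicator {0..a} x \<partial>I01) = integral {0..1} (\<lambda>x. g x * indicator {0..a} x)"
        by (rule I01_integral_eq)
      also have "\<dots> = integral {0..1} (\<lambda>x. if x \<in> {0..a} then g x else 0)"
        by (intro integral_cong) (simp add: indicator_def)
      also have "\<dots> = integral ({0..a} \<inter> {0..1}) g" by (rule integral_restrict_Int)
      also have "{0..a} \<inter> {0..1} = {0..a}" using a by auto
      finally show ?thesis .
    qed
    ultimately show "integral {0..a} g = 0" by simp
  qed
  moreover have "AE x in I01. x \<notin> {0, 1}"
  proof -
    have "{0, 1::real} \<in> null_sets lebesgue" by (simp add: negligible_iff_null_sets[symmetric])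
    then have "AE x in lebesgue. x \<notin> {0, 1::real}" by (rule AE_not_in)
    then show ?thesis by (subst AE_restrict_space_iff) auto
  qed
  moreover have "AE x in I01. x \<in> {0..1}" by (rule AE_I2) (simp add: space_restrict_space)
  ultimately show ?thesis
  proof eventually_elim
    fix x :: real assume "g x = 0" "x \<notin> {0, 1}" "x \<in> {0..1}"
    moreover from this have "sin (pi * x) > 0" by (intro sin_gt_zero) (auto simp: less_le mult_le_cancel_left1)
    ultimately show "f x = 0" by (simp add: g_def S_def)
  qed
qed


lemma sine_sum_sq:
  assumes "finite F"
  shows "(\<integral>x. (\<Sum>k\<in>F. c k * sine k x)^2 \<partial>I01) = (\<Sum>k\<in>F. (c k)^2)"
proof -
  have int: "integrable I01 (\<lambda>x. c j * c k * (sine j x * sine k x))" for j k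
    by (intro integrable_mult_right L2_mult_integrable L2_sine)
  have "(\<integral>x. (\<Sum>k\<in>F. c k * sine k x)^2 \<partial>I01) = (\<integral>x. (\<Sum>j\<in>F. \<Sum>k\<in>F. c j * c k * (sine j x * sine k x)) \<partial>I01)"
    by (simp add: power2_eq_square sum_product mult_ac)
  also have "\<dots> = (\<Sum>j\<in>F. \<Sum>k\<in>F. c j * c k * (\<integral>x. sine j x * sine k x \<partial>I01))"
    using int by (simp add: Bochner_Integration.integral_sum)
  also have "\<dots> = (\<Sum>k\<in>F. (c k)^2)"
    using assms by (simp add: sine_orthonormal power2_eq_square sum.delta if_distrib cong: if_cong)
  finally show ?thesis .
qed

theorem Riesz_Fischer_sine:
  assumes s: "summable (\<lambda>k. (c k)^2)"
  obtains g where "L2 I01 g" "\<And>k. coef g k = c k" "(\<lambda>n. \<integral>x. ((\<Sum>k<n. c k * sine k x) - g x)^2 \<partial>I01) \<longlonglongrightarrow> 0"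
proof -
  define S where "S n x = (\<Sum>k<n. c k * sine k x)" for n x
  have LS: "L2 I01 (S n)" for n unfolding S_def[abs_def] by (intro L2_sum L2_cmult L2_sine)
  have d: "(\<integral>x. (S m x - S n x)^2 \<partial>I01) = (\<Sum>k\<in>{n..<m}. (c k)^2)" if "n \<le> m" for m n
  proof -
    have "S m x - S n x = (\<Sum>k\<in>{n..<m}. c k * sine k x)" for x
      using sum_diff_nat_ivl[of 0 n m "\<lambda>k. c k * sine k x"] that by (simp add: S_def atLeast0LessThan)
    then show ?thesis using sine_sum_sq[of "{n..<m}" c] by simp
  qed
  have "\<exists>N. \<forall>m\<ge>N. \<forall>n\<ge>N. (\<integral>x. (S m x - S n x)^2 \<partial>I01) < e" if e: "e > 0" for e
  proof -
    obtain N where N: "\<And>m n. m \<ge> N \<Longrightarrow> norm (\<Sum>k\<in>{m..<n}. (c k)^2) < e"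
      using s e unfolding summable_Cauchy by blast
    have le: "(\<integral>x. (S m x - S n x)^2 \<partial>I01) < e" if "n \<ge> N" "n \<le> m" for m n
      using N[OF that(1), of m] d[OF that(2)] by (simp add: abs_less_iff)
    have "(\<integral>x. (S m x - S n x)^2 \<partial>I01) < e" if "m \<ge> N" "n \<ge> N" for m n
    proof (cases "n \<le> m")
      case True then show ?thesis using le that by blast
    next
      case False
      then have "(\<integral>x. (S n x - S m x)^2 \<partial>I01) < e" using le that by simp
      then show ?thesis by (simp add: power2_commute)
    qed
    then show ?thesis by blast
  qed
  then obtain g where g: "L2 I01 g" "(\<lambda>n. \<integral>x. (S n x - g x)^2 \<partial>I01) \<longlonglongrightarrow> 0"
    using L2_complete[of I01 S] LS by blast
  have "coef g k = c k" for k
  proof -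
    have "(\<lambda>n. nrm I01 (\<lambda>x. S n x - g x)) \<longlonglongrightarrow> sqrt 0"
      unfolding nrm_def by (intro tendsto_real_sqrt g(2))
    then have "(\<lambda>n. coef (\<lambda>x. S n x - g x) k) \<longlonglongrightarrow> 0"
      by (intro Lim_null_comparison[of "\<lambda>n. coef (\<lambda>x. S n x - g x) k"])
        (auto intro!: always_eventually coef_bound L2_diff LS g(1))
    moreover have "coef (\<lambda>x. S n x - g x) k = c k - coef g k" if "n > k" for n
    proof -
      have "coef (S n) k = (\<Sum>j<n. c j * (if j = k then 1 else 0))"
        unfolding S_def[abs_def] by (simp add: coef_sum L2_cmult coef_cmult coef_sine)
      also have "\<dots> = (\<Sum>j<n. if j = k then c j else 0)" by (intro sum.cong) auto
      also have "\<dots> = c k" using that by simp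
      finally have "coef (S n) k = c k" .
      then show ?thesis using that by (simp add: coef_diff LS g(1))
    qed
    then have "(\<lambda>n. coef (\<lambda>x. S n x - g x) k) \<longlonglongrightarrow> c k - coef g k"
      by (intro tendsto_eventually) (auto simp: eventually_sequentially intro!: exI[of _ "Suc k"])
    ultimately show ?thesis using LIMSEQ_unique by fastforce
  qed
  then show ?thesis using that g unfolding S_def by blast
qed

lemma Bessel_sine:
  assumes f: "L2 I01 f"
  shows "(\<integral>x. ((\<Sum>k<n. coef f k * sine k x) - f x)^2 \<partial>I01) = (\<integral>x. (f x)^2 \<partial>I01) - (\<Sum>k<n. (coef f k)^2)"
proof -
  define S where "S x = (\<Sum>k<n. coef f k * sine k x)" for x
  have LS: "L2 I01 S" unfolding S_def[abs_def] by (intro L2_sum L2_cmult L2_sine)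
  have "(\<integral>x. f x * S x \<partial>I01) = (\<integral>x. (\<Sum>k<n. coef f k * (f x * sine k x)) \<partial>I01)"
    by (simp add: S_def sum_distrib_left mult_ac)
  also have "\<dots> = (\<Sum>k<n. coef f k * coef f k)"
    unfolding coef_def by (subst Bochner_Integration.integral_sum) (auto intro: L2_mult_integrable f)
  finally have fS: "(\<integral>x. f x * S x \<partial>I01) = (\<Sum>k<n. (coef f k)^2)" by (simp add: power2_eq_square)
  have SS: "(\<integral>x. (S x)^2 \<partial>I01) = (\<Sum>k<n. (coef f k)^2)"
    unfolding S_def by (rule sine_sum_sq) simp
  have "(\<integral>x. (S x - f x)^2 \<partial>I01) = (\<integral>x. (S x)^2 + (f x)^2 - 2 * (f x * S x) \<partial>I01)"
    by (simp add: power2_diff mult_ac)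
  also have "\<dots> = (\<integral>x. (f x)^2 \<partial>I01) - (\<Sum>k<n. (coef f k)^2)"
    using L2_sq_integrable[OF LS] L2_sq_integrable[OF f] L2_mult_integrable[OF f LS] by (simp add: fS SS)
  finally show ?thesis unfolding S_def .
qed

theorem Parseval_sine:
  assumes f: "L2 I01 f"
  shows "(\<lambda>k. (coef f k)^2) sums (\<integral>x. (f x)^2 \<partial>I01)"
proof -
  have le: "(\<Sum>k<n. (coef f k)^2) \<le> (\<integral>x. (f x)^2 \<partial>I01)" for n
  proof -
    have "0 \<le> (\<integral>x. ((\<Sum>k<n. coef f k * sine k x) - f x)^2 \<partial>I01)" by simp
    then show ?thesis unfolding Bessel_sine[OF f] by simp
  qed
  have "summable (\<lambda>k. (coef f k)^2)"
    by (rule summableI_nonneg_bounded[of _ "\<integral>x. (f x)^2 \<partial>I01"]) (use le in auto)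
  then obtain g where g: "L2 I01 g" "\<And>k. coef g k = coef f k"
    "(\<lambda>n. \<integral>x. ((\<Sum>k<n. coef f k * sine k x) - g x)^2 \<partial>I01) \<longlonglongrightarrow> 0"
    using Riesz_Fischer_sine by blast
  have "AE x in I01. f x - g x = 0"
    by (rule sine_complete[OF L2_diff[OF f g(1)]]) (simp add: coef_diff f g)
  moreover have LS: "L2 I01 (\<lambda>x. \<Sum>k<n. coef f k * sine k x)" for n by (intro L2_sum L2_cmult L2_sine)
  ultimately have "(\<integral>x. ((\<Sum>k<n. coef f k * sine k x) - g x)^2 \<partial>I01) = (\<integral>x. ((\<Sum>k<n. coef f k * sine k x) - f x)^2 \<partial>I01)" for n
    using borel_measurable_integrable[OF L2_sq_integrable[OF L2_diff[OF LS f]]]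
      borel_measurable_integrable[OF L2_sq_integrable[OF L2_diff[OF LS g(1)]]]
    by (intro integral_cong_AE) (auto elim: eventually_mono)
  then have "(\<lambda>n. (\<integral>x. (f x)^2 \<partial>I01) - (\<Sum>k<n. (coef f k)^2)) \<longlonglongrightarrow> 0"
    using g(3) by (simp add: Bessel_sine[OF f])
  then have "(\<lambda>n. (\<integral>x. (f x)^2 \<partial>I01) - ((\<integral>x. (f x)^2 \<partial>I01) - (\<Sum>k<n. (coef f k)^2))) \<longlonglongrightarrow> (\<integral>x. (f x)^2 \<partial>I01) - 0"
    by (intro tendsto_intros)
  then show ?thesis by (simp add: sums_def)
qed

lemma Parseval_sine_mult:
  assumes f: "L2 I01 f" and g: "L2 I01 g"
  shows "(\<lambda>k. coef f k * coef g k) sums (\<integral>x. f x * g x \<partial>I01)"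
proof -
  have "(\<lambda>k. ((coef f k + coef g k)^2 - (coef f k)^2 - (coef g k)^2) / 2) sums
     (((\<integral>x. (f x + g x)^2 \<partial>I01) - (\<integral>x. (f x)^2 \<partial>I01) - (\<integral>x. (g x)^2 \<partial>I01)) / 2)"
    using Parseval_sine[OF L2_add[OF f g]] Parseval_sine[OF f] Parseval_sine[OF g]
    by (intro sums_divide sums_diff) (simp_all add: coef_add f g)
  moreover have "(\<integral>x. (f x + g x)^2 \<partial>I01) = (\<integral>x. (f x)^2 + (g x)^2 + 2 * (f x * g x) \<partial>I01)"
    by (simp add: power2_sum mult_ac)
  then have "(\<integral>x. (f x + g x)^2 \<partial>I01) = (\<integral>x. (f x)^2 \<partial>I01) + (\<integral>x. (g x)^2 \<partial>I01) + 2 * (\<integral>x. f x * g x \<partial>I01)"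
    using L2_sq_integrable[OF g] L2_sq_integrable[OF f] L2_mult_integrable[OF f g] by simp
  ultimately show ?thesis by (simp add: power2_sum)
qed

section \<open>The space \<open>H\<close> and the operator \<open>A\<close> in coordinates\<close>

lemma inH_iff: "inH f \<longleftrightarrow> L2 I01 f"
  unfolding inH_def L2_def set_borel_measurable_def set_integrable_def
  by (simp add: borel_measurable_restrict_space_iff integrable_restrict_space)

lemma normH_eq: "normH f = nrm I01 f"
  unfolding normH_def nrm_def set_lebesgue_integral_def
  by (simp add: integral_restrict_space)

lemma distH_eq: "distH f g = nrm I01 (\<lambda>x. f x - g x)"
  by (simp add: distH_def normH_eq)

lemma eqH_iff: "eqH f g \<longleftrightarrow> (AE x in I01. f x = g x)"
  unfolding eqH_def by (subst AE_restrict_space_iff) auto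

lemma normH_sums: "inH f \<Longrightarrow> (\<lambda>k. (coef f k)^2) sums (normH f)^2"
  by (simp add: inH_iff normH_eq nrm_power2 Parseval_sine)

lemma distH_sums: "inH f \<Longrightarrow> inH g \<Longrightarrow> (\<lambda>k. (coef f k - coef g k)^2) sums (distH f g)^2"
  using Parseval_sine[OF L2_diff[of I01 f g]]
  by (simp add: inH_iff distH_eq nrm_power2 coef_diff)

lemma inH_diff: "inH f \<Longrightarrow> inH g \<Longrightarrow> inH (\<lambda>x. f x - g x)"
  by (simp add: inH_iff L2_diff)

lemma eqH_iff_coef: "inH f \<Longrightarrow> inH g \<Longrightarrow> eqH f g \<longleftrightarrow> (\<forall>k. coef f k = coef g k)"
proof
  assume fg: "inH f" "inH g" and "\<forall>k. coef f k = coef g k"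
  then have "AE x in I01. f x - g x = 0"
    by (intro sine_complete) (auto simp: inH_iff L2_diff coef_diff)
  then show "eqH f g" unfolding eqH_iff by (auto elim: eventually_mono)
qed (auto simp: eqH_iff inH_iff intro: coef_cong_AE)

lemma inH_of_coef:
  assumes "summable (\<lambda>k. (c k)^2)"
  obtains g where "inH g" "\<And>k. coef g k = c k"
  using Riesz_Fischer_sine[OF assms] by (metis inH_iff)

lemma lebesgue_set_integral_eq:
  assumes "inH v" "x \<in> {0..1}"
  shows "(LINT s:{0..x}|lebesgue. v s) = integral {0..x} v"
proof -
  have "L2 (lebesgue_on {0..x}) v" by (rule L2_on_subset[of 0 1]) (use assms in \<open>auto simp: inH_iff\<close>)
  then have "integrable (lebesgue_on {0..x}) v" by (rule L2_on_integrable)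
  then have "set_integrable lebesgue {0..x} v" by (subst (asm) integrable_lebesgue_on_iff) auto
  then show ?thesis by (rule set_lebesgue_integral_eq_integral)
qed

lemma opA_coef:
  assumes "opA f v"
  shows "coef v k = lam k * coef f k"
proof -
  obtain g g1 where H: "inH f" "inH v" and g: "eqH f g" "g 0 = 0" "g 1 = 0"
    "\<And>x. x \<in> {0..1} \<Longrightarrow> (g has_real_derivative g1 x) (at x within {0..1})"
    and g1: "\<And>x. x \<in> {0..1} \<Longrightarrow> g1 x = g1 0 - (LINT s:{0..x}|lebesgue. v s)"
    using assms unfolding opA_def by blast
  define V where "V x = integral {0..x} v" for x
  have g1V: "g1 x = g1 0 - V x" if "x \<in> {0..1}" for x
    using g1[OF that] lebesgue_set_integral_eq[OF H(2) that] by (simp add: V_def)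
  have Lv: "L2 I01 v" using H by (simp add: inH_iff)
  have cV: "continuous_on {0..1} V" by (rule continuous_on_indefinite_integral[OF Lv, of _ 0]) (simp add: V_def)
  have "continuous_on {0..1} (\<lambda>x. g1 0 - V x)" by (intro continuous_intros cV)
  moreover have "continuous_on {0..1} g1 \<longleftrightarrow> continuous_on {0..1} (\<lambda>x. g1 0 - V x)"
    by (rule continuous_on_cong[OF refl]) (rule g1V)
  ultimately have cg1: "continuous_on {0..1} g1" by simp
  have cg: "continuous_on {0..1} g"
    using DERIV_continuous[OF g(4)] unfolding continuous_on_eq_continuous_within by blast
  have gint: "g x = 0 + integral {0..x} g1" if "x \<in> {0..1}" for x
  proof -
    have "(g1 has_integral (g x - g 0)) {0..x}"
      using that g(4) by (intro fundamental_theorem_of_calculus)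
        (auto simp: has_real_derivative_iff_has_vector_derivative intro!: has_vector_derivative_within_subset[of g _ _ "{0..1}" "{0..x}"])
    then show ?thesis using g(2) by (simp add: integral_unique)
  qed
  have Lc: "L2 I01 (cosine k)" "L2 I01 g1" by (intro L2_on_continuous continuous_intros cg1)+
  have s: "sine k x = 0 + integral {0..x} (cosine k)" if "x \<in> {0..1}" for x
    using that by (simp add: integral_cosine)
  have c: "cosine k x = cosine k 0 + integral {0..x} (\<lambda>y. - lam k * sine k y)" if "x \<in> {0..1}" for x
    using that integral_lam_sine[of x k] by simp
  have i1: "((\<lambda>x. v x * sine k x + V x * cosine k x) has_integral (V 1 * sine k 1 - V 0 * sine k 0)) {0..1}"
    by (rule integration_by_parts_L2[OF Lv _ Lc(1) s]) (auto simp: V_def)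
  have i2: "((\<lambda>x. g1 x * cosine k x + g x * (- lam k * sine k x)) has_integral (g 1 * cosine k 1 - g 0 * cosine k 0)) {0..1}"
    by (rule integration_by_parts_L2[OF Lc(2) gint L2_cmult[OF L2_sine] c]) auto
  have i3: "(cosine k has_integral sine k 1) {0..1}"
    using integrable_on_lebesgue_on[OF L2_on_integrable(1)[OF Lc(1)]] integral_cosine[of 1 k]
    by (simp add: has_integral_iff)
  have "((\<lambda>x. (v x * sine k x + V x * cosine k x) + (g1 x * cosine k x + g x * (- lam k * sine k x)) - g1 0 * cosine k x) has_integral
     0 + 0 - g1 0 * sine k 1) {0..1}"
    using i1 i2 g by (intro has_integral_add has_integral_diff has_integral_mult_right i3) simp_all
  moreover have "(v x * sine k x + V x * cosine k x) + (g1 x * cosine k x + g x * (- lam k * sine k x)) - g1 0 * cosine k x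
      = v x * sine k x - lam k * (g x * sine k x)" if "x \<in> {0..1}" for x
    unfolding g1V[OF that] by (simp add: algebra_simps)
  ultimately have z: "((\<lambda>x. v x * sine k x - lam k * (g x * sine k x)) has_integral 0 + 0 - g1 0 * sine k 1) {0..1}"
    by (rule has_integral_eq[rotated])
  have Hg: "inH g" using cg by (simp add: inH_iff L2_on_continuous)
  have h: "((\<lambda>x. u x * sine k x) has_integral coef u k) {0..1}" if "inH u" for u
    unfolding coef_def using that L2_mult_integrable[OF _ L2_sine, of u k]
    by (intro has_integral_integral_lebesgue_on) (simp_all add: inH_iff)
  have "coef v k - lam k * coef g k = 0 + 0 - g1 0 * sine k 1"
    by (rule has_integral_unique[OF has_integral_diff[OF h[OF H(2)] has_integral_mult_right[OF h[OF Hg]]] z])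
  then have "coef v k = lam k * coef g k" by simp
  then show ?thesis using g(1) H(1) Hg eqH_iff_coef by simp
qed

theorem opA_iff: "opA f v \<longleftrightarrow> inH f \<and> inH v \<and> (\<forall>k. coef v k = lam k * coef f k)"
proof
  assume "opA f v"
  then show "inH f \<and> inH v \<and> (\<forall>k. coef v k = lam k * coef f k)"
    using opA_coef by (auto simp: opA_def)
next
  assume a: "inH f \<and> inH v \<and> (\<forall>k. coef v k = lam k * coef f k)"
  define V where "V x = integral {0..x} v" for x
  define c where "c = integral {0..1} V"
  define g1 where "g1 x = c - V x" for x
  define g where "g x = c * x - integral {0..x} V" for x
  have Lv: "L2 I01 v" using a by (simp add: inH_iff)
  have cV: "continuous_on {0..1} V" by (rule continuous_on_indefinite_integral[OF Lv, of _ 0]) (simp add: V_def)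
  have dg: "(g has_real_derivative g1 x) (at x within {0..1})" if "x \<in> {0..1}" for x
    unfolding g_def g1_def
    by (rule derivative_eq_intros integral_has_real_derivative[OF cV] that refl | simp)+
  then have "continuous_on {0..1} g"
    using DERIV_continuous[OF dg] unfolding continuous_on_eq_continuous_within by blast
  then have Hg: "inH g" by (simp add: inH_iff L2_on_continuous)
  have op: "opA h v" if "inH h" "eqH h g" for h
  proof -
    have "g1 x = g1 0 - (LINT s:{0..x}|lebesgue. v s)" if "x \<in> {0..1}" for x
      using a that lebesgue_set_integral_eq[of v x] by (simp add: g1_def V_def)
    moreover have "g 0 = 0" "g 1 = 0" by (simp_all add: g_def c_def)
    ultimately show ?thesis unfolding opA_def using that dg a by blast
  qed
  have "coef v k = lam k * coef g k" for k
    by (rule opA_coef[OF op[OF Hg]]) (simp add: eqH_iff)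
  then have "lam k * coef f k = lam k * coef g k" for k using a by simp
  then have "coef f k = coef g k" for k using lam_pos[of k] by (metis mult_left_cancel less_irrefl)
  then have "eqH f g" using eqH_iff_coef[of f g] a Hg by simp
  then show "opA f v" using op a by blast
qed

section \<open>Forcing terms\<close>

definition forcing :: "real \<Rightarrow> (real \<Rightarrow> real \<Rightarrow> real) \<Rightarrow> bool" where
  "forcing \<tau> r \<longleftrightarrow> (\<forall>T>\<tau>. set_borel_measurable (lborel \<Otimes>\<^sub>M lborel) ({\<tau>..T} \<times> {0..1}) (\<lambda>p. r (fst p) (snd p))
               \<and> set_integrable (lborel \<Otimes>\<^sub>M lborel) ({\<tau>..T} \<times> {0..1}) (\<lambda>p. (r (fst p) (snd p))^2))"

lemma I01_transfer:
  fixes h :: "real \<Rightarrow> real"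
  assumes h: "h \<in> borel_measurable lborel" and z: "\<And>y. y \<notin> {0..1} \<Longrightarrow> h y = 0"
  shows "integrable I01 h \<longleftrightarrow> integrable lborel h" "(\<integral>y. h y \<partial>I01) = (\<integral>y. h y \<partial>lborel)"
proof -
  have e: "(\<lambda>y. indicator {0..1} y *\<^sub>R h y) = h" using z by (auto simp: indicator_def fun_eq_iff)
  have \<Omega>: "{0..1::real} \<inter> space lebesgue \<in> sets lebesgue" by simp
  show "integrable I01 h \<longleftrightarrow> integrable lborel h"
    unfolding integrable_restrict_space[OF \<Omega>] e by (rule integrable_completion[OF h])
  show "(\<integral>y. h y \<partial>I01) = (\<integral>y. h y \<partial>lborel)"
    unfolding integral_restrict_space[OF \<Omega>] e by (rule integral_completion[OF h])
qed

lemma borel_inH: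
  assumes g: "g \<in> borel_measurable lborel" and z: "\<forall>y. y \<notin> {0..1} \<longrightarrow> g y = (0::real)"
  shows "inH g \<longleftrightarrow> integrable lborel (\<lambda>y. (g y)^2)" "(normH g)^2 = (\<integral>y. (g y)^2 \<partial>lborel)"
    "coef g k = (\<integral>y. g y * sine k y \<partial>lborel)"
proof -
  have [measurable]: "g \<in> borel_measurable borel" "sine k \<in> borel_measurable borel"
    using g by (auto intro: borel_measurable_continuous_onI continuous_on_sine)
  have "g \<in> borel_measurable I01"
    using g by (intro measurable_restrict_space1 measurable_completion) auto
  then show "inH g \<longleftrightarrow> integrable lborel (\<lambda>y. (g y)^2)"
    unfolding inH_iff L2_def by (subst I01_transfer) (use z in auto)
  show "(normH g)^2 = (\<integral>y. (g y)^2 \<partial>lborel)"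
    unfolding normH_eq nrm_power2 by (rule I01_transfer) (use z in auto)
  show "coef g k = (\<integral>y. g y * sine k y \<partial>lborel)"
    unfolding coef_def by (rule I01_transfer) (use z in auto)
qed

lemma inH_cong:
  assumes "\<And>y. y \<in> {0..1} \<Longrightarrow> f y = g y"
  shows "inH f \<longleftrightarrow> inH g" "normH f = normH g" "coef f k = coef g k"
proof -
  have s: "\<And>y. y \<in> space I01 \<Longrightarrow> f y = g y" using assms by (simp add: space_restrict_space)
  show "inH f \<longleftrightarrow> inH g" unfolding inH_iff L2_def
    using measurable_cong[of I01 f g borel] Bochner_Integration.integrable_cong[of I01 I01 "\<lambda>x. (f x)^2" "\<lambda>x. (g x)^2"] s by simp
  show "normH f = normH g" unfolding normH_eq nrm_def
    by (intro arg_cong[where f = sqrt] Bochner_Integration.integral_cong) (use s in auto)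
  show "coef f k = coef g k" unfolding coef_def
    by (intro Bochner_Integration.integral_cong) (use s in auto)
qed

lemma slices:
  fixes F :: "real \<times> real \<Rightarrow> real"
  assumes F: "L2 (lborel \<Otimes>\<^sub>M lborel) F" and z: "\<forall>t y. y \<notin> {0..1} \<longrightarrow> F (t, y) = 0"
  shows "AE t in lborel. inH (\<lambda>y. F (t, y))"
    and "integrable lborel (\<lambda>t. (normH (\<lambda>y. F (t, y)))^2)"
    and "(\<integral>t. (normH (\<lambda>y. F (t, y)))^2 \<partial>lborel) = (\<integral>p. (F p)^2 \<partial>(lborel \<Otimes>\<^sub>M lborel))"
    and "L2 lborel (\<lambda>t. coef (\<lambda>y. F (t, y)) k)"
proof -
  have Fm [measurable]: "F \<in> borel_measurable (lborel \<Otimes>\<^sub>M lborel)" and Fi: "integrable (lborel \<Otimes>\<^sub>M lborel) (\<lambda>p. (F p)^2)"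
    using F unfolding L2_def by auto
  have [measurable]: "sine k \<in> borel_measurable borel"
    by (auto intro: borel_measurable_continuous_onI continuous_on_sine)
  have sl: "(\<lambda>y. F (t, y)) \<in> borel_measurable lborel" for t by measurable
  note b = borel_inH[OF sl spec[OF z]]
  show A: "AE t in lborel. inH (\<lambda>y. F (t, y))"
    unfolding b(1) using lborel_pair.AE_integrable_fst'[OF Fi] by simp
  show I: "integrable lborel (\<lambda>t. (normH (\<lambda>y. F (t, y)))^2)"
    unfolding b(2) using lborel_pair.integrable_fst'[OF Fi] by simp
  show "(\<integral>t. (normH (\<lambda>y. F (t, y)))^2 \<partial>lborel) = (\<integral>p. (F p)^2 \<partial>(lborel \<Otimes>\<^sub>M lborel))"
    unfolding b(2) using lborel_pair.integral_fst'[OF Fi] by simp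
  have m: "(\<lambda>t. coef (\<lambda>y. F (t, y)) k) \<in> borel_measurable lborel"
    unfolding b(3) by measurable
  moreover have "integrable lborel (\<lambda>t. (coef (\<lambda>y. F (t, y)) k)^2)"
  proof (rule Bochner_Integration.integrable_bound[OF I])
    show "(\<lambda>t. (coef (\<lambda>y. F (t, y)) k)^2) \<in> borel_measurable lborel" using m by measurable
    show "AE t in lborel. norm ((coef (\<lambda>y. F (t, y)) k)^2) \<le> norm ((normH (\<lambda>y. F (t, y)))^2)"
      using A
    proof eventually_elim
      fix t assume "inH (\<lambda>y. F (t, y))"
      then have "\<bar>coef (\<lambda>y. F (t, y)) k\<bar> \<le> normH (\<lambda>y. F (t, y))"
        by (simp add: coef_bound inH_iff normH_eq)
      then show "norm ((coef (\<lambda>y. F (t, y)) k)^2) \<le> norm ((normH (\<lambda>y. F (t, y)))^2)"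
        by (simp add: abs_le_square_iff[symmetric] normH_eq)
    qed
  qed
  ultimately show "L2 lborel (\<lambda>t. coef (\<lambda>y. F (t, y)) k)" by (simp add: L2_def)
qed

lemma normH_nonneg [simp]: "normH f \<ge> 0"
  by (simp add: normH_eq)

lemma distH_nonneg [simp]: "distH f g \<ge> 0"
  by (simp add: distH_def)

lemma L2_lborel_imp_on:
  assumes "L2 lborel (f :: real \<Rightarrow> real)" shows "L2 (lebesgue_on {a..b}) f"
proof -
  have m: "f \<in> borel_measurable lborel" and i: "integrable lborel (\<lambda>x. (f x)^2)" using assms by (auto simp: L2_def)
  have "integrable lebesgue (\<lambda>x. (f x)^2)" using i m by (subst integrable_completion) auto
  then have "set_integrable lebesgue {a..b} (\<lambda>x. (f x)^2)"
    unfolding set_integrable_def by (intro integrable_mult_indicator) auto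
  then have "integrable (lebesgue_on {a..b}) (\<lambda>x. (f x)^2)" by (subst integrable_lebesgue_on_iff) simp_all
  moreover have "f \<in> borel_measurable (lebesgue_on {a..b})"
    by (rule measurable_restrict_space1[OF measurable_completion[OF m]])
  ultimately show ?thesis unfolding L2_def by blast
qed

lemma L2_on_cong:
  assumes "L2 (lebesgue_on S) g" "\<And>x. x \<in> S \<Longrightarrow> f x = g x"
  shows "L2 (lebesgue_on S) f"
proof -
  have s: "\<And>y. y \<in> space (lebesgue_on S) \<Longrightarrow> f y = g y" using assms(2) by (simp add: space_restrict_space)
  show ?thesis using assms(1) unfolding L2_def
    using measurable_cong[of "lebesgue_on S" f g borel]
      Bochner_Integration.integrable_cong[of "lebesgue_on S" "lebesgue_on S" "\<lambda>x. (f x)^2" "\<lambda>x. (g x)^2"] s by simp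
qed

lemma forcing_slices:
  assumes r: "forcing \<tau> r" and T: "\<tau> < T"
  shows "AE t in lborel. t \<in> {\<tau>..T} \<longrightarrow> inH (r t)"
    and "(\<lambda>t. (normH (r t))^2) integrable_on {\<tau>..T}"
    and "L2 (lebesgue_on {\<tau>..T}) (\<lambda>t. coef (r t) k)"
proof -
  define F where "F p = indicator ({\<tau>..T} \<times> {0..1}) p *\<^sub>R r (fst p) (snd p)" for p
  have "(\<lambda>p. (F p)^2) = (\<lambda>p. indicator ({\<tau>..T} \<times> {0..1}) p *\<^sub>R (r (fst p) (snd p))^2)"
    by (auto simp: F_def indicator_def fun_eq_iff)
  then have LF: "L2 (lborel \<Otimes>\<^sub>M lborel) F"
    using r T unfolding forcing_def set_borel_measurable_def set_integrable_def L2_def F_def[abs_def] by simp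
  have z: "\<forall>t y. y \<notin> {0..1} \<longrightarrow> F (t, y) = 0" by (simp add: F_def)
  note s = slices[OF LF z]
  have c: "F (t, y) = r t y" if "t \<in> {\<tau>..T}" "y \<in> {0..1}" for t y using that by (simp add: F_def)
  show "AE t in lborel. t \<in> {\<tau>..T} \<longrightarrow> inH (r t)"
    using s(1)
  proof eventually_elim
    fix t assume "inH (\<lambda>y. F (t, y))"
    then show "t \<in> {\<tau>..T} \<longrightarrow> inH (r t)" using inH_cong(1)[of "\<lambda>y. F (t, y)" "r t"] c by blast
  qed
  have "(\<lambda>t. (normH (\<lambda>y. F (t, y)))^2) integrable_on UNIV"
    by (rule integrable_on_lborel) (rule s(2))
  then have "(\<lambda>t. (normH (\<lambda>y. F (t, y)))^2) integrable_on {\<tau>..T}"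
    by (rule integrable_on_subinterval[of _ UNIV]) auto
  then show "(\<lambda>t. (normH (r t))^2) integrable_on {\<tau>..T}"
    by (rule integrable_eq) (use inH_cong(2) c in metis)
  show "L2 (lebesgue_on {\<tau>..T}) (\<lambda>t. coef (r t) k)"
    by (rule L2_on_cong[OF L2_lborel_imp_on[OF s(4)[of k]]]) (use inH_cong(3) c in metis)
qed

lemma AE_lborel_negligible:
  assumes "AE t in lborel. P t"
  obtains N where "negligible N" "\<And>t::real. t \<notin> N \<Longrightarrow> P t"
proof -
  obtain N where "\<And>x. x \<in> space lborel - N \<Longrightarrow> P x" "N \<in> null_sets lborel" using AE_E3[OF assms] by blast
  then show ?thesis using that[of N] by (auto simp: negligible_iff_null_sets intro: null_sets_completionI)
qed

lemma negligible_AE_lborel: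
  assumes "negligible N" "\<And>t::real. t \<notin> N \<Longrightarrow> P t"
  shows "AE t in lborel. P t"
proof -
  have "AE t in lebesgue. t \<notin> N" using assms(1) by (intro AE_not_in) (simp add: negligible_iff_null_sets)
  then have "AE t in lebesgue. P t" by (rule eventually_mono) (use assms(2) in blast)
  then show ?thesis by (simp add: AE_completion_iff)
qed

section \<open>Energy estimates for a scalar mode\<close>

lemma mode_properties:
  fixes \<rho> u :: "real \<Rightarrow> real"
  assumes rho: "L2 (lebesgue_on {a..b}) \<rho>" and l: "l \<ge> 1" and ab: "a \<le> b"
    and ode: "\<And>s t. a \<le> s \<Longrightarrow> s \<le> t \<Longrightarrow> t \<le> b \<Longrightarrow> ((\<lambda>x. \<rho> x - l * u x) has_integral (u t - u s)) {s..t}"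
  shows mode_continuous: "continuous_on {a..b} u"
    and mode_L2: "L2 (lebesgue_on {a..b}) (\<lambda>x. \<rho> x - l * u x)"
    and mode_energy1: "l * (u b)^2 + integral {a..b} (\<lambda>x. l^2 * (u x)^2) \<le> l * (u a)^2 + integral {a..b} (\<lambda>x. (\<rho> x)^2)"
    and mode_energy2: "(u b)^2 + integral {a..b} (\<lambda>x. l * (u x)^2) \<le> (u a)^2 + integral {a..b} (\<lambda>x. (\<rho> x)^2)"
proof -
  have ui: "u x = u a + integral {a..x} (\<lambda>x. \<rho> x - l * u x)" if "x \<in> {a..b}" for x
    using ode[of a x] that by (simp add: integral_unique)
  have "(\<lambda>x. \<rho> x - l * u x) integrable_on {a..b}" using ode[of a b] ab by (auto simp: integrable_on_def)
  then have "continuous_on {a..b} (\<lambda>x. integral {a..x} (\<lambda>x. \<rho> x - l * u x))" by (rule indefinite_integral_continuous_1)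
  then have "continuous_on {a..b} (\<lambda>x. u a + integral {a..x} (\<lambda>x. \<rho> x - l * u x))" by (intro continuous_intros)
  moreover have "continuous_on {a..b} u \<longleftrightarrow> continuous_on {a..b} (\<lambda>x. u a + integral {a..x} (\<lambda>x. \<rho> x - l * u x))"
    by (rule continuous_on_cong[OF refl]) (rule ui)
  ultimately show cu: "continuous_on {a..b} u" by simp
  show L: "L2 (lebesgue_on {a..b}) (\<lambda>x. \<rho> x - l * u x)"
    by (intro L2_diff rho L2_cmult L2_on_continuous cu)
  have "((\<lambda>x. (\<rho> x - l * u x) * u x + u x * (\<rho> x - l * u x)) has_integral (u b * u b - u a * u a)) {a..b}"
    by (rule integration_by_parts_L2[OF L ui L ui ab]) auto
  moreover have "(\<lambda>x. (\<rho> x - l * u x) * u x + u x * (\<rho> x - l * u x)) = (\<lambda>x. 2 * u x * (\<rho> x - l * u x))"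
    by (auto simp: algebra_simps)
  ultimately have E: "((\<lambda>x. 2 * u x * (\<rho> x - l * u x)) has_integral ((u b)^2 - (u a)^2)) {a..b}"
    by (simp add: power2_eq_square)
  have r2: "((\<lambda>x. (\<rho> x)^2) has_integral integral {a..b} (\<lambda>x. (\<rho> x)^2)) {a..b}"
    using L2_on_integrable(3)[OF rho] by (simp add: has_integral_integral)
  have u2: "((\<lambda>x. c * (u x)^2) has_integral integral {a..b} (\<lambda>x. c * (u x)^2)) {a..b}" for c
    by (intro integrable_integral integrable_continuous_interval continuous_intros cu)
  have "l * ((u b)^2 - (u a)^2) \<le> integral {a..b} (\<lambda>x. (\<rho> x)^2) - integral {a..b} (\<lambda>x. l^2 * (u x)^2)"
  proof (rule has_integral_le[OF has_integral_mult_right[OF E] has_integral_diff[OF r2 u2]])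
    fix x
    have "0 \<le> (\<rho> x - l * u x)^2" by simp
    then show "l * (2 * u x * (\<rho> x - l * u x)) \<le> (\<rho> x)^2 - l^2 * (u x)^2"
      by (simp add: power2_eq_square algebra_simps)
  qed
  then show "l * (u b)^2 + integral {a..b} (\<lambda>x. l^2 * (u x)^2) \<le> l * (u a)^2 + integral {a..b} (\<lambda>x. (\<rho> x)^2)"
    by (simp add: algebra_simps)
  have "(u b)^2 - (u a)^2 \<le> integral {a..b} (\<lambda>x. (\<rho> x)^2) - integral {a..b} (\<lambda>x. l * (u x)^2)"
  proof (rule has_integral_le[OF E has_integral_diff[OF r2 u2]])
    fix x
    have "0 \<le> (\<rho> x - u x)^2" by simp
    moreover have "(l - 1) * (u x)^2 \<ge> 0" using l by simp
    ultimately show "2 * u x * (\<rho> x - l * u x) \<le> (\<rho> x)^2 - l * (u x)^2"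
      by (simp add: power2_eq_square algebra_simps)
  qed
  then show "(u b)^2 + integral {a..b} (\<lambda>x. l * (u x)^2) \<le> (u a)^2 + integral {a..b} (\<lambda>x. (\<rho> x)^2)"
    by (simp add: algebra_simps)
qed

text \<open>Averaging \<open>mode_energy1\<close> over the initial time gives the smoothing estimate.\<close>
lemma mode_smoothing:
  fixes \<rho> u :: "real \<Rightarrow> real"
  assumes rho: "L2 (lebesgue_on {a..b}) \<rho>" and l: "l \<ge> 1" and ab: "a \<le> b"
    and ode: "\<And>s t. a \<le> s \<Longrightarrow> s \<le> t \<Longrightarrow> t \<le> b \<Longrightarrow> ((\<lambda>x. \<rho> x - l * u x) has_integral (u t - u s)) {s..t}"
  shows "(b - a) * (l * (u b)^2) \<le> (u a)^2 + (1 + (b - a)) * integral {a..b} (\<lambda>x. (\<rho> x)^2)"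
proof -
  define R where "R = integral {a..b} (\<lambda>x. (\<rho> x)^2)"
  note P = mode_properties[OF rho l ab ode]
  have ri: "(\<lambda>x. (\<rho> x)^2) integrable_on {a..b}" by (rule L2_on_integrable(3)[OF rho])
  have le: "l * (u b)^2 \<le> l * (u s)^2 + R" if s: "s \<in> {a..b}" for s
  proof -
    have "L2 (lebesgue_on {s..b}) \<rho>" by (rule L2_on_subset[OF rho]) (use s in auto)
    then have "l * (u b)^2 + integral {s..b} (\<lambda>x. l^2 * (u x)^2) \<le> l * (u s)^2 + integral {s..b} (\<lambda>x. (\<rho> x)^2)"
      by (rule mode_energy1[OF _ l]) (use s ode in auto)
    moreover have "integral {s..b} (\<lambda>x. (\<rho> x)^2) \<le> R" unfolding R_def
      by (rule integral_subset_le) (use s ri in \<open>auto intro: integrable_subinterval_real\<close>)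
    moreover have "integral {s..b} (\<lambda>x. l^2 * (u x)^2) \<ge> 0"
      by (intro integral_nonneg integrable_continuous_interval continuous_intros continuous_on_subset[OF P(1)])
        (use s in auto)
    ultimately show ?thesis by linarith
  qed
  have "integral {a..b} (\<lambda>s. l * (u b)^2) \<le> integral {a..b} (\<lambda>s. l * (u s)^2 + R)"
    by (intro integral_le integrable_continuous_interval continuous_intros P(1) le)
  also have "\<dots> = integral {a..b} (\<lambda>s. l * (u s)^2) + integral {a..b} (\<lambda>s. R)"
    by (intro integral_add integrable_continuous_interval continuous_intros P(1))
  finally have "integral {a..b} (\<lambda>s. l * (u b)^2) \<le> integral {a..b} (\<lambda>s. l * (u s)^2) + integral {a..b} (\<lambda>s. R)" .
  moreover have "integral {a..b} (\<lambda>s. c) = (b - a) * c" for c :: real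
    unfolding integral_const_real using ab by simp
  ultimately have "(b - a) * (l * (u b)^2) \<le> integral {a..b} (\<lambda>s. l * (u s)^2) + (b - a) * R"
    by (simp only:)
  moreover have "integral {a..b} (\<lambda>s. l * (u s)^2) \<le> (u a)^2 + R"
    using P(4) zero_le_power2[of "u b"] unfolding R_def by linarith
  ultimately show ?thesis unfolding R_def by (simp add: algebra_simps)
qed

lemma nonneg_series_integral:
  fixes f :: "nat \<Rightarrow> real \<Rightarrow> real"
  assumes f: "\<And>k. f k integrable_on {a..b}" and f0: "\<And>k x. f k x \<ge> 0"
    and C: "\<And>n. (\<Sum>k<n. integral {a..b} (f k)) \<le> C"
  obtains N G where "negligible N" "\<And>x. G x \<ge> 0" "G integrable_on {a..b}"
    "\<And>x. x \<in> {a..b} - N \<Longrightarrow> (\<lambda>k. f k x) sums G x"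
    "\<And>n s e. a \<le> s \<Longrightarrow> e \<le> b \<Longrightarrow> (\<Sum>k<n. integral {s..e} (f k)) \<le> integral {s..e} G"
proof -
  define S where "S n x = (\<Sum>k<n. f k x)" for n x
  have Si: "S n integrable_on {a..b}" for n unfolding S_def[abs_def] by (intro integrable_sum f) auto
  have Sint: "integral {a..b} (S n) = (\<Sum>k<n. integral {a..b} (f k))" for n
    unfolding S_def[abs_def] by (intro integral_sum f) auto
  have S0: "integral {a..b} (S n) \<ge> 0" for n
    by (rule integral_nonneg[OF Si]) (simp add: S_def sum_nonneg f0)
  have Sm: "S n x \<le> S (Suc n) x" for n x using f0[of n x] by (simp add: S_def)
  have Sb: "\<bar>integral {a..b} (S n)\<bar> \<le> C" for n using S0[of n] C[of n] by (simp add: Sint)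
  have fM: "integrable (lebesgue_on {a..b}) (f k)" for k
  proof -
    have "f k absolutely_integrable_on {a..b}" by (rule nonnegative_absolutely_integrable_1[OF f f0])
    then show ?thesis by (subst integrable_lebesgue_on_iff) simp_all
  qed
  have "(\<integral>\<^sup>+x. (\<Sum>k. ennreal (f k x)) \<partial>lebesgue_on {a..b}) = (\<Sum>k. \<integral>\<^sup>+x. ennreal (f k x) \<partial>lebesgue_on {a..b})"
    using borel_measurable_integrable[OF fM] by (intro nn_integral_suminf) simp
  also have "\<dots> = (\<Sum>k. ennreal (integral {a..b} (f k)))"
    using fM f0 by (simp add: nn_integral_eq_integral lebesgue_integral_eq_integral)
  also have "\<dots> \<le> ennreal C"
  proof (rule suminf_le_const)
    fix n
    have "(\<Sum>k<n. ennreal (integral {a..b} (f k))) = ennreal (\<Sum>k<n. integral {a..b} (f k))"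
      by (intro sum_ennreal integral_nonneg f f0)
    also have "\<dots> \<le> ennreal C" by (intro ennreal_leI C)
    finally show "(\<Sum>k<n. ennreal (integral {a..b} (f k))) \<le> ennreal C" .
  qed simp
  finally have "(\<integral>\<^sup>+x. (\<Sum>k. ennreal (f k x)) \<partial>lebesgue_on {a..b}) \<noteq> \<infinity>"
    by (auto simp: top_unique)
  then have "AE x in lebesgue_on {a..b}. (\<Sum>k. ennreal (f k x)) \<noteq> \<infinity>"
    using borel_measurable_integrable[OF fM] by (intro nn_integral_PInf_AE) auto
  then have "AE x in lebesgue. x \<in> {a..b} \<longrightarrow> (\<Sum>k. ennreal (f k x)) \<noteq> \<infinity>"
    by (subst (asm) AE_restrict_space_iff) simp_all
  then obtain N where N': "\<And>x. x \<in> space lebesgue - N \<Longrightarrow> x \<in> {a..b} \<longrightarrow> (\<Sum>k. ennreal (f k x)) \<noteq> \<infinity>"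
    and "N \<in> null_sets lebesgue" using AE_E3 by blast
  then have N: "negligible N" by (simp add: negligible_iff_null_sets)
  define g where "g x = (\<Sum>k. f k x)" for x
  have g: "(\<lambda>k. S k x) \<longlonglongrightarrow> g x" if "x \<in> {a..b} - N" for x
  proof -
    have "summable (\<lambda>k. f k x)"
      by (rule summable_suminf_not_top[OF f0]) (use N'[of x] that in simp)
    then show ?thesis unfolding S_def g_def by (rule summable_LIMSEQ)
  qed
  define G where "G x = (if x \<in> {a..b} - N then g x else 0)" for x
  define S' where "S' n x = (if x \<in> N then 0 else S n x)" for n x
  have Si': "S' n integrable_on {a..b}" for n
    by (rule integrable_spike[OF Si N]) (simp add: S'_def)
  have Sint': "integral {a..b} (S' n) = integral {a..b} (S n)" for n
    by (rule integral_spike[OF N]) (simp add: S'_def)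
  have SG: "S n x \<le> G x" if "x \<in> {a..b} - N" for n x
  proof -
    have "incseq (\<lambda>n. S n x)" by (rule incseq_SucI) (rule Sm)
    then show ?thesis using incseq_le[OF _ g[OF that]] that by (simp add: G_def)
  qed
  have lim: "(\<lambda>k. S' k x) \<longlonglongrightarrow> G x" if "x \<in> {a..b}" for x
    using g[of x] that by (cases "x \<in> N") (auto simp: S'_def G_def)
  have bd: "bounded (range (\<lambda>k. integral {a..b} (S' k)))"
    unfolding Sint' bounded_iff using Sb by (auto intro!: exI[of _ C])
  have Gi: "G integrable_on {a..b}"
    using monotone_convergence_increasing(1)[OF Si' _ lim bd] Sm by (auto simp: S'_def)
  show ?thesis
  proof (rule that[of N G])
    show "G x \<ge> 0" for x
      using SG[of x 0] by (cases "x \<in> {a..b} - N") (auto simp: S_def G_def)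
    show "(\<lambda>k. f k x) sums G x" if "x \<in> {a..b} - N" for x
      using g[OF that] that by (simp add: sums_def S_def G_def)
    fix n s e assume se: "a \<le> s" "e \<le> b"
    have sub: "{s..e} \<subseteq> {a..b}" using se by auto
    have fi: "f k integrable_on {s..e}" for k by (rule integrable_subinterval_real[OF f sub])
    have "(\<Sum>k<n. integral {s..e} (f k)) = integral {s..e} (S n)"
      unfolding S_def[abs_def] by (intro integral_sum[symmetric] fi) auto
    also have "\<dots> = integral {s..e} (S' n)"
      by (rule integral_spike[OF N, symmetric]) (simp add: S'_def)
    also have "\<dots> \<le> integral {s..e} G"
    proof (rule integral_le)
      show "S' n integrable_on {s..e}" "G integrable_on {s..e}"
        by (rule integrable_subinterval_real[OF Si' sub], rule integrable_subinterval_real[OF Gi sub])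
      fix x assume "x \<in> {s..e}"
      then show "S' n x \<le> G x" using SG[of x n] sub by (cases "x \<in> N") (auto simp: S'_def G_def)
    qed
    finally show "(\<Sum>k<n. integral {s..e} (f k)) \<le> integral {s..e} G" .
  qed (rule N, rule Gi)
qed

section \<open>Strong convergence from convergence of the coefficients\<close>

lemma distH_sq_le:
  assumes "inH x" "inH y"
  shows "(distH x y)^2 \<le> (\<Sum>k<n. (coef x k - coef y k)^2)
     + 2 * ((normH x)^2 - (\<Sum>k<n. (coef x k)^2)) + 2 * ((normH y)^2 - (\<Sum>k<n. (coef y k)^2))"
proof -
  have d: "(\<lambda>k. (coef x (k + n) - coef y (k + n))^2) sums ((distH x y)^2 - (\<Sum>k<n. (coef x k - coef y k)^2))"
    using distH_sums[OF assms] by (rule sums_split_initial_segment)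
  have 1: "(\<lambda>k. (coef x (k + n))^2) sums ((normH x)^2 - (\<Sum>k<n. (coef x k)^2))"
    using normH_sums[OF assms(1)] by (rule sums_split_initial_segment)
  have 2: "(\<lambda>k. (coef y (k + n))^2) sums ((normH y)^2 - (\<Sum>k<n. (coef y k)^2))"
    using normH_sums[OF assms(2)] by (rule sums_split_initial_segment)
  have "(distH x y)^2 - (\<Sum>k<n. (coef x k - coef y k)^2)
     \<le> 2 * ((normH x)^2 - (\<Sum>k<n. (coef x k)^2)) + 2 * ((normH y)^2 - (\<Sum>k<n. (coef y k)^2))"
  proof (rule sums_le[OF _ d sums_add[OF sums_mult[OF 1] sums_mult[OF 2]]])
    fix k
    have "0 \<le> (coef x (k + n) + coef y (k + n))^2" by simp
    then show "(coef x (k + n) - coef y (k + n))^2 \<le> 2 * (coef x (k + n))^2 + 2 * (coef y (k + n))^2"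
      by (simp add: power2_eq_square algebra_simps)
  qed
  then show ?thesis by linarith
qed

lemma distH_tendsto_coef:
  assumes x: "\<forall>\<^sub>F h in F. inH (x h)" and y: "inH y"
    and c: "\<And>k. ((\<lambda>h. coef (x h) k) \<longlongrightarrow> coef y k) F"
    and tail: "\<And>\<epsilon>. \<epsilon> > 0 \<Longrightarrow> \<exists>n0. \<forall>n\<ge>n0. \<forall>\<^sub>F h in F. (normH (x h))^2 - (\<Sum>k<n. (coef (x h) k)^2) \<le> \<epsilon>"
  shows "((\<lambda>h. distH (x h) y) \<longlongrightarrow> 0) F"
proof (rule tendstoI)
  fix e :: real assume "e > 0"
  define \<epsilon> where "\<epsilon> = e^2 / 6"
  have "\<epsilon> > 0" using \<open>e > 0\<close> by (simp add: \<epsilon>_def)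
  obtain n0 where n0: "\<And>n. n \<ge> n0 \<Longrightarrow> \<forall>\<^sub>F h in F. (normH (x h))^2 - (\<Sum>k<n. (coef (x h) k)^2) \<le> \<epsilon>"
    using tail[OF \<open>\<epsilon> > 0\<close>] by blast
  have "(\<lambda>n. \<Sum>k<n. (coef y k)^2) \<longlonglongrightarrow> (normH y)^2"
    using normH_sums[OF y] by (simp add: sums_def)
  then have "\<forall>\<^sub>F n in sequentially. dist (\<Sum>k<n. (coef y k)^2) ((normH y)^2) < \<epsilon>"
    using \<open>\<epsilon> > 0\<close> by (rule tendstoD)
  then obtain n1 where n1: "\<And>n. n \<ge> n1 \<Longrightarrow> dist (\<Sum>k<n. (coef y k)^2) ((normH y)^2) < \<epsilon>"
    by (auto simp: eventually_sequentially)
  define n where "n = max n0 n1"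
  have ty: "(normH y)^2 - (\<Sum>k<n. (coef y k)^2) < \<epsilon>" using n1[of n] by (simp add: n_def dist_real_def)
  have tx: "\<forall>\<^sub>F h in F. (normH (x h))^2 - (\<Sum>k<n. (coef (x h) k)^2) \<le> \<epsilon>" by (rule n0) (simp add: n_def)
  have "((\<lambda>h. \<Sum>k<n. (coef (x h) k - coef y k)^2) \<longlongrightarrow> (\<Sum>k<n. (coef y k - coef y k)^2)) F"
    by (intro tendsto_intros c)
  then have "\<forall>\<^sub>F h in F. (\<Sum>k<n. (coef (x h) k - coef y k)^2) < \<epsilon>"
    using order_tendstoD(2)[of _ 0 F \<epsilon>] \<open>\<epsilon> > 0\<close> by simp
  with x tx show "\<forall>\<^sub>F h in F. dist (distH (x h) y) 0 < e"
  proof eventually_elim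
    case (elim h)
    have "(distH (x h) y)^2 < e^2"
    proof -
      have "D < E" if "D \<le> S + 2 * X + 2 * Y" "X \<le> \<epsilon>" "S < \<epsilon>" "Y < \<epsilon>" "E = 6 * \<epsilon>" for D S X Y E :: real
        using that \<open>\<epsilon> > 0\<close> by linarith
      from this[OF distH_sq_le[OF elim(1) y, of n] elim(2,3) ty] show ?thesis by (simp add: \<epsilon>_def)
    qed
    then show ?case using \<open>e > 0\<close> power2_less_imp_less[of "distH (x h) y" e] by simp
  qed
qed

lemma distH_tendsto_norm:
  assumes x: "\<forall>\<^sub>F h in F. inH (x h)" and y: "inH y"
    and c: "\<And>k. ((\<lambda>h. coef (x h) k) \<longlongrightarrow> coef y k) F"
    and n: "\<forall>\<^sub>F h in F. (normH (x h))^2 \<le> B h" and B: "(B \<longlongrightarrow> (normH y)^2) F"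
  shows "((\<lambda>h. distH (x h) y) \<longlongrightarrow> 0) F"
proof (rule distH_tendsto_coef[OF x y c])
  fix \<epsilon> :: real assume "\<epsilon> > 0"
  have "(\<lambda>n. \<Sum>k<n. (coef y k)^2) \<longlonglongrightarrow> (normH y)^2"
    using normH_sums[OF y] by (simp add: sums_def)
  then have "\<forall>\<^sub>F n in sequentially. (normH y)^2 - \<epsilon> < (\<Sum>k<n. (coef y k)^2)"
    using \<open>\<epsilon> > 0\<close> by (intro order_tendstoD(1)) auto
  then obtain n1 where n1: "\<And>n. n \<ge> n1 \<Longrightarrow> (normH y)^2 - \<epsilon> < (\<Sum>k<n. (coef y k)^2)"
    by (auto simp: eventually_sequentially)
  have "\<forall>\<^sub>F h in F. (normH (x h))^2 - (\<Sum>k<n. (coef (x h) k)^2) \<le> \<epsilon>" if "n \<ge> n1" for n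
  proof -
    have "((\<lambda>h. B h - (\<Sum>k<n. (coef (x h) k)^2)) \<longlongrightarrow> (normH y)^2 - (\<Sum>k<n. (coef y k)^2)) F"
      by (intro tendsto_intros c B)
    moreover have "(normH y)^2 - (\<Sum>k<n. (coef y k)^2) < \<epsilon>" using n1[OF that] by simp
    ultimately have "\<forall>\<^sub>F h in F. B h - (\<Sum>k<n. (coef (x h) k)^2) < \<epsilon>" by (rule order_tendstoD(2))
    with n show ?thesis by eventually_elim linarith
  qed
  then show "\<exists>n0. \<forall>n\<ge>n0. \<forall>\<^sub>F h in F. (normH (x h))^2 - (\<Sum>k<n. (coef (x h) k)^2) \<le> \<epsilon>" by blast
qed

section \<open>Solutions in coordinates\<close>

definition inclusion :: "real \<Rightarrow> (real \<Rightarrow> real \<times> real) \<Rightarrow> (real \<Rightarrow> real \<Rightarrow> real) \<Rightarrow> (real \<Rightarrow> real \<Rightarrow> real) \<Rightarrow> bool" where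
  "inclusion \<tau> \<sigma> u r \<longleftrightarrow> (AE t in lborel. t > \<tau> \<longrightarrow>
            (AE y in lebesgue. y \<in> {0..1} \<longrightarrow>
               (\<exists>h\<in>H0 (u t y). r t y = fst (\<sigma> t) * h + snd (\<sigma> t) * u t y)))"

definition mild :: "real \<Rightarrow> (real \<Rightarrow> real \<Rightarrow> real) \<Rightarrow> (real \<Rightarrow> real \<Rightarrow> real) \<Rightarrow> bool" where
  "mild \<tau> r u \<longleftrightarrow> forcing \<tau> r \<and> (\<forall>t\<ge>\<tau>. inH (u t)) \<and>
     (\<forall>k s t. \<tau> \<le> s \<longrightarrow> s \<le> t \<longrightarrow>
        ((\<lambda>x. coef (r x) k - lam k * coef (u x) k) has_integral (coef (u t) k - coef (u s) k)) {s..t})"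

lemma integral_le_spike:
  fixes f g :: "real \<Rightarrow> real"
  assumes f: "f integrable_on S" and g: "g integrable_on S" and N: "negligible N"
    and le: "\<And>x. x \<in> S - N \<Longrightarrow> f x \<le> g x"
  shows "integral S f \<le> integral S g"
proof -
  define f' where "f' x = (if x \<in> N then 0 else f x)" for x
  define g' where "g' x = (if x \<in> N then 0 else g x)" for x
  have "integral S f = integral S f'" by (rule integral_spike[OF N]) (simp add: f'_def)
  also have "\<dots> \<le> integral S g'"
  proof (rule integral_le)
    show "f' integrable_on S" by (rule integrable_spike[OF f N]) (simp add: f'_def)
    show "g' integrable_on S" by (rule integrable_spike[OF g N]) (simp add: g'_def)
    show "f' x \<le> g' x" if "x \<in> S" for x using le[of x] that by (auto simp: f'_def g'_def)
  qed
  also have "\<dots> = integral S g" by (rule integral_spike[OF N]) (simp add: g'_def)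
  finally show ?thesis .
qed

lemma partial_sum_le_sums:
  fixes f :: "nat \<Rightarrow> real"
  assumes "f sums l" "\<And>k. f k \<ge> 0"
  shows "(\<Sum>k<n. f k) \<le> l"
  using sum_le_suminf[OF sums_summable[OF assms(1)], of "{..<n}"] assms by (simp add: sums_iff)

lemma forcing_on:
  assumes r: "forcing \<tau> r" and ab: "\<tau> \<le> a" "a \<le> b"
  shows forcing_L2: "L2 (lebesgue_on {a..b}) (\<lambda>t. coef (r t) k)"
    and forcing_norm_integrable: "(\<lambda>t. (normH (r t))^2) integrable_on {a..b}"
    and forcing_sum_le: "(\<Sum>k<n. integral {a..b} (\<lambda>t. (coef (r t) k)^2)) \<le> integral {a..b} (\<lambda>t. (normH (r t))^2)"
proof -
  define T where "T = max b (\<tau> + 1)"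
  have T: "\<tau> < T" "b \<le> T" by (auto simp: T_def)
  note s = forcing_slices[OF r T(1)]
  show L: "L2 (lebesgue_on {a..b}) (\<lambda>t. coef (r t) k)" for k
    by (rule L2_on_subset[OF s(3)]) (use ab T in auto)
  show i: "(\<lambda>t. (normH (r t))^2) integrable_on {a..b}"
    by (rule integrable_subinterval_real[OF s(2)]) (use ab T in auto)
  obtain N where N: "negligible N" "\<And>t. t \<notin> N \<Longrightarrow> t \<in> {\<tau>..T} \<longrightarrow> inH (r t)"
    using AE_lborel_negligible[OF s(1)] by blast
  have "(\<Sum>k<n. integral {a..b} (\<lambda>t. (coef (r t) k)^2)) = integral {a..b} (\<lambda>t. \<Sum>k<n. (coef (r t) k)^2)"
    by (intro integral_sum[symmetric] L2_on_integrable(3)[OF L]) auto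
  also have "\<dots> \<le> integral {a..b} (\<lambda>t. (normH (r t))^2)"
  proof (rule integral_le_spike[OF _ i N(1)])
    show "(\<lambda>t. \<Sum>k<n. (coef (r t) k)^2) integrable_on {a..b}"
      by (intro integrable_sum L2_on_integrable(3)[OF L]) auto
    fix t assume "t \<in> {a..b} - N"
    then have "inH (r t)" using N(2)[of t] ab T by auto
    from normH_sums[OF this] show "(\<Sum>k<n. (coef (r t) k)^2) \<le> (normH (r t))^2"
      by (rule partial_sum_le_sums) auto
  qed
  finally show "(\<Sum>k<n. integral {a..b} (\<lambda>t. (coef (r t) k)^2)) \<le> integral {a..b} (\<lambda>t. (normH (r t))^2)" .
qed

lemma mildD:
  assumes "mild \<tau> r u"
  shows "forcing \<tau> r" "\<And>t. t \<ge> \<tau> \<Longrightarrow> inH (u t)"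
    "\<And>k s t. \<tau> \<le> s \<Longrightarrow> s \<le> t \<Longrightarrow>
        ((\<lambda>x. coef (r x) k - lam k * coef (u x) k) has_integral (coef (u t) k - coef (u s) k)) {s..t}"
  using assms unfolding mild_def by blast+

lemma mild_modes:
  assumes m: "mild \<tau> r u" and ab: "\<tau> \<le> a" "a \<le> b"
  shows mild_continuous_coef: "continuous_on {a..b} (\<lambda>t. coef (u t) k)"
    and mild_L2_rate: "L2 (lebesgue_on {a..b}) (\<lambda>x. coef (r x) k - lam k * coef (u x) k)"
    and mild_norm_le: "(normH (u b))^2 \<le> (normH (u a))^2 + integral {a..b} (\<lambda>t. (normH (r t))^2)"
    and mild_smoothing: "(b - a) * (\<Sum>k<n. lam k * (coef (u b) k)^2)
       \<le> (normH (u a))^2 + (1 + (b - a)) * integral {a..b} (\<lambda>t. (normH (r t))^2)"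
    and mild_regularity: "(\<Sum>k<n. integral {a..b} (\<lambda>t. (lam k)^2 * (coef (u t) k)^2))
       \<le> (\<Sum>k<n. lam k * (coef (u a) k)^2) + integral {a..b} (\<lambda>t. (normH (r t))^2)"
proof -
  note D = mildD[OF m]
  note f = forcing_on[OF D(1) ab]
  have ode: "((\<lambda>x. coef (r x) k - lam k * coef (u x) k) has_integral (coef (u t) k - coef (u s) k)) {s..t}"
    if "a \<le> s" "s \<le> t" "t \<le> b" for s t k using D(3)[of s t k] that ab by simp
  note P = mode_properties[OF f(1) lam_ge_1 ab(2) ode]
  show "continuous_on {a..b} (\<lambda>t. coef (u t) k)" by (rule P(1))
  show "L2 (lebesgue_on {a..b}) (\<lambda>x. coef (r x) k - lam k * coef (u x) k)" by (rule P(2))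
  have Ha: "inH (u a)" "inH (u b)" using D(2) ab by auto
  have na: "(\<Sum>k<n. (coef (u a) k)^2) \<le> (normH (u a))^2" for n
    by (rule partial_sum_le_sums[OF normH_sums[OF Ha(1)]]) auto
  have c: "continuous_on {a..b} (\<lambda>t. coef (u t) k)" for k by (rule P(1))
  have "(\<Sum>k<n. (coef (u b) k)^2) \<le> (normH (u a))^2 + integral {a..b} (\<lambda>t. (normH (r t))^2)" for n
  proof -
    have "(coef (u b) k)^2 \<le> (coef (u a) k)^2 + integral {a..b} (\<lambda>x. (coef (r x) k)^2)" for k
    proof -
      have "integral {a..b} (\<lambda>x. lam k * (coef (u x) k)^2) \<ge> 0"
        using lam_pos[of k] by (intro integral_nonneg integrable_continuous_interval continuous_intros c) (auto simp: less_imp_le)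
      then show ?thesis using P(4)[of k] by linarith
    qed
    then have "(\<Sum>k<n. (coef (u b) k)^2) \<le> (\<Sum>k<n. (coef (u a) k)^2 + integral {a..b} (\<lambda>x. (coef (r x) k)^2))"
      by (rule sum_mono)
    then show ?thesis using na[of n] f(3)[of n] by (simp add: sum.distrib)
  qed
  then show "(normH (u b))^2 \<le> (normH (u a))^2 + integral {a..b} (\<lambda>t. (normH (r t))^2)"
    using normH_sums[OF Ha(2)] unfolding sums_def by (intro LIMSEQ_le_const2) auto
  have "(\<Sum>k<n. (b - a) * (lam k * (coef (u b) k)^2)) \<le> (\<Sum>k<n. (coef (u a) k)^2 + (1 + (b - a)) * integral {a..b} (\<lambda>x. (coef (r x) k)^2))"
    by (intro sum_mono mode_smoothing[OF f(1) lam_ge_1 ab(2) ode])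
  also have "\<dots> = (\<Sum>k<n. (coef (u a) k)^2) + (1 + (b - a)) * (\<Sum>k<n. integral {a..b} (\<lambda>x. (coef (r x) k)^2))"
    unfolding sum.distrib sum_distrib_left ..
  also have "\<dots> \<le> (normH (u a))^2 + (1 + (b - a)) * integral {a..b} (\<lambda>t. (normH (r t))^2)"
    using ab by (intro add_mono na mult_left_mono f(3)) auto
  finally show "(b - a) * (\<Sum>k<n. lam k * (coef (u b) k)^2)
       \<le> (normH (u a))^2 + (1 + (b - a)) * integral {a..b} (\<lambda>t. (normH (r t))^2)"
    by (simp only: sum_distrib_left)
  have "(\<Sum>k<n. integral {a..b} (\<lambda>t. (lam k)^2 * (coef (u t) k)^2))
     \<le> (\<Sum>k<n. lam k * (coef (u a) k)^2 + integral {a..b} (\<lambda>x. (coef (r x) k)^2))"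
  proof (rule sum_mono)
    fix k
    have "lam k * (coef (u b) k)^2 \<ge> 0" using lam_pos[of k] by (simp add: less_imp_le)
    then show "integral {a..b} (\<lambda>t. (lam k)^2 * (coef (u t) k)^2) \<le> lam k * (coef (u a) k)^2 + integral {a..b} (\<lambda>x. (coef (r x) k)^2)"
      using P(3)[of k] by linarith
  qed
  then show "(\<Sum>k<n. integral {a..b} (\<lambda>t. (lam k)^2 * (coef (u t) k)^2))
       \<le> (\<Sum>k<n. lam k * (coef (u a) k)^2) + integral {a..b} (\<lambda>t. (normH (r t))^2)"
    using f(3)[of n] by (simp add: sum.distrib)
qed

lemma mild_rate_density:
  assumes m: "mild \<tau> r u" and ab: "\<tau> < a" "a \<le> b"
  obtains N G where "negligible N" "\<And>x. G x \<ge> 0" "G integrable_on {a..b}"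
    "\<And>t. t \<in> {a..b} - N \<Longrightarrow> (\<lambda>k. (coef (r t) k - lam k * coef (u t) k)^2) sums G t"
    "\<And>s e. a \<le> s \<Longrightarrow> s \<le> e \<Longrightarrow> e \<le> b \<Longrightarrow> (distH (u e) (u s))^2 \<le> (e - s) * integral {s..e} G"
proof -
  define d where "d k t = coef (r t) k - lam k * coef (u t) k" for k t
  define M where "M = integral {a..b} (\<lambda>t. (normH (r t))^2)"
  define S where "S = ((normH (u \<tau>))^2 + (1 + (a - \<tau>)) * integral {\<tau>..a} (\<lambda>t. (normH (r t))^2)) / (a - \<tau>)"
  have \<tau>a: "\<tau> \<le> a" using ab by simp
  note D = mildD[OF m]
  note f = forcing_on[OF D(1) \<tau>a ab(2)] and mm = mild_modes[OF m \<tau>a ab(2)]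
  have S: "(\<Sum>k<n. lam k * (coef (u a) k)^2) \<le> S" for n
    using mild_smoothing[OF m order.refl \<tau>a, of n] ab unfolding S_def by (simp add: field_simps)
  have Ld: "L2 (lebesgue_on {a..b}) (d k)" for k unfolding d_def by (rule mm(2))
  have di: "(\<lambda>t. (d k t)^2) integrable_on {a..b}" for k by (rule L2_on_integrable(3)[OF Ld])
  have bd: "(\<Sum>k<n. integral {a..b} (\<lambda>t. (d k t)^2)) \<le> 2 * M + 2 * (S + M)" for n
  proof -
    have "integral {a..b} (\<lambda>t. (d k t)^2) \<le> 2 * integral {a..b} (\<lambda>t. (coef (r t) k)^2) + 2 * integral {a..b} (\<lambda>t. (lam k)^2 * (coef (u t) k)^2)" for k
    proof -
      have i1: "((\<lambda>t. (coef (r t) k)^2) has_integral integral {a..b} (\<lambda>t. (coef (r t) k)^2)) {a..b}"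
        by (intro integrable_integral L2_on_integrable(3)[OF f(1)])
      have i2: "((\<lambda>t. (lam k)^2 * (coef (u t) k)^2) has_integral integral {a..b} (\<lambda>t. (lam k)^2 * (coef (u t) k)^2)) {a..b}"
        by (intro integrable_integral integrable_continuous_interval continuous_intros mm(1))
      show ?thesis
      proof (rule has_integral_le[OF integrable_integral[OF di] has_integral_add[OF has_integral_mult_right[OF i1] has_integral_mult_right[OF i2]]])
        fix t
        have "0 \<le> (coef (r t) k + lam k * coef (u t) k)^2" by simp
        then show "(d k t)^2 \<le> 2 * (coef (r t) k)^2 + 2 * ((lam k)^2 * (coef (u t) k)^2)"
          by (simp add: d_def power2_eq_square algebra_simps)
      qed
    qed
    then have "(\<Sum>k<n. integral {a..b} (\<lambda>t. (d k t)^2))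
      \<le> (\<Sum>k<n. 2 * integral {a..b} (\<lambda>t. (coef (r t) k)^2) + 2 * integral {a..b} (\<lambda>t. (lam k)^2 * (coef (u t) k)^2))"
      by (rule sum_mono)
    also have "\<dots> = 2 * (\<Sum>k<n. integral {a..b} (\<lambda>t. (coef (r t) k)^2)) + 2 * (\<Sum>k<n. integral {a..b} (\<lambda>t. (lam k)^2 * (coef (u t) k)^2))"
      unfolding sum.distrib sum_distrib_left ..
    also have "\<dots> \<le> 2 * M + 2 * (S + M)"
      using f(3)[of n] mm(5)[of n] S[of n] unfolding M_def by (intro add_mono mult_left_mono) auto
    finally show ?thesis .
  qed
  obtain N G where G: "negligible N" "\<And>x. G x \<ge> 0" "G integrable_on {a..b}"
    "\<And>x. x \<in> {a..b} - N \<Longrightarrow> (\<lambda>k. (d k x)^2) sums G x"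
    "\<And>n s e. a \<le> s \<Longrightarrow> e \<le> b \<Longrightarrow> (\<Sum>k<n. integral {s..e} (\<lambda>x. (d k x)^2)) \<le> integral {s..e} G"
    using nonneg_series_integral[of "\<lambda>k x. (d k x)^2", OF di _ bd] by auto
  show ?thesis
  proof (rule that[OF G(1,2,3)])
    show "(\<lambda>k. (coef (r t) k - lam k * coef (u t) k)^2) sums G t" if "t \<in> {a..b} - N" for t
      using G(4)[OF that] by (simp add: d_def)
    fix s e assume se: "a \<le> s" "s \<le> e" "e \<le> b"
    have H: "inH (u e)" "inH (u s)" using D(2) se ab by auto
    have "(\<Sum>k<n. (coef (u e) k - coef (u s) k)^2) \<le> (e - s) * integral {s..e} G" for n
    proof -
      have "(coef (u e) k - coef (u s) k)^2 \<le> (e - s) * integral {s..e} (\<lambda>x. (d k x)^2)" for k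
      proof -
        have "coef (u e) k - coef (u s) k = integral {s..e} (d k)"
          using D(3)[of s e k] se ab by (simp add: integral_unique d_def[abs_def])
        then show ?thesis using L2_on_integral_sq_le[OF L2_on_subset[OF Ld se(1,3)] se(2)] by simp
      qed
      then have "(\<Sum>k<n. (coef (u e) k - coef (u s) k)^2) \<le> (\<Sum>k<n. (e - s) * integral {s..e} (\<lambda>x. (d k x)^2))"
        by (rule sum_mono)
      also have "\<dots> = (e - s) * (\<Sum>k<n. integral {s..e} (\<lambda>x. (d k x)^2))" by (simp add: sum_distrib_left)
      also have "\<dots> \<le> (e - s) * integral {s..e} G" using G(5)[OF se(1,3)] se by (intro mult_left_mono) auto
      finally show ?thesis .
    qed
    then show "(distH (u e) (u s))^2 \<le> (e - s) * integral {s..e} G"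
      using distH_sums[OF H] unfolding sums_def by (intro LIMSEQ_le_const2) auto
  qed
qed

lemma mild_abs_cont:
  assumes m: "mild \<tau> r u" and ab: "\<tau> < a" "a < b"
  shows "abs_cont_H u a b"
proof -
  obtain N G where G: "\<And>x. G x \<ge> 0" "G integrable_on {a..b}"
    "\<And>s e. a \<le> s \<Longrightarrow> s \<le> e \<Longrightarrow> e \<le> b \<Longrightarrow> (distH (u e) (u s))^2 \<le> (e - s) * integral {s..e} G"
    using mild_rate_density[OF m ab(1) less_imp_le[OF ab(2)]] by metis
  have "ac (\<lambda>s e. distH (u e) (u s)) a b" by (rule ac_sqrt_integral[OF G(2,1,3)])
  then show ?thesis unfolding ac_def abs_cont_H_def intervals_def by simp
qed

lemma distH_commute: "distH f g = distH g f"
  unfolding distH_eq by (rule nrm_minus_commute)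

lemma mild_continuous:
  assumes m: "mild \<tau> r u" and t: "t \<ge> \<tau>"
  shows "((\<lambda>s. distH (u s) (u t)) \<longlongrightarrow> 0) (at t within {\<tau>..})"
proof (cases "t = \<tau>")
  case True
  note D = mildD[OF m]
  have \<tau>1: "\<tau> \<le> \<tau> + 1" by simp
  have F: "at \<tau> within {\<tau>..} = at \<tau> within {\<tau>..\<tau>+1}"
    by (rule at_within_nhd[of _ "{..<\<tau>+1}"]) auto
  have ev: "\<forall>\<^sub>F s in at \<tau> within {\<tau>..\<tau>+1}. s \<in> {\<tau>..\<tau>+1}" by (auto simp: eventually_at_filter)
  have "((\<lambda>s. distH (u s) (u \<tau>)) \<longlongrightarrow> 0) (at \<tau> within {\<tau>..\<tau>+1})"
  proof (rule distH_tendsto_norm)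
    show "\<forall>\<^sub>F s in at \<tau> within {\<tau>..\<tau>+1}. inH (u s)" using ev by eventually_elim (use D(2) in auto)
    show "inH (u \<tau>)" using D(2) by simp
    show "((\<lambda>s. coef (u s) k) \<longlongrightarrow> coef (u \<tau>) k) (at \<tau> within {\<tau>..\<tau>+1})" for k
      using mild_continuous_coef[OF m order.refl \<tau>1, of k] by (auto simp: continuous_on)
    define B where "B s = (normH (u \<tau>))^2 + integral {\<tau>..s} (\<lambda>t. (normH (r t))^2)" for s
    show "\<forall>\<^sub>F s in at \<tau> within {\<tau>..\<tau>+1}. (normH (u s))^2 \<le> B s"
      using ev by eventually_elim (use mild_norm_le[OF m order.refl] in \<open>auto simp: B_def\<close>)
    have "continuous_on {\<tau>..\<tau>+1} (\<lambda>s. integral {\<tau>..s} (\<lambda>t. (normH (r t))^2))"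
      by (rule indefinite_integral_continuous_1) (rule forcing_norm_integrable[OF D(1) order.refl \<tau>1])
    then have "((\<lambda>s. integral {\<tau>..s} (\<lambda>t. (normH (r t))^2)) \<longlongrightarrow> integral {\<tau>..\<tau>} (\<lambda>t. (normH (r t))^2)) (at \<tau> within {\<tau>..\<tau>+1})"
      unfolding continuous_on by (rule bspec) simp
    then have "((\<lambda>s. (normH (u \<tau>))^2 + integral {\<tau>..s} (\<lambda>t. (normH (r t))^2)) \<longlongrightarrow> (normH (u \<tau>))^2 + 0) (at \<tau> within {\<tau>..\<tau>+1})"
      by (intro tendsto_intros) simp
    then show "(B \<longlongrightarrow> (normH (u \<tau>))^2) (at \<tau> within {\<tau>..\<tau>+1})" by (simp add: B_def[abs_def])
  qed
  then show ?thesis using True F by simp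
next
  case False
  then have t': "\<tau> < t" using t by simp
  define a b where "a = (\<tau> + t) / 2" and "b = t + 1"
  have ab: "\<tau> < a" "a \<le> b" "a < t" "t < b" using t' by (auto simp: a_def b_def)
  obtain N G where G: "\<And>x. G x \<ge> 0" "G integrable_on {a..b}"
    "\<And>s e. a \<le> s \<Longrightarrow> s \<le> e \<Longrightarrow> e \<le> b \<Longrightarrow> (distH (u e) (u s))^2 \<le> (e - s) * integral {s..e} G"
    using mild_rate_density[OF m ab(1,2)] by metis
  define C where "C = integral {a..b} G"
  have le: "(distH (u e) (u s))^2 \<le> \<bar>e - s\<bar> * C" if "a \<le> s" "s \<le> e" "e \<le> b" for s e
  proof -
    have "integral {s..e} G \<le> C" unfolding C_def
      by (rule integral_subset_le) (use that G in \<open>auto intro: integrable_subinterval_real\<close>)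
    then have "(e - s) * integral {s..e} G \<le> \<bar>e - s\<bar> * C" using that by (intro mult_mono) (auto simp: C_def intro!: integral_nonneg G integrable_subinterval_real[OF G(2)])
    then show ?thesis using G(3)[OF that] by linarith
  qed
  have bd: "distH (u s) (u t) \<le> sqrt (\<bar>s - t\<bar> * C)" if "s \<in> {a<..<b}" for s
  proof (rule real_le_rsqrt)
    show "(distH (u s) (u t))^2 \<le> \<bar>s - t\<bar> * C"
      using le[of s t] le[of t s] that ab by (cases "s \<le> t") (auto simp: distH_commute abs_minus_commute)
  qed
  have "((\<lambda>s. distH (u s) (u t)) \<longlongrightarrow> 0) (at t)"
  proof (rule Lim_null_comparison)
    have "\<forall>\<^sub>F s in at t. s \<in> {a<..<b}" using ab by (intro eventually_at_in_open') auto
    then show "\<forall>\<^sub>F s in at t. norm (distH (u s) (u t)) \<le> sqrt (\<bar>s - t\<bar> * C)"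
      by eventually_elim (use bd in simp)
    have "((\<lambda>s. sqrt (\<bar>s - t\<bar> * C)) \<longlongrightarrow> sqrt (\<bar>t - t\<bar> * C)) (at t)" by (intro tendsto_intros)
    then show "((\<lambda>s. sqrt (\<bar>s - t\<bar> * C)) \<longlongrightarrow> 0) (at t)" by simp
  qed
  then show ?thesis by (rule tendsto_within_subset) simp
qed

lemma mild_derivative_on:
  assumes m: "mild \<tau> r u" and ab: "\<tau> < a" "a < b"
  obtains E where "negligible E" "\<And>t. t \<in> {a<..<b} - E \<Longrightarrow>
     \<exists>d v. has_H_derivative u d t \<and> opA (u t) v \<and> eqH (\<lambda>y. d y + v y) (r t)"
proof -
  note D = mildD[OF m]
  have \<tau>a: "\<tau> \<le> a" "a \<le> b" using ab by auto
  obtain N G where G: "negligible N" "\<And>x. G x \<ge> 0" "G integrable_on {a..b}"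
    "\<And>t. t \<in> {a..b} - N \<Longrightarrow> (\<lambda>k. (coef (r t) k - lam k * coef (u t) k)^2) sums G t"
    "\<And>s e. a \<le> s \<Longrightarrow> s \<le> e \<Longrightarrow> e \<le> b \<Longrightarrow> (distH (u e) (u s))^2 \<le> (e - s) * integral {s..e} G"
    by (rule mild_rate_density[OF m ab(1) \<tau>a(2)]) (rule that)
  define d where "d k t = coef (r t) k - lam k * coef (u t) k" for k t
  have di: "d k integrable_on {a..b}" for k
    unfolding d_def by (rule L2_on_integrable(2)[OF mild_L2_rate[OF m \<tau>a]])
  obtain N1 where N1: "negligible N1" "\<And>t. t \<in> {a<..<b} - N1 \<Longrightarrow> ((\<lambda>x. integral {a..x} G) has_real_derivative G t) (at t)"
    using integral_has_derivative_AE[OF G(3)] by blast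
  have "\<exists>N. negligible N \<and> (\<forall>t\<in>{a<..<b} - N. ((\<lambda>x. integral {a..x} (d k)) has_real_derivative d k t) (at t))" for k
    using integral_has_derivative_AE[OF di[of k]] by metis
  then obtain Nk where Nk: "\<And>k. negligible (Nk k)"
    "\<And>k t. t \<in> {a<..<b} - Nk k \<Longrightarrow> ((\<lambda>x. integral {a..x} (d k)) has_real_derivative d k t) (at t)" by metis
  have "\<tau> < b" using ab by simp
  obtain N2 where N2: "negligible N2" "\<And>t. t \<notin> N2 \<Longrightarrow> t \<in> {\<tau>..b} \<longrightarrow> inH (r t)"
    using AE_lborel_negligible[OF forcing_slices(1)[OF D(1) \<open>\<tau> < b\<close>]] by blast
  define E where "E = N \<union> N1 \<union> N2 \<union> (\<Union>k. Nk k)"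
  show ?thesis
  proof (rule that[of E])
    show "negligible E" unfolding E_def by (intro negligible_Un G(1) N1(1) N2(1) negligible_Union_nat Nk(1))
    fix t assume tE: "t \<in> {a<..<b} - E"
    then have t: "a < t" "t < b" "t \<notin> N" "t \<notin> N1" "t \<notin> N2" "\<And>k. t \<notin> Nk k" by (auto simp: E_def)
    have Hu: "inH (u t)" using D(2) t ab by auto
    have Hr: "inH (r t)" using N2(2)[OF t(5)] t ab by auto
    have dG: "(\<lambda>k. (d k t)^2) sums G t" using G(4)[of t] t by (simp add: d_def)
    obtain d0 where d0: "inH d0" "\<And>k. coef d0 k = d k t"
      using inH_of_coef[OF sums_summable[OF dG]] by blast
    define v where "v y = r t y - d0 y" for y
    have Hv: "inH v" unfolding v_def[abs_def] by (rule inH_diff[OF Hr d0(1)])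
    have "opA (u t) v" unfolding opA_iff
      using Hu Hv Hr d0 by (auto simp: v_def[abs_def] coef_diff inH_iff d_def)
    moreover have "eqH (\<lambda>y. d0 y + v y) (r t)" by (simp add: v_def eqH_iff)
    moreover have "has_H_derivative u d0 t"
      unfolding has_H_derivative_def
    proof (intro conjI d0(1) distH_tendsto_norm)
      have ev: "\<forall>\<^sub>F h in at 0. t + h \<in> {a..b} \<and> h \<noteq> 0"
      proof -
        have "\<forall>\<^sub>F h in at 0. h \<in> {a - t<..<b - t}" using t by (intro eventually_at_in_open') auto
        moreover have "\<forall>\<^sub>F h in at (0::real). h \<noteq> 0" by (auto simp: eventually_at_filter)
        ultimately show ?thesis by eventually_elim auto
      qed
      have q: "inH (\<lambda>x. (u (t + h) x - u t x) / h)" "normH (\<lambda>x. (u (t + h) x - u t x) / h) = distH (u (t + h)) (u t) / \<bar>h\<bar>"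
        "coef (\<lambda>x. (u (t + h) x - u t x) / h) k = (coef (u (t + h)) k - coef (u t) k) / h" if "t + h \<in> {a..b}" for h k
      proof -
        have H: "inH (u (t + h))" using D(2) that ab by auto
        have e: "(\<lambda>x. (u (t + h) x - u t x) / h) = (\<lambda>x. (1/h) * (u (t + h) x - u t x))" by simp
        show "inH (\<lambda>x. (u (t + h) x - u t x) / h)" unfolding e
          using inH_diff[OF H Hu] by (simp only: inH_iff L2_cmult)
        show "coef (\<lambda>x. (u (t + h) x - u t x) / h) k = (coef (u (t + h)) k - coef (u t) k) / h"
          unfolding e coef_cmult using H Hu by (simp add: coef_diff inH_iff)
        show "normH (\<lambda>x. (u (t + h) x - u t x) / h) = distH (u (t + h)) (u t) / \<bar>h\<bar>"
          unfolding distH_eq normH_eq nrm_def by (simp add: power_divide real_sqrt_divide)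
      qed
      show "\<forall>\<^sub>F h in at 0. inH (\<lambda>x. (u (t + h) x - u t x) / h)" using ev by eventually_elim (use q in auto)
      show "((\<lambda>h. coef (\<lambda>x. (u (t + h) x - u t x) / h) k) \<longlongrightarrow> coef d0 k) (at 0)" for k
      proof -
        have "((\<lambda>h. (integral {a..t + h} (d k) - integral {a..t} (d k)) / h) \<longlongrightarrow> d k t) (at 0)"
          using Nk(2)[of t k] t by (simp add: DERIV_def)
        moreover have "\<forall>\<^sub>F h in at 0. (integral {a..t + h} (d k) - integral {a..t} (d k)) / h = coef (\<lambda>x. (u (t + h) x - u t x) / h) k"
          using ev
        proof eventually_elim
          case (elim h)
          have "coef (u x) k - coef (u a) k = integral {a..x} (d k)" if "x \<in> {a..b}" for x
            using D(3)[of a x k] ab that by (simp add: integral_unique d_def[abs_def])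
          from this[of "t + h"] this[of t] show ?case using elim t q(3)[of h k] by simp
        qed
        ultimately show ?thesis unfolding d0(2) by (rule Lim_transform_eventually)
      qed
      define B where "B h = (integral {a..t + h} G - integral {a..t} G) / h" for h
      have "(B \<longlongrightarrow> G t) (at 0)" using N1(2)[of t] t by (simp add: DERIV_def B_def[abs_def])
      moreover have "(normH d0)^2 = G t"
        using sums_unique2[OF normH_sums[OF d0(1)]] dG by (simp add: d0(2))
      ultimately show "(B \<longlongrightarrow> (normH d0)^2) (at 0)" by simp
      show "\<forall>\<^sub>F h in at 0. (normH (\<lambda>x. (u (t + h) x - u t x) / h))^2 \<le> B h"
        using ev
      proof eventually_elim
        case (elim h)
        have Gi: "G integrable_on {x..y}" if "a \<le> x" "y \<le> b" for x y
          by (rule integrable_subinterval_real[OF G(3)]) (use that in auto)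
        have "(distH (u (t + h)) (u t))^2 \<le> h * (integral {a..t + h} G - integral {a..t} G)"
        proof (cases "h > 0")
          case True
          have "integral {a..t} G + integral {t..t + h} G = integral {a..t + h} G"
            by (rule Henstock_Kurzweil_Integration.integral_combine) (use True t elim Gi in auto)
          then have "integral {a..t + h} G - integral {a..t} G = integral {t..t + h} G" by linarith
          then show ?thesis using G(5)[of t "t + h"] True t elim by simp
        next
          case False
          have "integral {a..t + h} G + integral {t + h..t} G = integral {a..t} G"
            by (rule Henstock_Kurzweil_Integration.integral_combine) (use False t elim Gi in auto)
          then have "integral {a..t + h} G - integral {a..t} G = - integral {t + h..t} G" by linarith
          then have "h * (integral {a..t + h} G - integral {a..t} G) = (t - (t + h)) * integral {t + h..t} G"
            by simp
          then show ?thesis using G(5)[of "t + h" t] False t elim by (simp add: distH_commute)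
        qed
        then have "(distH (u (t + h)) (u t))^2 / h^2 \<le> h * (integral {a..t + h} G - integral {a..t} G) / h^2"
          by (rule divide_right_mono) simp
        also have "\<dots> = B h" using elim by (simp add: B_def power2_eq_square)
        finally show ?case using q(2)[of h] elim by (simp add: power_divide)
      qed
    qed
    ultimately show "\<exists>d v. has_H_derivative u d t \<and> opA (u t) v \<and> eqH (\<lambda>y. d y + v y) (r t)" by blast
  qed
qed

lemma mild_derivative:
  assumes m: "mild \<tau> r u"
  shows "AE t in lborel. t > \<tau> \<longrightarrow> (\<exists>d v. has_H_derivative u d t \<and> opA (u t) v \<and> eqH (\<lambda>y. d y + v y) (r t))"
proof -
  define P where "P t \<longleftrightarrow> (\<exists>d v. has_H_derivative u d t \<and> opA (u t) v \<and> eqH (\<lambda>y. d y + v y) (r t))" for t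
  have "\<exists>E. negligible E \<and> (\<forall>t\<in>{\<tau> + inverse (real (Suc n))<..<\<tau> + 2 + real n} - E. P t)" for n
  proof -
    have "inverse (real (Suc n)) \<le> 1" by (simp add: inverse_le_1_iff)
    then have "\<tau> + inverse (real (Suc n)) < \<tau> + 2 + real n" by linarith
    moreover have "\<tau> < \<tau> + inverse (real (Suc n))" by simp
    ultimately show ?thesis using mild_derivative_on[OF m, of "\<tau> + inverse (real (Suc n))" "\<tau> + 2 + real n"] unfolding P_def by metis
  qed
  then obtain E where E: "\<And>n. negligible (E n)"
    "\<And>n t. t \<in> {\<tau> + inverse (real (Suc n))<..<\<tau> + 2 + real n} - E n \<Longrightarrow> P t" by metis
  have "AE t in lborel. t > \<tau> \<longrightarrow> P t"
  proof (rule negligible_AE_lborel)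
    show "negligible (\<Union>n. E n)" by (intro negligible_Union_nat E(1))
    fix t assume t: "t \<notin> (\<Union>n. E n)"
    show "t > \<tau> \<longrightarrow> P t"
    proof
      assume "t > \<tau>"
      then obtain n1 where n1: "inverse (real (Suc n1)) < t - \<tau>" using reals_Archimedean[of "t - \<tau>"] by auto
      obtain n2 :: nat where n2: "t - \<tau> < real n2" using reals_Archimedean2 by blast
      define n where "n = max n1 n2"
      have "inverse (real (Suc n)) \<le> inverse (real (Suc n1))" by (rule le_imp_inverse_le) (auto simp: n_def)
      moreover have "real n2 \<le> real n" by (simp add: n_def)
      ultimately have "\<tau> + inverse (real (Suc n)) < t" "t < \<tau> + 2 + real n" using n1 n2 by linarith+
      then show "P t" using t by (intro E(2)[of t n]) (simp del: of_nat_Suc)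
    qed
  qed
  then show ?thesis unfolding P_def .
qed

lemma distH_coef_le:
  assumes "inH f" "inH g" shows "\<bar>coef f k - coef g k\<bar> \<le> distH f g"
  using coef_bound[OF L2_diff[of I01 f g], of k] assms by (simp add: coef_diff inH_iff distH_eq)

lemma strong_imp_mild:
  assumes H: "\<And>t. t \<ge> \<tau> \<Longrightarrow> inH (u t)"
    and c: "\<And>t. t \<ge> \<tau> \<Longrightarrow> ((\<lambda>s. distH (u s) (u t)) \<longlongrightarrow> 0) (at t within {\<tau>..})"
    and ac: "\<And>T1 T2. \<tau> < T1 \<Longrightarrow> T1 < T2 \<Longrightarrow> abs_cont_H u T1 T2"
    and r: "forcing \<tau> r"
    and der: "AE t in lborel. t > \<tau> \<longrightarrow> (\<exists>d v. has_H_derivative u d t \<and> opA (u t) v \<and> eqH (\<lambda>y. d y + v y) (r t))"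
  shows "mild \<tau> r u"
  unfolding mild_def
proof (intro conjI allI impI r H)
  fix k s t assume st: "\<tau> \<le> s" "s \<le> t"
  define U where "U t = coef (u t) k" for t
  define w where "w x = coef (r x) k - lam k * coef (u x) k" for x
  have cU: "continuous_on {\<tau>..} U"
    unfolding continuous_on
  proof
    fix x assume x: "x \<in> {\<tau>..}"
    have ev: "\<forall>\<^sub>F s in at x within {\<tau>..}. s \<in> {\<tau>..}" by (auto simp: eventually_at_filter)
    have "((\<lambda>s. U s - U x) \<longlongrightarrow> 0) (at x within {\<tau>..})"
    proof (rule Lim_null_comparison[OF _ c])
      show "\<forall>\<^sub>F s in at x within {\<tau>..}. norm (U s - U x) \<le> distH (u s) (u x)"
        using ev by eventually_elim (use x H in \<open>auto simp: U_def intro!: distH_coef_le\<close>)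
    qed (use x in simp)
    then show "(U \<longlongrightarrow> U x) (at x within {\<tau>..})" by (simp add: LIM_zero_iff)
  qed
  have Lw: "L2 (lebesgue_on {\<tau>..T}) w" if "\<tau> \<le> T" for T
    unfolding w_def U_def[symmetric]
    by (intro L2_diff L2_cmult forcing_L2[OF r] L2_on_continuous continuous_on_subset[OF cU]) (use that in auto)
  have pos: "(w has_integral (U b - U a)) {a..b}" if ab: "\<tau> < a" "a < b" for a b
  proof -
    have "\<tau> < b" using ab by simp
    obtain N1 where N1: "negligible N1" "\<And>t. t \<notin> N1 \<Longrightarrow> t > \<tau> \<longrightarrow> (\<exists>d v. has_H_derivative u d t \<and> opA (u t) v \<and> eqH (\<lambda>y. d y + v y) (r t))"
      using AE_lborel_negligible[OF der] by blast
    obtain N2 where N2: "negligible N2" "\<And>t. t \<notin> N2 \<Longrightarrow> t \<in> {\<tau>..b} \<longrightarrow> inH (r t)"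
      using AE_lborel_negligible[OF forcing_slices(1)[OF r \<open>\<tau> < b\<close>]] by blast
    show ?thesis
  proof (rule ac_has_integral_derivative)
    have "ac (\<lambda>s e. distH (u e) (u s)) a b"
      using ac[OF ab] unfolding ac_def abs_cont_H_def intervals_def by simp
    then show "ac (\<lambda>s e. \<bar>U e - U s\<bar>) a b"
    proof (rule ac_dominated[of _ _ _ 1])
      fix s e assume se: "a \<le> s" "s \<le> e" "e \<le> b"
      have "\<bar>U e - U s\<bar> \<le> distH (u e) (u s)" unfolding U_def using se ab by (intro distH_coef_le H) auto
      then show "\<bar>U e - U s\<bar> \<le> 1 * (distH (u e) (u s) + (e - s))" using se by simp
    qed simp
    show "negligible (N1 \<union> N2)" by (intro negligible_Un N1(1) N2(1))
    fix x assume x: "x \<in> {a..b} - (N1 \<union> N2)"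
    then have x\<tau>: "\<tau> < x" using ab by auto
    obtain d v where dv: "has_H_derivative u d x" "opA (u x) v" "eqH (\<lambda>y. d y + v y) (r x)"
      using N1(2)[of x] x x\<tau> by auto
    have Hr: "inH (r x)" using N2(2)[of x] x ab by auto
    have Hd: "inH d" using dv(1) by (simp add: has_H_derivative_def)
    have Hv: "inH v" "coef v k = lam k * coef (u x) k" using dv(2) by (simp_all add: opA_iff)
    have Hx: "inH (u x)" using H x\<tau> by simp
    have "coef (r x) k = coef (\<lambda>y. d y + v y) k"
      using dv(3) Hr Hd Hv(1) eqH_iff_coef[of "\<lambda>y. d y + v y" "r x"] by (simp add: inH_iff L2_add)
    then have dk: "coef d k = w x" using Hd Hv by (simp add: w_def coef_add inH_iff)
    have "((\<lambda>h. (U (x + h) - U x) / h - coef d k) \<longlongrightarrow> 0) (at 0)"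
    proof (rule Lim_null_comparison)
      show "((\<lambda>h. distH (\<lambda>y. (u (x + h) y - u x y) / h) d) \<longlongrightarrow> 0) (at 0)"
        using dv(1) by (simp add: has_H_derivative_def)
      have "\<forall>\<^sub>F h in at 0. h \<in> {\<tau> - x<..}" using x\<tau> by (intro eventually_at_in_open') auto
      then show "\<forall>\<^sub>F h in at 0. norm ((U (x + h) - U x) / h - coef d k) \<le> distH (\<lambda>y. (u (x + h) y - u x y) / h) d"
      proof eventually_elim
        case (elim h)
        have Hh: "inH (u (x + h))" using elim by (intro H) auto
        have e: "(\<lambda>y. (u (x + h) y - u x y) / h) = (\<lambda>y. (1/h) * (u (x + h) y - u x y))" by simp
        have "coef (\<lambda>y. (u (x + h) y - u x y) / h) k = (U (x + h) - U x) / h"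
          unfolding e coef_cmult U_def using Hh Hx by (simp add: coef_diff inH_iff)
        moreover have "inH (\<lambda>y. (u (x + h) y - u x y) / h)" unfolding e
          using inH_diff[OF Hh Hx] by (simp only: inH_iff L2_cmult)
        ultimately show ?case using distH_coef_le[OF _ Hd, of "\<lambda>y. (u (x + h) y - u x y) / h" k] by simp
      qed
    qed
    then have "((\<lambda>h. (U (x + h) - U x) / h) \<longlongrightarrow> w x) (at 0)" by (simp add: LIM_zero_iff dk)
    then show "(U has_real_derivative w x) (at x within {a..b})"
      using has_field_derivative_at_within by (auto simp: DERIV_def)
  qed (use ab in simp)
  qed
  have fin: "(w has_integral (U t - U s)) {s..t}" if "s < t"
  proof (cases "s = \<tau>")
    case True
    define I where "I x = integral {s..x} w" for x
    have wi: "w integrable_on {s..t}" using L2_on_integrable(2)[OF Lw[of t]] True st by simp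
    have cI: "continuous_on {s..t} I" unfolding I_def by (rule indefinite_integral_continuous_1[OF wi])
    have F: "at s within {s..t} \<noteq> bot" using that by (simp add: trivial_limit_within islimpt_Icc)
    have lI: "((\<lambda>x. I t - I x) \<longlongrightarrow> I t - I s) (at s within {s..t})"
      using cI that by (intro tendsto_intros) (auto simp: continuous_on)
    have "((\<lambda>x. U t - U x) \<longlongrightarrow> U t - U s) (at s within {s..t})"
      using continuous_on_subset[OF cU, of "{s..t}"] that True by (intro tendsto_intros) (auto simp: continuous_on)
    moreover have "\<forall>\<^sub>F x in at s within {s..t}. U t - U x = I t - I x"
    proof -
      have "\<forall>\<^sub>F x in at s within {s..t}. x \<in> {s..t} \<and> x \<noteq> s \<and> x < t"
        using that by (auto simp: eventually_at_filter order_tendstoD(2)[OF tendsto_ident_at] eventually_conj_iff intro: eventually_mono[OF eventually_nhds_in_open[of "{..<t}" s]])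
      then show ?thesis
      proof eventually_elim
        case (elim x)
        have "I x + integral {x..t} w = I t" unfolding I_def
          by (rule Henstock_Kurzweil_Integration.integral_combine) (use elim wi in auto)
        moreover have "integral {x..t} w = U t - U x" using pos[of x t] elim True by (auto intro: integral_unique)
        ultimately show ?case by simp
      qed
    qed
    ultimately have "((\<lambda>x. I t - I x) \<longlongrightarrow> U t - U s) (at s within {s..t})"
      by (rule Lim_transform_eventually)
    then have "I t - I s = U t - U s" by (rule tendsto_unique[OF F lI])
    then have "integral {s..t} w = U t - U s" by (simp add: I_def)
    then show ?thesis using wi by (simp add: has_integral_iff)
  qed (use pos st that in auto)
  show "((\<lambda>x. coef (r x) k - lam k * coef (u x) k) has_integral (coef (u t) k - coef (u s) k)) {s..t}"
    using fin st unfolding w_def U_def by (cases "s = t") auto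
qed

theorem solution_iff:
  "solution \<tau> \<sigma> x u \<longleftrightarrow> inH x \<and> eqH (u \<tau>) x \<and> (\<exists>r. mild \<tau> r u \<and> inclusion \<tau> \<sigma> u r)"
proof
  assume s: "solution \<tau> \<sigma> x u"
  then obtain r where "forcing \<tau> r" "inclusion \<tau> \<sigma> u r"
    "AE t in lborel. t > \<tau> \<longrightarrow> (\<exists>d v. has_H_derivative u d t \<and> opA (u t) v \<and> eqH (\<lambda>y. d y + v y) (r t))"
    unfolding solution_def forcing_def inclusion_def by blast
  moreover from this s have "mild \<tau> r u"
    by (intro strong_imp_mild) (auto simp: solution_def)
  ultimately show "inH x \<and> eqH (u \<tau>) x \<and> (\<exists>r. mild \<tau> r u \<and> inclusion \<tau> \<sigma> u r)"
    using s by (auto simp: solution_def)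
next
  assume "inH x \<and> eqH (u \<tau>) x \<and> (\<exists>r. mild \<tau> r u \<and> inclusion \<tau> \<sigma> u r)"
  then obtain r where x: "inH x" "eqH (u \<tau>) x" and m: "mild \<tau> r u" and i: "inclusion \<tau> \<sigma> u r" by blast
  note D = mildD[OF m]
  show "solution \<tau> \<sigma> x u"
    unfolding solution_def
    using x D(2) mild_continuous[OF m] mild_abs_cont[OF m] D(1)[unfolded forcing_def] i[unfolded inclusion_def] mild_derivative[OF m]
    by blast
qed

section \<open>Restriction, translation and concatenation of trajectories\<close>

definition traj :: "real \<Rightarrow> (real \<Rightarrow> real \<times> real) \<Rightarrow> (real \<Rightarrow> real \<Rightarrow> real) \<Rightarrow> bool" where
  "traj \<tau> \<sigma> u \<longleftrightarrow> (\<exists>r. mild \<tau> r u \<and> inclusion \<tau> \<sigma> u r)"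

lemma solution_iff_traj: "solution \<tau> \<sigma> x u \<longleftrightarrow> inH x \<and> eqH (u \<tau>) x \<and> traj \<tau> \<sigma> u"
  by (simp add: solution_iff traj_def)

lemma set_borel_measurable_mono:
  assumes "set_borel_measurable M A f" "B \<in> sets M" "B \<subseteq> A"
  shows "set_borel_measurable M B (f :: _ \<Rightarrow> real)"
proof -
  have "(\<lambda>x. indicator B x *\<^sub>R (indicator A x *\<^sub>R f x)) \<in> borel_measurable M"
    using assms(1) unfolding set_borel_measurable_def
    by (rule borel_measurable_scaleR[OF borel_measurable_indicator[OF assms(2)]])
  moreover have "(\<lambda>x. indicator B x *\<^sub>R (indicator A x *\<^sub>R f x)) = (\<lambda>x. indicator B x *\<^sub>R f x)"
    using assms(3) by (auto simp: indicator_def fun_eq_iff)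
  ultimately show ?thesis unfolding set_borel_measurable_def by simp
qed

lemma forcing_restrict:
  assumes "forcing \<tau> r" "\<tau> \<le> s" shows "forcing s r"
  unfolding forcing_def
proof (intro allI impI)
  fix T assume "s < T"
  then have "\<tau> < T" and sub: "{s..T} \<times> {0..1::real} \<subseteq> {\<tau>..T} \<times> {0..1}" using assms(2) by auto
  moreover have "{s..T} \<times> {0..1::real} \<in> sets (lborel \<Otimes>\<^sub>M lborel)" by simp
  ultimately show "set_borel_measurable (lborel \<Otimes>\<^sub>M lborel) ({s..T} \<times> {0..1}) (\<lambda>p. r (fst p) (snd p)) \<and>
        set_integrable (lborel \<Otimes>\<^sub>M lborel) ({s..T} \<times> {0..1}) (\<lambda>p. (r (fst p) (snd p))\<^sup>2)"
    using assms(1) unfolding forcing_def by (blast intro: set_borel_measurable_mono set_integrable_subset)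
qed

lemma traj_restrict:
  assumes "traj \<tau> \<sigma> u" "\<tau> \<le> s" shows "traj s \<sigma> u"
proof -
  obtain r where r: "mild \<tau> r u" "inclusion \<tau> \<sigma> u r" using assms(1) by (auto simp: traj_def)
  have "mild s r u"
    using r(1) assms(2) forcing_restrict[of \<tau> r s] unfolding mild_def by auto
  moreover have "inclusion s \<sigma> u r"
    using r(2) assms(2) unfolding inclusion_def by (auto elim: eventually_mono)
  ultimately show ?thesis by (auto simp: traj_def)
qed

lemma forcing_shift:
  assumes "forcing \<tau> r" shows "forcing (\<tau> - s) (\<lambda>t. r (t + s))"
  unfolding forcing_def
proof (intro allI impI)
  fix T assume T: "T > \<tau> - s"
  define B where "B = {\<tau>..T + s} \<times> {0..1::real}"
  define F where "F p = indicator B p *\<^sub>R r (fst p) (snd p)" for p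
  define G where "G p = indicator B p *\<^sub>R (r (fst p) (snd p))^2" for p
  have "\<tau> < T + s" using T by simp
  then have "F \<in> borel_measurable (lborel \<Otimes>\<^sub>M lborel)" "integrable (lborel \<Otimes>\<^sub>M lborel) G"
    using assms unfolding forcing_def set_borel_measurable_def set_integrable_def F_def[abs_def] G_def[abs_def] B_def by blast+
  then have F: "F \<in> borel_measurable borel" and G: "integrable lborel G"
    unfolding lborel_prod by simp_all
  have m: "(+) (s, 0) \<in> measurable borel (borel :: (real \<times> real) measure)" by measurable
  have i: "indicator B ((s, 0) + p) = (indicator ({\<tau> - s..T} \<times> {0..1}) p :: real)" for p :: "real \<times> real"
    by (cases p) (auto simp: B_def indicator_def)
  have "(\<lambda>p. F ((s, 0) + p)) \<in> borel_measurable borel" by (rule measurable_compose[OF m F])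
  moreover have "F ((s, 0) + p) = indicator ({\<tau> - s..T} \<times> {0..1}) p *\<^sub>R r (fst p + s) (snd p)" for p
    unfolding F_def i by (simp add: add.commute)
  ultimately have 1: "set_borel_measurable (lborel \<Otimes>\<^sub>M lborel) ({\<tau> - s..T} \<times> {0..1}) (\<lambda>p. r (fst p + s) (snd p))"
    unfolding set_borel_measurable_def lborel_prod by simp
  have "integrable (distr lborel borel ((+) (s, 0))) G" unfolding lborel_distr_plus by (rule G)
  then have "integrable lborel (\<lambda>p. G ((s, 0) + p))" by (rule integrable_distr[rotated]) (use m in simp)
  moreover have "G ((s, 0) + p) = indicator ({\<tau> - s..T} \<times> {0..1}) p *\<^sub>R (r (fst p + s) (snd p))^2" for p
    unfolding G_def i by (simp add: add.commute)
  ultimately have "set_integrable (lborel \<Otimes>\<^sub>M lborel) ({\<tau> - s..T} \<times> {0..1}) (\<lambda>p. (r (fst p + s) (snd p))^2)"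
    unfolding set_integrable_def lborel_prod by simp
  with 1 show "set_borel_measurable (lborel \<Otimes>\<^sub>M lborel) ({\<tau> - s..T} \<times> {0..1}) (\<lambda>p. r (fst p + s) (snd p)) \<and>
         set_integrable (lborel \<Otimes>\<^sub>M lborel) ({\<tau> - s..T} \<times> {0..1}) (\<lambda>p. (r (fst p + s) (snd p))\<^sup>2)" by blast
qed

lemma has_integral_shift_real:
  fixes f :: "real \<Rightarrow> real"
  assumes "(f has_integral i) {a + s..b + s}"
  shows "((\<lambda>x. f (x + s)) has_integral i) {a..b}"
  using has_integral_affinity'[of f i "a + s" "b + s" 1 s] assms by simp

lemma AE_lborel_shift:
  assumes "AE t in lborel. P t" shows "AE t in lborel. P (t + s :: real)"
proof -
  obtain N where N: "negligible N" "\<And>t. t \<notin> N \<Longrightarrow> P t" using AE_lborel_negligible[OF assms] by blast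
  show ?thesis
  proof (rule negligible_AE_lborel)
    show "negligible ((+) (-s) ` N)" by (rule negligible_translation[OF N(1)])
    fix t assume "t \<notin> (+) (-s) ` N"
    then have "t + s \<notin> N" by (metis add.commute image_eqI minus_add_cancel)
    then show "P (t + s)" by (rule N(2))
  qed
qed

lemma traj_shift:
  assumes "traj \<tau> \<sigma> u" shows "traj (\<tau> - s) (theta s \<sigma>) (\<lambda>t. u (t + s))"
proof -
  obtain r where r: "mild \<tau> r u" "inclusion \<tau> \<sigma> u r" using assms(1) by (auto simp: traj_def)
  note D = mildD[OF r(1)]
  have "mild (\<tau> - s) (\<lambda>t. r (t + s)) (\<lambda>t. u (t + s))"
    unfolding mild_def
  proof (intro conjI allI impI forcing_shift D(1))
    show "inH (u (t + s))" if "\<tau> - s \<le> t" for t using that by (intro D(2)) simp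
    show "((\<lambda>x. coef (r (x + s)) k - lam k * coef (u (x + s)) k) has_integral coef (u (t + s)) k - coef (u (t' + s)) k) {t'..t}"
      if "\<tau> - s \<le> t'" "t' \<le> t" for k t' t
      by (rule has_integral_shift_real[OF D(3)]) (use that in auto)
  qed
  moreover have "inclusion (\<tau> - s) (theta s \<sigma>) (\<lambda>t. u (t + s)) (\<lambda>t. r (t + s))"
    using AE_lborel_shift[OF r(2)[unfolded inclusion_def], of s]
    unfolding inclusion_def theta_def by (simp add: diff_less_eq)
  ultimately show ?thesis by (auto simp: traj_def)
qed

lemma traj_concat:
  assumes u1: "traj \<tau> \<sigma> u1" and u2: "traj s \<sigma> u2" and s: "\<tau> \<le> s" and e: "eqH (u2 s) (u1 s)"
  shows "traj \<tau> \<sigma> (\<lambda>t. if t < s then u1 t else u2 t)"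
proof -
  obtain r1 where r1: "mild \<tau> r1 u1" "inclusion \<tau> \<sigma> u1 r1" using u1 by (auto simp: traj_def)
  obtain r2 where r2: "mild s r2 u2" "inclusion s \<sigma> u2 r2" using u2 by (auto simp: traj_def)
  note D1 = mildD[OF r1(1)] and D2 = mildD[OF r2(1)]
  define u where "u t = (if t < s then u1 t else u2 t)" for t
  define r where "r t = (if t < s then r1 t else r2 t)" for t
  have es: "coef (u2 s) k = coef (u1 s) k" for k using e D1(2)[OF s] D2(2)[OF order.refl] eqH_iff_coef by blast
  have "forcing \<tau> r"
    unfolding forcing_def
  proof (intro allI impI)
    fix T assume T: "T > \<tau>"
    define B1 where "B1 = ({\<tau>..T} \<inter> {..<s}) \<times> {0..1::real}"
    define B2 where "B2 = ({\<tau>..T} \<inter> {s..}) \<times> {0..1::real}"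
    have m: "B1 \<in> sets (lborel \<Otimes>\<^sub>M lborel)" "B2 \<in> sets (lborel \<Otimes>\<^sub>M lborel)" by (auto simp: B1_def B2_def)
    have b1: "set_borel_measurable (lborel \<Otimes>\<^sub>M lborel) B1 (\<lambda>p. r1 (fst p) (snd p))"
       "set_integrable (lborel \<Otimes>\<^sub>M lborel) B1 (\<lambda>p. (r1 (fst p) (snd p))^2)"
      using D1(1) T m unfolding forcing_def
      by (auto intro: set_borel_measurable_mono[of _ "{\<tau>..T} \<times> {0..1}"] set_integrable_subset[of _ "{\<tau>..T} \<times> {0..1}"] simp: B1_def)
    have b2: "set_borel_measurable (lborel \<Otimes>\<^sub>M lborel) B2 (\<lambda>p. r2 (fst p) (snd p))"
       "set_integrable (lborel \<Otimes>\<^sub>M lborel) B2 (\<lambda>p. (r2 (fst p) (snd p))^2)"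
    proof -
      have "s < max T s + 1" by simp
      moreover have "B2 \<subseteq> {s..max T s + 1} \<times> {0..1}" by (auto simp: B2_def)
      ultimately show "set_borel_measurable (lborel \<Otimes>\<^sub>M lborel) B2 (\<lambda>p. r2 (fst p) (snd p))"
       "set_integrable (lborel \<Otimes>\<^sub>M lborel) B2 (\<lambda>p. (r2 (fst p) (snd p))^2)"
        using D2(1) m unfolding forcing_def by (blast intro: set_borel_measurable_mono set_integrable_subset)+
    qed
    have i: "indicator ({\<tau>..T} \<times> {0..1}) p *\<^sub>R f (r (fst p) (snd p))
        = indicator B1 p *\<^sub>R f (r1 (fst p) (snd p)) + indicator B2 p *\<^sub>R f (r2 (fst p) (snd p))" for p and f :: "real \<Rightarrow> real"
      by (cases p) (auto simp: B1_def B2_def r_def indicator_def)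
    show "set_borel_measurable (lborel \<Otimes>\<^sub>M lborel) ({\<tau>..T} \<times> {0..1}) (\<lambda>p. r (fst p) (snd p)) \<and>
        set_integrable (lborel \<Otimes>\<^sub>M lborel) ({\<tau>..T} \<times> {0..1}) (\<lambda>p. (r (fst p) (snd p))\<^sup>2)"
      unfolding set_borel_measurable_def set_integrable_def i[of _ "\<lambda>x. x"] i[of _ "\<lambda>x. x^2"]
      using b1 b2 unfolding set_borel_measurable_def set_integrable_def by auto
  qed
  moreover have "((\<lambda>x. coef (r x) k - lam k * coef (u x) k) has_integral coef (u b) k - coef (u a) k) {a..b}"
    if ab: "\<tau> \<le> a" "a \<le> b" for k a b
  proof -
    have left: "((\<lambda>x. coef (r x) k - lam k * coef (u x) k) has_integral coef (u b) k - coef (u a) k) {a..b}"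
      if "\<tau> \<le> a" "a \<le> b" "b \<le> s" for a b
    proof -
      have e: "coef (u x) k = coef (u1 x) k" if "x \<le> s" for x using that es by (cases "x = s") (auto simp: u_def)
      have i: "((\<lambda>x. coef (r1 x) k - lam k * coef (u1 x) k) has_integral coef (u1 b) k - coef (u1 a) k) {a..b}"
        by (rule D1(3)[OF that(1,2)])
      have "((\<lambda>x. coef (r x) k - lam k * coef (u x) k) has_integral coef (u1 b) k - coef (u1 a) k) {a..b}"
      proof (rule has_integral_spike[OF negligible_sing _ i])
        fix x assume "x \<in> {a..b} - {s}"
        then have "x < s" using that by auto
        then show "coef (r x) k - lam k * coef (u x) k = coef (r1 x) k - lam k * coef (u1 x) k"
          by (simp add: r_def u_def)
      qed
      then show ?thesis using that by (simp add: e)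
    qed
    have right: "((\<lambda>x. coef (r x) k - lam k * coef (u x) k) has_integral coef (u b) k - coef (u a) k) {a..b}"
      if "s \<le> a" "a \<le> b" for a b
    proof -
      have i: "((\<lambda>x. coef (r2 x) k - lam k * coef (u2 x) k) has_integral coef (u2 b) k - coef (u2 a) k) {a..b}"
        by (rule D2(3)[OF that])
      have "((\<lambda>x. coef (r x) k - lam k * coef (u x) k) has_integral coef (u2 b) k - coef (u2 a) k) {a..b}"
        by (rule has_integral_eq[OF _ i]) (use that in \<open>auto simp: r_def u_def\<close>)
      then show ?thesis using that by (simp add: u_def)
    qed
    consider "b \<le> s" | "s \<le> a" | "a \<le> s" "s \<le> b" by linarith
    then show ?thesis
    proof cases
      case 3
      have "((\<lambda>x. coef (r x) k - lam k * coef (u x) k) has_integral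
          (coef (u s) k - coef (u a) k) + (coef (u b) k - coef (u s) k)) {a..b}"
        by (rule has_integral_combine[OF 3]) (use left right ab 3 in auto)
      then show ?thesis by simp
    qed (use left right ab in auto)
  qed
  moreover have "inH (u t)" if "t \<ge> \<tau>" for t using D1(2)[OF that] D2(2)[of t] by (simp add: u_def)
  ultimately have m: "mild \<tau> r u" by (simp add: mild_def)
  have "AE t in lborel. t \<noteq> s" by (rule negligible_AE_lborel[OF negligible_sing[of s]]) simp
  with r1(2) r2(2) have "inclusion \<tau> \<sigma> u r" unfolding inclusion_def
  proof eventually_elim
    case (elim t)
    then show ?case by (cases "t < s") (auto simp: u_def r_def)
  qed
  with m show ?thesis unfolding traj_def u_def[abs_def] by blast
qed

section \<open>The dissipative estimate\<close>

lemma nrm_mono: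
  assumes "L2 M f" "L2 M g" "AE x in M. \<bar>f x\<bar> \<le> g x"
  shows "nrm M f \<le> nrm M g"
  unfolding nrm_def
proof (intro real_sqrt_le_mono integral_mono_AE L2_sq_integrable assms)
  show "AE x in M. (f x)\<^sup>2 \<le> (g x)\<^sup>2" using assms(3)
  proof eventually_elim
    case (elim x)
    then show ?case using power_mono[OF elim, of 2] by simp
  qed
qed

lemma nrm_abs [simp]: "nrm M (\<lambda>x. \<bar>f x\<bar>) = nrm M f"
  by (simp add: nrm_def)

lemma L2_abs: "L2 M f \<Longrightarrow> L2 M (\<lambda>x. \<bar>f x\<bar>)"
  by (auto simp: L2_def)

lemma nrm_cmult: "nrm M (\<lambda>x. c * f x) = \<bar>c\<bar> * nrm M f"
  by (simp add: nrm_def power_mult_distrib real_sqrt_mult)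

lemma L2_const_I01 [simp]: "L2 I01 (\<lambda>x. c)"
  by (intro L2_on_continuous continuous_intros)

lemma nrm_const_I01: "nrm I01 (\<lambda>x. c) = \<bar>c\<bar>"
  unfolding nrm_def by (subst I01_integral_eq) (auto intro: continuous_imp_integrable_real)

lemma normH_affine_le:
  assumes "inH f" "inH u" "a \<ge> 0" "w \<ge> 0" "AE y in I01. \<bar>f y\<bar> \<le> a + w * \<bar>u y\<bar>"
  shows "normH f \<le> a + w * normH u"
proof -
  have L: "L2 I01 (\<lambda>y. w * \<bar>u y\<bar>)" "L2 I01 f" using assms by (auto simp: inH_iff intro: L2_cmult L2_abs)
  have "nrm I01 f \<le> nrm I01 (\<lambda>y. a + w * \<bar>u y\<bar>)" by (rule nrm_mono[OF L(2) L2_add[OF L2_const_I01 L(1)] assms(5)])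
  also have "\<dots> \<le> nrm I01 (\<lambda>y. a) + nrm I01 (\<lambda>y. w * \<bar>u y\<bar>)" by (rule nrm_triangle[OF L2_const_I01 L(1)])
  also have "\<dots> = a + w * nrm I01 u" using assms by (simp add: nrm_const_I01 nrm_cmult)
  finally show ?thesis by (simp add: normH_eq)
qed

lemma H0_abs_le: "h \<in> H0 s \<Longrightarrow> \<bar>h\<bar> \<le> 1"
  by (auto simp: H0_def split: if_splits)

locale coefficient_bounds =
  fixes b0 b1 w1 :: real
  assumes b0: "0 < b0" and b01: "b0 \<le> b1" and w1: "0 \<le> w1" and w1_pi: "w1 < pi^2"
begin

definition adm :: "(real \<Rightarrow> real \<times> real) \<Rightarrow> bool" where
  "adm \<sigma> \<longleftrightarrow> (\<forall>t. b0 \<le> fst (\<sigma> t) \<and> fst (\<sigma> t) \<le> b1 \<and> 0 \<le> snd (\<sigma> t) \<and> snd (\<sigma> t) \<le> w1)"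

definition \<delta> :: real where "\<delta> = pi^2 - w1"

definition K :: real where "K = (b1 / \<delta>)^2"

lemma \<delta>_pos: "\<delta> > 0" using w1_pi by (simp add: \<delta>_def)

lemma b1_pos: "b1 > 0" using b0 b01 by simp

lemma forcing_bound:
  assumes m: "mild \<tau> r u" and i: "inclusion \<tau> \<sigma> u r" and a: "adm \<sigma>"
  shows "AE t in lborel. t > \<tau> \<longrightarrow> inH (r t) \<and> normH (r t) \<le> b1 + w1 * normH (u t)"
proof -
  note D = mildD[OF m]
  have "AE t in lborel. \<forall>n::nat. t \<in> {\<tau>..\<tau> + 1 + real n} \<longrightarrow> inH (r t)"
    by (subst AE_all_countable) (intro allI forcing_slices(1)[OF D(1)], simp)
  with i[unfolded inclusion_def] show ?thesis
  proof eventually_elim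
    case (elim t)
    show ?case
    proof
      assume t: "t > \<tau>"
      obtain n :: nat where "t - \<tau> < real n" using reals_Archimedean2 by blast
      then have Hr: "inH (r t)" using elim(2) t by (auto dest!: spec[of _ n])
      have s: "b0 \<le> fst (\<sigma> t)" "fst (\<sigma> t) \<le> b1" "0 \<le> snd (\<sigma> t)" "snd (\<sigma> t) \<le> w1"
        using a by (auto simp: adm_def)
      have "AE y in lebesgue. y \<in> {0..1} \<longrightarrow> (\<exists>h\<in>H0 (u t y). r t y = fst (\<sigma> t) * h + snd (\<sigma> t) * u t y)"
        using elim(1) t by blast
      then have "AE y in lebesgue. y \<in> {0..1} \<longrightarrow> \<bar>r t y\<bar> \<le> b1 + w1 * \<bar>u t y\<bar>"
      proof eventually_elim
        case (elim y)
        show ?case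
        proof
          assume "y \<in> {0..1}"
          with elim obtain h where h: "h \<in> H0 (u t y)" "r t y = fst (\<sigma> t) * h + snd (\<sigma> t) * u t y" by blast
          have "\<bar>r t y\<bar> \<le> \<bar>fst (\<sigma> t)\<bar> * \<bar>h\<bar> + \<bar>snd (\<sigma> t)\<bar> * \<bar>u t y\<bar>"
            unfolding h(2) abs_mult[symmetric] by (rule abs_triangle_ineq)
          also have "\<dots> \<le> b1 * 1 + w1 * \<bar>u t y\<bar>"
            using s b0 b1_pos H0_abs_le[OF h(1)] w1 by (intro add_mono mult_mono) auto
          finally show "\<bar>r t y\<bar> \<le> b1 + w1 * \<bar>u t y\<bar>" by simp
        qed
      qed
      then have "AE y in I01. \<bar>r t y\<bar> \<le> b1 + w1 * \<bar>u t y\<bar>" by (subst AE_restrict_space_iff) simp_all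
      then have "normH (r t) \<le> b1 + w1 * normH (u t)"
        using Hr D(2)[of t] t w1 b1_pos by (intro normH_affine_le) auto
      with Hr show "inH (r t) \<and> normH (r t) \<le> b1 + w1 * normH (u t)" by simp
    qed
  qed
qed

lemma energy_derivative:
  assumes Hu: "\<And>t. t \<ge> \<tau> \<Longrightarrow> inH (u t)" and t: "t > \<tau>" and d: "has_H_derivative u d t"
  shows "((\<lambda>t. (normH (u t))^2) has_real_derivative 2 * (\<integral>y. u t y * d y \<partial>I01)) (at t)"
  unfolding DERIV_def
proof -
  define q where "q h y = (u (t + h) y - u t y) / h" for h y
  have Hd: "inH d" and lim: "((\<lambda>h. distH (q h) d) \<longlongrightarrow> 0) (at 0)"
    using d by (auto simp: has_H_derivative_def q_def[abs_def])
  have Ht: "inH (u t)" using Hu t by simp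
  have ev: "\<forall>\<^sub>F h in at 0. h \<in> {\<tau> - t<..} \<and> h \<noteq> 0"
    using t by (intro eventually_conj eventually_at_in_open') (auto simp: eventually_at_filter)
  have Hq: "inH (q h)" if "h > \<tau> - t" for h
  proof -
    have "q h = (\<lambda>y. (1/h) * (u (t + h) y - u t y))" by (simp add: q_def fun_eq_iff)
    moreover have "inH (\<lambda>y. u (t + h) y - u t y)" using that by (intro inH_diff Hu Ht) simp
    ultimately show ?thesis by (simp only: inH_iff L2_cmult)
  qed
  define I where "I f = (\<integral>y. u t y * f y \<partial>I01)" for f
  have E: "((normH (u (t + h)))^2 - (normH (u t))^2) / h = 2 * I (q h) + h * (normH (q h))^2"
    if h: "h > \<tau> - t" "h \<noteq> 0" for h
  proof -
    have L: "L2 I01 (q h)" "L2 I01 (u t)" using Hq[OF h(1)] Ht by (simp_all add: inH_iff)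
    have "u (t + h) y = u t y + h * q h y" for y using h by (simp add: q_def)
    then have "(normH (u (t + h)))^2 = (\<integral>y. (u t y)^2 + (2 * h * (u t y * q h y) + h^2 * (q h y)^2) \<partial>I01)"
      by (simp add: normH_eq nrm_power2 power2_sum power_mult_distrib mult_ac add_ac)
    also have "\<dots> = (normH (u t))^2 + (2 * h * I (q h) + h^2 * (normH (q h))^2)"
      unfolding I_def normH_eq nrm_power2 using L2_mult_integrable[OF L(2,1)] L2_sq_integrable[OF L(1)] L2_sq_integrable[OF L(2)]
      by simp
    finally show ?thesis using h by (simp add: field_simps power2_eq_square)
  qed
  have I: "((\<lambda>h. I (q h)) \<longlongrightarrow> I d) (at 0)"
  proof (rule LIM_zero_cancel, rule Lim_null_comparison)
    show "((\<lambda>h. normH (u t) * distH (q h) d) \<longlongrightarrow> 0) (at 0)" using tendsto_mult[OF tendsto_const lim] by simp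
    show "\<forall>\<^sub>F h in at 0. norm (I (q h) - I d) \<le> normH (u t) * distH (q h) d"
      using ev
    proof eventually_elim
      case (elim h)
      have L: "L2 I01 (q h)" "L2 I01 (u t)" "L2 I01 d" using Hq[of h] elim Ht Hd by (simp_all add: inH_iff)
      have "I (q h) - I d = (\<integral>y. u t y * (q h y - d y) \<partial>I01)"
        unfolding I_def using L2_mult_integrable[OF L(2,1)] L2_mult_integrable[OF L(2,3)] by (simp add: right_diff_distrib)
      then show ?case using L2_Cauchy_Schwarz[OF L(2) L2_diff[OF L(1,3)]] by (simp add: normH_eq distH_eq)
    qed
  qed
  have Z: "((\<lambda>h. h * (normH (q h))^2) \<longlongrightarrow> 0) (at 0)"
  proof (rule Lim_null_comparison)
    have "((\<lambda>h. \<bar>h\<bar> * (normH d + distH (q h) d)^2) \<longlongrightarrow> \<bar>0\<bar> * (normH d + 0)^2) (at 0)"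
      by (intro tendsto_intros lim)
    then show "((\<lambda>h. \<bar>h\<bar> * (normH d + distH (q h) d)^2) \<longlongrightarrow> 0) (at 0)" by simp
    show "\<forall>\<^sub>F h in at 0. norm (h * (normH (q h))^2) \<le> \<bar>h\<bar> * (normH d + distH (q h) d)^2"
      using ev
    proof eventually_elim
      case (elim h)
      have L: "L2 I01 (q h)" "L2 I01 d" using Hq[of h] elim Hd by (simp_all add: inH_iff)
      have "normH (q h) \<le> normH d + distH (q h) d"
        using nrm_triangle[OF L(2) L2_diff[OF L]] by (simp add: normH_eq distH_eq)
      then have "(normH (q h))^2 \<le> (normH d + distH (q h) d)^2" by (intro power_mono) auto
      then show ?case by (simp add: abs_mult mult_left_mono)
    qed
  qed
  have "((\<lambda>h. 2 * I (q h) + h * (normH (q h))^2) \<longlongrightarrow> 2 * I d + 0) (at 0)"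
    by (intro tendsto_intros I Z)
  moreover have "\<forall>\<^sub>F h in at 0. 2 * I (q h) + h * (normH (q h))^2 = ((normH (u (t + h)))^2 - (normH (u t))^2) / h"
    using ev by eventually_elim (use E in auto)
  ultimately show "((\<lambda>h. ((normH (u (t + h)))\<^sup>2 - (normH (u t))\<^sup>2) / h) \<longlongrightarrow> 2 * (\<integral>y. u t y * d y \<partial>I01)) (at 0)"
    unfolding I_def by (auto intro: Lim_transform_eventually)
qed

lemma energy_rate:
  assumes Hu: "inH u" and Hr: "inH r" and Hd: "inH d" and v: "opA u v" and e: "eqH (\<lambda>y. d y + v y) r"
    and r: "normH r \<le> b1 + w1 * normH u"
  shows "2 * (\<integral>y. u y * d y \<partial>I01) \<le> - \<delta> * (normH u)^2 + \<delta> * K"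
proof -
  have Hv: "inH v" "\<And>k. coef v k = lam k * coef u k" using v by (simp_all add: opA_iff)
  have L: "L2 I01 u" "L2 I01 r" "L2 I01 d" "L2 I01 v" using Hu Hr Hd Hv by (simp_all add: inH_iff)
  have "coef r k = coef d k + coef v k" for k
    using e eqH_iff_coef[of "\<lambda>y. d y + v y" r] L by (simp add: inH_iff L2_add coef_add)
  then have dk: "coef d k = coef r k - lam k * coef u k" for k using Hv by simp
  have 1: "(\<lambda>k. coef u k * coef r k - coef u k * coef d k) sums ((\<integral>y. u y * r y \<partial>I01) - (\<integral>y. u y * d y \<partial>I01))"
    by (intro sums_diff Parseval_sine_mult L)
  have 2: "(\<lambda>k. pi^2 * (coef u k)^2) sums (pi^2 * (normH u)^2)" by (intro sums_mult normH_sums Hu)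
  have "pi^2 * (normH u)^2 \<le> (\<integral>y. u y * r y \<partial>I01) - (\<integral>y. u y * d y \<partial>I01)"
  proof (rule sums_le[OF _ 2 1])
    fix k
    have "coef u k * coef r k - coef u k * coef d k = lam k * (coef u k)^2"
      by (simp add: dk power2_eq_square algebra_simps)
    then show "pi^2 * (coef u k)^2 \<le> coef u k * coef r k - coef u k * coef d k"
      using lam_ge[of k] by (simp add: mult_right_mono)
  qed
  moreover have "(\<integral>y. u y * r y \<partial>I01) \<le> normH u * normH r"
    using L2_Cauchy_Schwarz[OF L(1,2)] by (simp add: normH_eq)
  moreover have "normH u * normH r \<le> normH u * (b1 + w1 * normH u)" by (intro mult_left_mono r) simp
  ultimately have "(\<integral>y. u y * d y \<partial>I01) \<le> b1 * normH u - \<delta> * (normH u)^2"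
    by (simp add: \<delta>_def power2_eq_square algebra_simps)
  moreover have "2 * (b1 * normH u) \<le> \<delta> * (normH u)^2 + \<delta> * K"
  proof -
    have "0 \<le> \<delta> * (normH u - b1 / \<delta>)^2" using \<delta>_pos by simp
    also have "\<dots> = \<delta> * (normH u)^2 - 2 * (b1 * normH u) + \<delta> * K"
      using \<delta>_pos by (simp add: K_def power2_eq_square field_simps)
    finally show ?thesis by simp
  qed
  ultimately show ?thesis by linarith
qed

lemma energy_decay_aux:
  assumes m: "mild \<tau> r u" and i: "inclusion \<tau> \<sigma> u r" and a: "adm \<sigma>" and st: "\<tau> < s" "s < t"
  shows "(normH (u t))^2 \<le> exp (- \<delta> * (t - s)) * (normH (u s))^2 + K"
proof -
  note D = mildD[OF m]
  define E where "E x = (normH (u x))^2" for x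
  define g where "g x = exp (\<delta> * x)" for x
  define F where "F x = g x * (E x - K)" for x
  obtain M0 where M0: "\<And>x. x \<in> {s..t} \<Longrightarrow> \<bar>E x\<bar> \<le> M0"
  proof -
    have "\<bar>E x\<bar> \<le> (normH (u s))^2 + integral {s..t} (\<lambda>t. (normH (r t))^2)" if "x \<in> {s..t}" for x
    proof -
      have "E x \<le> (normH (u s))^2 + integral {s..x} (\<lambda>t. (normH (r t))^2)"
        unfolding E_def by (rule mild_norm_le[OF m]) (use st that in auto)
      also have "integral {s..x} (\<lambda>t. (normH (r t))^2) \<le> integral {s..t} (\<lambda>t. (normH (r t))^2)"
        by (rule integral_subset_le) (use st that in \<open>auto intro!: forcing_norm_integrable[OF D(1)]\<close>)
      finally show ?thesis by (simp add: E_def)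
    qed
    then show ?thesis using that by blast
  qed
  define M where "M = sqrt M0"
  have nM: "normH (u x) \<le> M" if "x \<in> {s..t}" for x
    using M0[OF that] unfolding M_def E_def by (intro real_le_rsqrt) auto
  have acu: "ac (\<lambda>s e. distH (u e) (u s)) s t"
    using mild_abs_cont[OF m st] unfolding ac_def abs_cont_H_def intervals_def by simp
  have "M \<ge> 0" using nM[of s] normH_nonneg[of "u s"] st by (meson atLeastAtMost_iff less_imp_le order.refl order.trans)
  have acE: "ac (\<lambda>s e. \<bar>(E e - K) - (E s - K)\<bar>) s t"
  proof (rule ac_dominated[OF acu, of "2 * M"])
    fix x y assume xy: "s \<le> x" "x \<le> y" "y \<le> t"
    have H: "L2 I01 (u x)" "L2 I01 (u y)" using D(2) xy st by (auto simp: inH_iff)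
    have "\<bar>normH (u y) - normH (u x)\<bar> \<le> distH (u y) (u x)"
      using nrm_triangle[OF H(1) L2_diff[OF H(2,1)]] nrm_triangle[OF H(2) L2_diff[OF H]] nrm_minus_commute[of I01 "u x" "u y"]
      by (simp add: normH_eq distH_eq)
    moreover have "(E y - K) - (E x - K) = (normH (u y) - normH (u x)) * (normH (u y) + normH (u x))"
      by (simp add: E_def power2_eq_square algebra_simps)
    moreover have "\<bar>normH (u y) + normH (u x)\<bar> \<le> 2 * M" using nM[of x] nM[of y] xy by simp
    ultimately have "\<bar>(E y - K) - (E x - K)\<bar> \<le> distH (u y) (u x) * (2 * M)"
      by (simp add: abs_mult mult_mono)
    also have "\<dots> \<le> 2 * M * (distH (u y) (u x) + (y - x))" using \<open>M \<ge> 0\<close> xy by (simp add: algebra_simps mult_left_mono)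
    finally show "\<bar>(E y - K) - (E x - K)\<bar> \<le> 2 * M * (distH (u y) (u x) + (y - x))" .
  qed (use \<open>M \<ge> 0\<close> in simp)
  have dg: "(g has_real_derivative \<delta> * g x) (at x within S)" for x S
    unfolding g_def[abs_def] by (auto intro!: derivative_eq_intros)
  have acg: "ac (\<lambda>s e. \<bar>g e - g s\<bar>) s t"
  proof (rule ac_indefinite_integral)
    show "L2 (lebesgue_on {s..t}) (\<lambda>x. \<delta> * g x)"
      unfolding g_def by (intro L2_on_continuous continuous_intros)
    fix x assume "x \<in> {s..t}"
    then have "((\<lambda>x. \<delta> * g x) has_integral (g x - g s)) {s..x}"
      by (intro fundamental_theorem_of_calculus) (auto simp: has_real_derivative_iff_has_vector_derivative[symmetric] dg)
    then have "integral {s..x} (\<lambda>x. \<delta> * g x) = g x - g s" by (rule integral_unique)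
    then show "g x = g s + integral {s..x} (\<lambda>x. \<delta> * g x)" by linarith
  qed
  have gpos: "g x > 0" for x by (simp add: g_def)
  have acF: "ac (\<lambda>s e. \<bar>F e - F s\<bar>) s t"
    unfolding F_def
  proof (rule ac_mult[OF acg acE, of "max (g t) (M0 + K)"])
    fix x assume x: "x \<in> {s..t}"
    have "g x \<le> g t" using x \<delta>_pos by (simp add: g_def)
    then show "\<bar>g x\<bar> \<le> max (g t) (M0 + K)" using gpos[of x] by simp
    have "K \<ge> 0" by (simp add: K_def)
    then have "\<bar>E x - K\<bar> \<le> M0 + K" using M0[OF x] by linarith
    then show "\<bar>E x - K\<bar> \<le> max (g t) (M0 + K)" by (rule max.coboundedI2)
  qed
  obtain N1 where N1: "negligible N1" "\<And>x. x \<notin> N1 \<Longrightarrow> x > \<tau> \<longrightarrow> (\<exists>d v. has_H_derivative u d x \<and> opA (u x) v \<and> eqH (\<lambda>y. d y + v y) (r x))"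
    using AE_lborel_negligible[OF mild_derivative[OF m]] by blast
  obtain N2 where N2: "negligible N2" "\<And>x. x \<notin> N2 \<Longrightarrow> x > \<tau> \<longrightarrow> inH (r x) \<and> normH (r x) \<le> b1 + w1 * normH (u x)"
    using AE_lborel_negligible[OF forcing_bound[OF m i a]] by blast
  have "\<exists>D. (F has_real_derivative D) (at x within {s..t}) \<and> D \<le> 0" if x: "x \<in> {s..t} - (N1 \<union> N2)" for x
  proof -
    have x\<tau>: "\<tau> < x" using x st by auto
    obtain d v where dv: "has_H_derivative u d x" "opA (u x) v" "eqH (\<lambda>y. d y + v y) (r x)"
      using N1(2)[of x] x x\<tau> by auto
    have r: "inH (r x)" "normH (r x) \<le> b1 + w1 * normH (u x)" using N2(2)[of x] x x\<tau> by auto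
    have Hd: "inH d" using dv(1) by (simp add: has_H_derivative_def)
    define e where "e = 2 * (\<integral>y. u x y * d y \<partial>I01)"
    have e: "e \<le> - \<delta> * E x + \<delta> * K"
      unfolding e_def E_def by (rule energy_rate[OF D(2) r(1) Hd dv(2,3) r(2)]) (use x\<tau> in simp)
    have "(E has_real_derivative e) (at x)"
      unfolding E_def[abs_def] e_def by (rule energy_derivative[OF D(2) x\<tau> dv(1)])
    then have "(E has_real_derivative e) (at x within {s..t})" by (rule has_field_derivative_at_within)
    then have "(F has_real_derivative \<delta> * g x * (E x - K) + (e - 0) * g x) (at x within {s..t})"
      unfolding F_def[abs_def] by (intro DERIV_mult dg DERIV_diff DERIV_const)
    moreover have "\<delta> * g x * (E x - K) + (e - 0) * g x = g x * (e - (- \<delta> * E x + \<delta> * K))"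
      by (simp add: algebra_simps)
    moreover have "g x * (e - (- \<delta> * E x + \<delta> * K)) \<le> 0" using e gpos[of x] by (simp add: mult_le_0_iff)
    ultimately show ?thesis by metis
  qed
  then obtain F' where F': "\<And>x. x \<in> {s..t} - (N1 \<union> N2) \<Longrightarrow> (F has_real_derivative F' x) (at x within {s..t})"
    "\<And>x. x \<in> {s..t} - (N1 \<union> N2) \<Longrightarrow> F' x \<le> 0" by metis
  have N: "negligible (N1 \<union> N2)" by (intro negligible_Un N1(1) N2(1))
  have hi: "(F' has_integral (F t - F s)) {s..t}"
    by (rule ac_has_integral_derivative[OF acF _ N F'(1)]) (use st in auto)
  have "integral {s..t} F' \<le> integral {s..t} (\<lambda>x. 0)"
    by (rule integral_le_spike[OF _ _ N F'(2)]) (use hi in \<open>auto simp: integrable_on_def\<close>)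
  then have "F t \<le> F s" using hi by (simp add: integral_unique)
  then have "E t - K \<le> g s / g t * (E s - K)" using gpos[of t] by (simp add: F_def field_simps)
  moreover have "g s / g t = exp (- \<delta> * (t - s))" by (simp add: g_def exp_diff[symmetric] algebra_simps)
  moreover have "exp (- \<delta> * (t - s)) * (E s - K) \<le> exp (- \<delta> * (t - s)) * E s" by (intro mult_left_mono) (auto simp: K_def)
  ultimately have "E t - K \<le> exp (- \<delta> * (t - s)) * E s" by (metis order.trans)
  then show ?thesis by (simp add: E_def)
qed

lemma energy_decay:
  assumes u: "traj \<tau> \<sigma> u" and a: "adm \<sigma>" and st: "\<tau> \<le> s" "s \<le> t"
  shows "(normH (u t))^2 \<le> exp (- \<delta> * (t - s)) * (normH (u s))^2 + K"
proof (cases "s = t")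
  case True then show ?thesis by (simp add: K_def)
next
  case False
  then have lt: "s < t" using st by simp
  obtain r where m: "mild s r u" and i: "inclusion s \<sigma> u r" using traj_restrict[OF u st(1)] by (auto simp: traj_def)
  define B where "B x = exp (- \<delta> * (t - x)) * ((normH (u s))^2 + integral {s..x} (\<lambda>t. (normH (r t))^2)) + K" for x
  have "continuous_on {s..t} (\<lambda>x. integral {s..x} (\<lambda>t. (normH (r t))^2))"
    by (rule indefinite_integral_continuous_1) (rule forcing_norm_integrable[OF mildD(1)[OF m] order.refl st(2)])
  then have "continuous_on {s..t} B" unfolding B_def by (intro continuous_intros)
  then have lB: "(B \<longlongrightarrow> B s) (at s within {s..t})" using lt by (simp add: continuous_on)
  have F: "at s within {s..t} \<noteq> bot" using lt by (simp add: trivial_limit_within islimpt_Icc)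
  have "\<forall>\<^sub>F x in at s within {s..t}. (normH (u t))^2 \<le> B x"
  proof -
    have "\<forall>\<^sub>F x in at s within {s..t}. x < t" using lt by (intro order_tendstoD(2)[OF tendsto_ident_at])
    moreover have "\<forall>\<^sub>F x in at s within {s..t}. x \<in> {s..t} \<and> x \<noteq> s" by (auto simp: eventually_at_filter)
    ultimately show ?thesis
    proof eventually_elim
      case (elim x)
      then have x: "s < x" "x < t" by auto
      have "(normH (u t))^2 \<le> exp (- \<delta> * (t - x)) * (normH (u x))^2 + K"
        by (rule energy_decay_aux[OF m i a x])
      also have "\<dots> \<le> B x" unfolding B_def
        by (intro add_right_mono mult_left_mono mild_norm_le[OF m]) (use x in auto)
      finally show ?case .
    qed
  qed
  from tendsto_lowerbound[OF lB this F] have "(normH (u t))^2 \<le> B s" .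
  then show ?thesis by (simp add: B_def)
qed

end

section \<open>Closedness of the inclusion under convex combinations\<close>

lemma H0_iff_subgradient: "h \<in> H0 u \<longleftrightarrow> (\<forall>z. \<bar>u\<bar> + h * (z - u) \<le> \<bar>z\<bar>)"
proof
  assume h: "h \<in> H0 u"
  show "\<forall>z. \<bar>u\<bar> + h * (z - u) \<le> \<bar>z\<bar>"
  proof
    fix z
    have "h * z \<le> \<bar>z\<bar>"
      using mult_right_mono[OF H0_abs_le[OF h], of "\<bar>z\<bar>"] abs_ge_self[of "h * z"] by (simp add: abs_mult)
    moreover have "h * u = \<bar>u\<bar>" using h by (auto simp: H0_def split: if_splits)
    ultimately show "\<bar>u\<bar> + h * (z - u) \<le> \<bar>z\<bar>" by (simp add: algebra_simps)
  qed
next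
  assume a: "\<forall>z. \<bar>u\<bar> + h * (z - u) \<le> \<bar>z\<bar>"
  have "h \<le> 1" using spec[OF a, of "u + 1"] by (simp add: algebra_simps)
  moreover have "h \<ge> -1" using spec[OF a, of "u - 1"] by (simp add: algebra_simps)
  moreover have "h * u \<ge> \<bar>u\<bar>" using spec[OF a, of 0] by simp
  moreover have "h \<le> -1" if "u < 0"
  proof (rule ccontr)
    assume "\<not> h \<le> -1"
    then have "(h + 1) * u < 0" using that by (intro mult_pos_neg) auto
    then show False using \<open>h * u \<ge> \<bar>u\<bar>\<close> that by (simp add: algebra_simps)
  qed
  moreover have "1 \<le> h" if "u > 0"
  proof (rule ccontr)
    assume "\<not> 1 \<le> h"
    then have "(h - 1) * u < 0" using that by (intro mult_neg_pos) auto
    then show False using \<open>h * u \<ge> \<bar>u\<bar>\<close> that by (simp add: algebra_simps)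
  qed
  ultimately show "h \<in> H0 u" by (auto simp: H0_def intro: antisym)
qed

lemma inclusion_limit:
  fixes \<beta> \<omega> :: "nat \<Rightarrow> real"
  assumes v: "\<And>i. inH (v i)" and \<rho>: "\<And>i. inH (\<rho> i)" and u: "inH u" and f: "inH f"
    and inc: "\<And>i. AE y in I01. \<exists>h\<in>H0 (v i y). \<rho> i y = \<beta> i * h + \<omega> i * v i y"
    and \<beta>: "\<beta> \<longlonglongrightarrow> \<beta>'" "\<beta>' > 0" and \<omega>: "\<omega> \<longlonglongrightarrow> \<omega>'" "\<omega>' \<ge> 0"
    and vu: "(\<lambda>i. distH (v i) u) \<longlonglongrightarrow> 0"
    and w: "\<And>n. tail_weights n (N n) (w n)"
    and lim: "(\<lambda>n. distH (\<lambda>y. \<Sum>i<N n. w n i * \<rho> i y) f) \<longlonglongrightarrow> 0"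
  shows "AE y in I01. \<exists>h\<in>H0 (u y). f y = \<beta>' * h + \<omega>' * u y"
proof -
  have L: "L2 I01 (v i)" "L2 I01 (\<rho> i)" "L2 I01 u" "L2 I01 f" for i using v \<rho> u f by (auto simp: inH_iff)
  define a where "a i y = \<bar>\<beta> i - \<beta>'\<bar> + (\<bar>\<omega> i - \<omega>'\<bar> * \<bar>v i y\<bar> + (1 + \<omega>') * \<bar>v i y - u y\<bar>)" for i y
  have La: "L2 I01 (a i)" for i unfolding a_def[abs_def] by (intro L2_add L2_cmult L2_abs L2_diff L L2_const_I01)
  have "(\<lambda>i. nrm I01 (a i)) \<longlonglongrightarrow> 0"
  proof (rule Lim_null_comparison)
    have "(\<lambda>i. \<bar>\<beta> i - \<beta>'\<bar> + (\<bar>\<omega> i - \<omega>'\<bar> * (normH u + distH (v i) u) + (1 + \<omega>') * distH (v i) u))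
      \<longlonglongrightarrow> \<bar>\<beta>' - \<beta>'\<bar> + (\<bar>\<omega>' - \<omega>'\<bar> * (normH u + 0) + (1 + \<omega>') * 0)"
      by (intro tendsto_intros \<beta> \<omega> vu)
    then show "(\<lambda>i. \<bar>\<beta> i - \<beta>'\<bar> + (\<bar>\<omega> i - \<omega>'\<bar> * (normH u + distH (v i) u) + (1 + \<omega>') * distH (v i) u)) \<longlonglongrightarrow> 0"
      by simp
    show "\<forall>\<^sub>F i in sequentially. norm (nrm I01 (a i)) \<le> \<bar>\<beta> i - \<beta>'\<bar> + (\<bar>\<omega> i - \<omega>'\<bar> * (normH u + distH (v i) u) + (1 + \<omega>') * distH (v i) u)"
    proof (intro always_eventually allI)
      fix i
      have l: "L2 I01 (\<lambda>y. \<bar>\<omega> i - \<omega>'\<bar> * \<bar>v i y\<bar>)" "L2 I01 (\<lambda>y. (1 + \<omega>') * \<bar>v i y - u y\<bar>)"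
        by (intro L2_cmult L2_abs L2_diff L)+
      have "nrm I01 (v i) \<le> normH u + distH (v i) u"
        using nrm_triangle[OF L(3) L2_diff[OF L(1,3)], of i] by (simp add: normH_eq distH_eq)
      then have 1: "nrm I01 (\<lambda>y. \<bar>\<omega> i - \<omega>'\<bar> * \<bar>v i y\<bar>) \<le> \<bar>\<omega> i - \<omega>'\<bar> * (normH u + distH (v i) u)"
        by (simp add: nrm_cmult mult_left_mono)
      have 2: "nrm I01 (\<lambda>y. (1 + \<omega>') * \<bar>v i y - u y\<bar>) = (1 + \<omega>') * distH (v i) u"
        using \<omega>(2) by (simp add: nrm_cmult distH_eq)
      have "nrm I01 (a i) \<le> nrm I01 (\<lambda>y. \<bar>\<beta> i - \<beta>'\<bar>) + nrm I01 (\<lambda>y. \<bar>\<omega> i - \<omega>'\<bar> * \<bar>v i y\<bar> + (1 + \<omega>') * \<bar>v i y - u y\<bar>)"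
        unfolding a_def by (rule nrm_triangle[OF L2_const_I01 L2_add[OF l]])
      also have "\<dots> \<le> \<bar>\<beta> i - \<beta>'\<bar> + (\<bar>\<omega> i - \<omega>'\<bar> * (normH u + distH (v i) u) + (1 + \<omega>') * distH (v i) u)"
        using nrm_triangle[OF l] 1 2 by (simp add: nrm_const_I01)
      finally show "norm (nrm I01 (a i)) \<le> \<bar>\<beta> i - \<beta>'\<bar> + (\<bar>\<omega> i - \<omega>'\<bar> * (normH u + distH (v i) u) + (1 + \<omega>') * distH (v i) u)"
        by simp
    qed
  qed
  then have "(\<lambda>i. (nrm I01 (a i))^2) \<longlonglongrightarrow> 0^2" by (rule tendsto_power)
  then have wa: "(\<lambda>n. \<Sum>i<N n. w n i * (nrm I01 (a i))^2) \<longlonglongrightarrow> 0"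
    using tail_weights_tendsto[OF w] by fastforce
  define A where "A n y = (\<Sum>i<N n. w n i * a i y)" for n y
  define S where "S n y = (\<Sum>i<N n. w n i * \<rho> i y)" for n y
  define e where "e n y = \<bar>S n y - f y\<bar> + A n y" for n y
  have LA: "L2 I01 (A n)" for n unfolding A_def[abs_def] by (intro L2_sum L2_cmult La)
  have LS: "L2 I01 (S n)" for n unfolding S_def[abs_def] by (intro L2_sum L2_cmult L)
  have Le: "L2 I01 (e n)" for n unfolding e_def[abs_def] by (intro L2_add L2_abs L2_diff LA LS L)
  have A2: "(nrm I01 (A n))^2 \<le> (\<Sum>i<N n. w n i * (nrm I01 (a i))^2)" for n
  proof -
    have "(nrm I01 (A n))^2 \<le> (\<integral>y. (\<Sum>i<N n. w n i * (a i y)^2) \<partial>I01)"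
      unfolding nrm_power2 A_def
      by (rule integral_mono[OF L2_sq_integrable[OF LA[unfolded A_def[abs_def]]]])
        (auto intro!: tail_weights_Jensen[OF w] L2_sq_integrable La)
    also have "\<dots> = (\<Sum>i<N n. w n i * (nrm I01 (a i))^2)"
      unfolding nrm_power2 using L2_sq_integrable[OF La] by (simp add: Bochner_Integration.integral_sum)
    finally show ?thesis .
  qed
  have "(\<lambda>n. (nrm I01 (A n))^2) \<longlonglongrightarrow> 0"
    by (rule Lim_null_comparison[OF _ wa]) (use A2 in \<open>auto intro!: always_eventually\<close>)
  then have "(\<lambda>n. sqrt ((nrm I01 (A n))^2)) \<longlonglongrightarrow> sqrt 0" by (rule tendsto_real_sqrt)
  then have nA: "(\<lambda>n. nrm I01 (A n)) \<longlonglongrightarrow> 0" by simp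
  have "(\<lambda>n. nrm I01 (e n)) \<longlonglongrightarrow> 0"
  proof (rule Lim_null_comparison)
    show "(\<lambda>n. distH (S n) f + nrm I01 (A n)) \<longlonglongrightarrow> 0"
      using tendsto_add[OF lim[folded S_def] nA] by simp
    have "nrm I01 (e n) \<le> distH (S n) f + nrm I01 (A n)" for n
      using nrm_triangle[OF L2_abs[OF L2_diff[OF LS L(4)]] LA, of n n] by (simp add: e_def[abs_def] distH_eq)
    then show "\<forall>\<^sub>F n in sequentially. norm (nrm I01 (e n)) \<le> distH (S n) f + nrm I01 (A n)" by simp
  qed
  then have "(\<lambda>n. (nrm I01 (e n))^2) \<longlonglongrightarrow> 0^2" by (rule tendsto_power)
  then have "(\<lambda>n. \<integral>y. (e n y)^2 \<partial>I01) \<longlonglongrightarrow> 0" by (simp add: nrm_power2)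
  from L2_AE_subseq[OF Le this] obtain q :: "nat \<Rightarrow> nat" where q: "AE y in I01. (\<lambda>n. e (q n) y) \<longlonglongrightarrow> 0"
    by blast
  have "AE y in I01. \<forall>i. \<exists>h\<in>H0 (v i y). \<rho> i y = \<beta> i * h + \<omega> i * v i y"
    using inc by (simp add: AE_all_countable)
  with q show ?thesis
  proof eventually_elim
    case (elim y)
    define h where "h = (f y - \<omega>' * u y) / \<beta>'"
    have "\<bar>u y\<bar> + h * (z - u y) \<le> \<bar>z\<bar>" for z
    proof -
      define c where "c = \<bar>z - u y\<bar> + 2 * \<beta>'"
      have c0: "c \<ge> 0" using \<beta>(2) by (simp add: c_def)
      have i: "(\<rho> i y - \<omega>' * u y) * (z - u y) \<le> \<beta>' * (\<bar>z\<bar> - \<bar>u y\<bar>) + c * a i y" for i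
      proof -
        obtain h' where h': "h' \<in> H0 (v i y)" "\<rho> i y = \<beta> i * h' + \<omega> i * v i y" using elim(2) by blast
        note h1 = H0_abs_le[OF h'(1)]
        define p where "p = (\<beta> i - \<beta>') * h' + ((\<omega> i - \<omega>') * v i y + \<omega>' * (v i y - u y))"
        have "\<bar>p\<bar> \<le> \<bar>\<beta> i - \<beta>'\<bar> * \<bar>h'\<bar> + (\<bar>\<omega> i - \<omega>'\<bar> * \<bar>v i y\<bar> + \<omega>' * \<bar>v i y - u y\<bar>)"
          unfolding p_def using \<omega>(2) by (intro order.trans[OF abs_triangle_ineq] add_mono) (simp_all add: abs_mult)
        moreover have "\<bar>\<beta> i - \<beta>'\<bar> * \<bar>h'\<bar> \<le> \<bar>\<beta> i - \<beta>'\<bar>" using h1 by (simp add: mult_left_le)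
        ultimately have pa: "\<bar>p\<bar> \<le> a i y"
          using abs_ge_zero[of "v i y - u y"] unfolding a_def distrib_right by linarith
        have va: "\<bar>v i y - u y\<bar> \<le> a i y"
          using \<omega>(2) by (simp add: a_def distrib_right add_nonneg_nonneg)
        have "\<bar>v i y\<bar> + h' * (z - v i y) \<le> \<bar>z\<bar>" using h'(1) H0_iff_subgradient by blast
        moreover have "h' * (v i y - u y) \<le> \<bar>v i y - u y\<bar>"
          using mult_right_mono[OF h1, of "\<bar>v i y - u y\<bar>"] abs_ge_self[of "h' * (v i y - u y)"] by (simp add: abs_mult)
        moreover have "h' * (z - u y) = h' * (z - v i y) + h' * (v i y - u y)" by (simp add: algebra_simps)
        ultimately have "h' * (z - u y) \<le> \<bar>z\<bar> - \<bar>u y\<bar> + 2 * a i y" using va by linarith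
        then have 1: "\<beta>' * (h' * (z - u y)) \<le> \<beta>' * (\<bar>z\<bar> - \<bar>u y\<bar> + 2 * a i y)" using \<beta>(2) by (intro mult_left_mono) auto
        have "p * (z - u y) \<le> \<bar>p\<bar> * \<bar>z - u y\<bar>" by (metis abs_ge_self abs_mult)
        also have "\<dots> \<le> a i y * \<bar>z - u y\<bar>" by (intro mult_right_mono pa) simp
        finally have 2: "p * (z - u y) \<le> a i y * \<bar>z - u y\<bar>" .
        have "(\<rho> i y - \<omega>' * u y) * (z - u y) = \<beta>' * (h' * (z - u y)) + p * (z - u y)"
          unfolding h'(2) p_def by (simp add: algebra_simps)
        then show ?thesis using 1 2 by (simp add: c_def algebra_simps)
      qed
      have n: "(f y - \<omega>' * u y) * (z - u y) \<le> \<beta>' * (\<bar>z\<bar> - \<bar>u y\<bar>) + c * e n y" for n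
      proof -
        have s1: "(\<Sum>i<N n. w n i) = 1" and w0: "\<And>i. w n i \<ge> 0" using w[of n] by (auto simp: tail_weights_def)
        have "(\<Sum>i<N n. w n i * ((\<rho> i y - \<omega>' * u y) * (z - u y))) \<le> (\<Sum>i<N n. w n i * (\<beta>' * (\<bar>z\<bar> - \<bar>u y\<bar>) + c * a i y))"
          by (intro sum_mono mult_left_mono i w0)
        also have "\<dots> = \<beta>' * (\<bar>z\<bar> - \<bar>u y\<bar>) + c * A n y"
        proof -
          have "(\<Sum>i<N n. w n i * (\<beta>' * (\<bar>z\<bar> - \<bar>u y\<bar>) + c * a i y)) = (\<Sum>i<N n. w n i) * (\<beta>' * (\<bar>z\<bar> - \<bar>u y\<bar>)) + c * A n y"
            unfolding A_def sum_distrib_left sum_distrib_right sum.distrib[symmetric]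
            by (intro sum.cong) (auto simp: algebra_simps)
          then show ?thesis using s1 by simp
        qed
        also have "(\<Sum>i<N n. w n i * ((\<rho> i y - \<omega>' * u y) * (z - u y))) = (S n y - \<omega>' * u y) * (z - u y)"
        proof -
          have "(\<Sum>i<N n. w n i * ((\<rho> i y - \<omega>' * u y) * (z - u y))) = (S n y - (\<Sum>i<N n. w n i) * (\<omega>' * u y)) * (z - u y)"
            unfolding S_def sum_distrib_right sum_subtractf[symmetric]
            by (intro sum.cong) (auto simp: algebra_simps)
          then show ?thesis using s1 by simp
        qed
        finally have 1: "(S n y - \<omega>' * u y) * (z - u y) \<le> \<beta>' * (\<bar>z\<bar> - \<bar>u y\<bar>) + c * A n y" .
        have "(f y - S n y) * (z - u y) \<le> \<bar>S n y - f y\<bar> * \<bar>z - u y\<bar>"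
          by (metis abs_ge_self abs_mult abs_minus_commute)
        also have "\<dots> \<le> \<bar>S n y - f y\<bar> * c" using \<beta>(2) by (intro mult_left_mono) (auto simp: c_def)
        finally have 2: "(f y - S n y) * (z - u y) \<le> \<bar>S n y - f y\<bar> * c" .
        have "(f y - \<omega>' * u y) * (z - u y) = (S n y - \<omega>' * u y) * (z - u y) + (f y - S n y) * (z - u y)"
          by (simp add: algebra_simps)
        also have "\<dots> \<le> \<beta>' * (\<bar>z\<bar> - \<bar>u y\<bar>) + c * e n y" using 1 2 by (simp add: e_def algebra_simps)
        finally show ?thesis .
      qed
      have "(\<lambda>n. \<beta>' * (\<bar>z\<bar> - \<bar>u y\<bar>) + c * e (q n) y) \<longlonglongrightarrow> \<beta>' * (\<bar>z\<bar> - \<bar>u y\<bar>) + c * 0"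
        by (intro tendsto_intros elim(1))
      then have "(f y - \<omega>' * u y) * (z - u y) \<le> \<beta>' * (\<bar>z\<bar> - \<bar>u y\<bar>) + c * 0"
        by (rule LIMSEQ_le_const) (use n in auto)
      then show ?thesis using \<beta>(2) by (simp add: h_def field_simps)
    qed
    then have "h \<in> H0 (u y)" by (simp add: H0_iff_subgradient)
    moreover have "f y = \<beta>' * h + \<omega>' * u y" using \<beta>(2) by (simp add: h_def)
    ultimately show ?case by blast
  qed
qed

section \<open>A weighted space of forcing terms on the whole time axis\<close>

definition weighted :: "real \<Rightarrow> (real \<Rightarrow> real \<Rightarrow> real) \<Rightarrow> real \<times> real \<Rightarrow> real" where
  "weighted \<tau> r p = indicator ({\<tau>..} \<times> {0..1}) p * (exp (- \<bar>fst p\<bar> / 2) * r (fst p) (snd p))"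

lemma integrable_exp_minus_abs: "integrable lborel (\<lambda>t::real. exp (- \<bar>t\<bar>))"
proof -
  have "((\<lambda>t::real. exp (- 1 * t)) has_integral exp (- 1 * 0) / 1) {0..}"
    by (rule has_integral_exp_minus_to_infinity) simp
  then have "(\<lambda>t::real. exp (- t)) integrable_on {0..}" by (auto simp: integrable_on_def)
  then have "(\<lambda>t::real. exp (- t)) absolutely_integrable_on {0..}"
    by (rule nonnegative_absolutely_integrable_1) simp
  then have "integrable lebesgue (\<lambda>t::real. indicator {0..} t *\<^sub>R exp (- t))" by (simp add: set_integrable_def)
  then have i: "integrable lborel (\<lambda>t::real. indicator {0..} t *\<^sub>R exp (- t))"
    by (subst (asm) integrable_completion) auto
  have "integrable lborel (\<lambda>t::real. indicator {0..} (0 + (-1) * t) *\<^sub>R exp (- (0 + (-1) * t)))"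
    by (rule lborel_integrable_real_affine[OF i]) simp
  with i have "integrable lborel (\<lambda>t::real. indicator {0..} t *\<^sub>R exp (- t) + indicator {0..} (0 + (-1) * t) *\<^sub>R exp (- (0 + (-1) * t)))"
    by (rule Bochner_Integration.integrable_add)
  then show ?thesis
    by (rule Bochner_Integration.integrable_bound) (auto simp: indicator_def)
qed

lemma weighted_slice:
  assumes "t \<ge> \<tau>"
  shows "inH (\<lambda>y. weighted \<tau> r (t, y)) \<longleftrightarrow> inH (r t)"
    "normH (\<lambda>y. weighted \<tau> r (t, y)) = exp (- \<bar>t\<bar> / 2) * normH (r t)"
    "coef (\<lambda>y. weighted \<tau> r (t, y)) k = exp (- \<bar>t\<bar> / 2) * coef (r t) k"
proof -
  have e: "weighted \<tau> r (t, y) = exp (- \<bar>t\<bar> / 2) * r t y" if "y \<in> {0..1}" for y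
    using that assms by (simp add: weighted_def)
  have c: "inH (\<lambda>y. weighted \<tau> r (t, y)) \<longleftrightarrow> inH (\<lambda>y. exp (- \<bar>t\<bar> / 2) * r t y)"
    "normH (\<lambda>y. weighted \<tau> r (t, y)) = normH (\<lambda>y. exp (- \<bar>t\<bar> / 2) * r t y)"
    "coef (\<lambda>y. weighted \<tau> r (t, y)) k = coef (\<lambda>y. exp (- \<bar>t\<bar> / 2) * r t y) k"
    by (rule inH_cong, erule e)+
  show "inH (\<lambda>y. weighted \<tau> r (t, y)) \<longleftrightarrow> inH (r t)"
  proof -
    have "inH (\<lambda>y. exp (- \<bar>t\<bar> / 2) * r t y) \<longleftrightarrow> inH (r t)"
      using L2_cmult[of I01 "r t" "exp (- \<bar>t\<bar> / 2)"] L2_cmult[of I01 "\<lambda>y. exp (- \<bar>t\<bar> / 2) * r t y" "exp (\<bar>t\<bar> / 2)"]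
      by (auto simp: inH_iff mult.assoc[symmetric] exp_add[symmetric])
    then show ?thesis using c(1) by simp
  qed
  show "normH (\<lambda>y. weighted \<tau> r (t, y)) = exp (- \<bar>t\<bar> / 2) * normH (r t)"
    unfolding c(2) by (simp add: normH_eq nrm_cmult)
  show "coef (\<lambda>y. weighted \<tau> r (t, y)) k = exp (- \<bar>t\<bar> / 2) * coef (r t) k"
    unfolding c(3) by (rule coef_cmult)
qed

lemma weighted_measurable:
  assumes "forcing \<tau> r"
  shows "weighted \<tau> r \<in> borel_measurable (lborel \<Otimes>\<^sub>M lborel)"
proof -
  define F where "F m p = indicator ({\<tau>..\<tau> + 1 + real m} \<times> {0..1}) p *\<^sub>R r (fst p) (snd p)" for m :: nat and p
  have [measurable]: "F m \<in> borel_measurable (lborel \<Otimes>\<^sub>M lborel)" for m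
    using assms unfolding forcing_def set_borel_measurable_def F_def[abs_def] by simp
  have "(\<lambda>p. indicator ({\<tau>..} \<times> {0..1}) p * r (fst p) (snd p)) \<in> borel_measurable (lborel \<Otimes>\<^sub>M lborel)"
  proof (rule borel_measurable_LIMSEQ_real)
    fix p :: "real \<times> real"
    obtain m0 :: nat where m0: "fst p - \<tau> < real m0" using reals_Archimedean2 by blast
    have "F m p = indicator ({\<tau>..} \<times> {0..1}) p * r (fst p) (snd p)" if "m \<ge> m0" for m
    proof -
      have "real m0 \<le> real m" using that by simp
      then have "fst p \<le> \<tau> + 1 + real m" using m0 by linarith
      then show ?thesis by (cases p) (auto simp: F_def indicator_def)
    qed
    then show "(\<lambda>m. F m p) \<longlonglongrightarrow> indicator ({\<tau>..} \<times> {0..1}) p * r (fst p) (snd p)"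
      by (intro tendsto_eventually) (auto simp: eventually_sequentially)
  qed measurable
  then have "(\<lambda>p. exp (- \<bar>fst p\<bar> / 2) * (indicator ({\<tau>..} \<times> {0..1}) p * r (fst p) (snd p))) \<in> borel_measurable (lborel \<Otimes>\<^sub>M lborel)"
    by (rule borel_measurable_times[rotated]) measurable
  then show ?thesis unfolding weighted_def[abs_def] by (simp add: mult_ac)
qed

lemma weighted_L2:
  assumes r: "forcing \<tau> r" and b: "AE t in lborel. t > \<tau> \<longrightarrow> inH (r t) \<and> normH (r t) \<le> R"
  shows "L2 (lborel \<Otimes>\<^sub>M lborel) (weighted \<tau> r)"
    and "(\<integral>p. (weighted \<tau> r p)^2 \<partial>(lborel \<Otimes>\<^sub>M lborel)) \<le> R^2 * (\<integral>t. exp (- \<bar>t\<bar>) \<partial>lborel)"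
proof -
  note [measurable] = weighted_measurable[OF r]
  define W where "W = (\<integral>t. exp (- \<bar>t::real\<bar>) \<partial>lborel)"
  have W: "(\<integral>\<^sup>+t. ennreal (R^2 * exp (- \<bar>t\<bar>)) \<partial>lborel) = ennreal (R^2 * W)"
    unfolding W_def using integrable_exp_minus_abs
    by (subst nn_integral_eq_integral) auto
  have "(\<integral>\<^sup>+p. ennreal ((weighted \<tau> r p)^2) \<partial>(lborel \<Otimes>\<^sub>M lborel)) = (\<integral>\<^sup>+t. \<integral>\<^sup>+y. ennreal ((weighted \<tau> r (t, y))^2) \<partial>lborel \<partial>lborel)"
    by (rule lborel.nn_integral_fst[symmetric]) measurable
  also have "\<dots> \<le> (\<integral>\<^sup>+t. ennreal (R^2 * exp (- \<bar>t\<bar>)) \<partial>lborel)"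
  proof (rule nn_integral_mono_AE)
    have "AE t in lborel. t \<noteq> \<tau>" by (rule negligible_AE_lborel[OF negligible_sing[of \<tau>]]) simp
    with b show "AE t in lborel. (\<integral>\<^sup>+y. ennreal ((weighted \<tau> r (t, y))^2) \<partial>lborel) \<le> ennreal (R^2 * exp (- \<bar>t\<bar>))"
    proof eventually_elim
      case (elim t)
      show ?case
      proof (cases "t > \<tau>")
        case True
        then have t: "inH (r t)" "normH (r t) \<le> R" "t \<ge> \<tau>" using elim by auto
        have sm: "(\<lambda>y. weighted \<tau> r (t, y)) \<in> borel_measurable lborel" by measurable
        have z: "\<forall>y. y \<notin> {0..1} \<longrightarrow> weighted \<tau> r (t, y) = 0" by (simp add: weighted_def)
        have i: "integrable lborel (\<lambda>y. (weighted \<tau> r (t, y))^2)"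
          using borel_inH(1)[OF sm z] weighted_slice(1)[OF t(3)] t(1) by blast
        have "(\<integral>\<^sup>+y. ennreal ((weighted \<tau> r (t, y))^2) \<partial>lborel) = ennreal ((normH (\<lambda>y. weighted \<tau> r (t, y)))^2)"
          unfolding borel_inH(2)[OF sm z] by (rule nn_integral_eq_integral[OF i]) simp
        also have "(normH (\<lambda>y. weighted \<tau> r (t, y)))^2 = exp (- \<bar>t\<bar>) * (normH (r t))^2"
          unfolding weighted_slice(2)[OF t(3)] power_mult_distrib by (simp add: exp_double[symmetric])
        also have "ennreal \<dots> \<le> ennreal (R^2 * exp (- \<bar>t\<bar>))"
          using power_mono[OF t(2), of 2] by (intro ennreal_leI) (simp add: mult.commute)
        finally show ?thesis .
      next
        case False
        then have "t < \<tau>" using elim by simp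
        then show ?thesis by (simp add: weighted_def)
      qed
    qed
  qed
  finally have le: "(\<integral>\<^sup>+p. ennreal ((weighted \<tau> r p)^2) \<partial>(lborel \<Otimes>\<^sub>M lborel)) \<le> ennreal (R^2 * W)" unfolding W .
  have i: "integrable (lborel \<Otimes>\<^sub>M lborel) (\<lambda>p. (weighted \<tau> r p)^2)"
    by (rule integrableI_nonneg) (use le in \<open>auto simp: top_unique less_top[symmetric]\<close>)
  then show "L2 (lborel \<Otimes>\<^sub>M lborel) (weighted \<tau> r)" unfolding L2_def using weighted_measurable[OF r] by blast
  have "W \<ge> 0" unfolding W_def by simp
  have "ennreal (\<integral>p. (weighted \<tau> r p)^2 \<partial>(lborel \<Otimes>\<^sub>M lborel)) \<le> ennreal (R^2 * W)"
    using le by (subst (asm) nn_integral_eq_integral[OF i]) auto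
  then show "(\<integral>p. (weighted \<tau> r p)^2 \<partial>(lborel \<Otimes>\<^sub>M lborel)) \<le> R^2 * (\<integral>t. exp (- \<bar>t\<bar>) \<partial>lborel)"
    using \<open>W \<ge> 0\<close> unfolding W_def by (simp add: ennreal_le_iff)
qed

definition test_fun :: "real \<Rightarrow> real \<Rightarrow> nat \<Rightarrow> real \<times> real \<Rightarrow> real" where
  "test_fun a b k p = indicator ({a..b} \<times> {0..1}) p * (exp (\<bar>fst p\<bar> / 2) * sine k (snd p))"

lemma test_fun_L2: "L2 (lborel \<Otimes>\<^sub>M lborel) (test_fun a b k)"
proof -
  have [measurable]: "sine k \<in> borel_measurable borel"
    by (auto intro: borel_measurable_continuous_onI continuous_on_sine)
  have m: "test_fun a b k \<in> borel_measurable (lborel \<Otimes>\<^sub>M lborel)"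
    unfolding test_fun_def[abs_def] by measurable
  define c where "c = (exp (max \<bar>a\<bar> \<bar>b\<bar> / 2) * 2)^2"
  have "emeasure (lborel \<Otimes>\<^sub>M lborel) ({a..b} \<times> {0..1::real}) < \<infinity>"
    by (subst lborel.emeasure_pair_measure_Times) (auto simp: ennreal_mult_less_top emeasure_lborel_Icc_eq)
  then have "integrable (lborel \<Otimes>\<^sub>M lborel) (\<lambda>p. indicator ({a..b} \<times> {0..1::real}) p * c)"
    by (intro integrable_mult_left integrable_real_indicator) auto
  then have "integrable (lborel \<Otimes>\<^sub>M lborel) (\<lambda>p. (test_fun a b k p)^2)"
  proof (rule Bochner_Integration.integrable_bound)
    show "(\<lambda>p. (test_fun a b k p)^2) \<in> borel_measurable (lborel \<Otimes>\<^sub>M lborel)" using m by measurable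
    have "norm ((test_fun a b k p)^2) \<le> norm (indicator ({a..b} \<times> {0..1}) p * c)" for p
    proof (cases "p \<in> {a..b} \<times> {0..1}")
      case True
      then have "\<bar>fst p\<bar> \<le> max \<bar>a\<bar> \<bar>b\<bar>" by (auto simp: abs_le_iff)
      then have "\<bar>exp (\<bar>fst p\<bar> / 2) * sine k (snd p)\<bar> \<le> exp (max \<bar>a\<bar> \<bar>b\<bar> / 2) * 2"
        unfolding abs_mult by (intro mult_mono sine_bound) auto
      then have "(exp (\<bar>fst p\<bar> / 2) * sine k (snd p))^2 \<le> c"
        unfolding c_def by (metis abs_ge_zero power2_abs power_mono)
      then show ?thesis using True by (simp add: test_fun_def)
    qed (simp add: test_fun_def)
    then show "AE p in lborel \<Otimes>\<^sub>M lborel. norm ((test_fun a b k p)^2) \<le> norm (indicator ({a..b} \<times> {0..1}) p * c)" by simp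
  qed
  with m show ?thesis by (simp add: L2_def)
qed

lemma test_fun_pairing:
  assumes G: "L2 (lborel \<Otimes>\<^sub>M lborel) G" and z: "\<forall>t y. y \<notin> {0..1} \<longrightarrow> G (t, y) = 0"
  shows "(\<integral>p. G p * test_fun a b k p \<partial>(lborel \<Otimes>\<^sub>M lborel)) = integral {a..b} (\<lambda>t. exp (\<bar>t\<bar> / 2) * coef (\<lambda>y. G (t, y)) k)"
proof -
  have [measurable]: "G \<in> borel_measurable (lborel \<Otimes>\<^sub>M lborel)" using G by (simp add: L2_def)
  have i: "integrable (lborel \<Otimes>\<^sub>M lborel) (\<lambda>p. G p * test_fun a b k p)" by (rule L2_mult_integrable[OF G test_fun_L2])
  have s: "(\<integral>y. G (t, y) * test_fun a b k (t, y) \<partial>lborel) = indicator {a..b} t *\<^sub>R (exp (\<bar>t\<bar> / 2) * coef (\<lambda>y. G (t, y)) k)" for t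
  proof -
    have sm: "(\<lambda>y. G (t, y)) \<in> borel_measurable lborel" by measurable
    have "G (t, y) * test_fun a b k (t, y) = (indicator {a..b} t * exp (\<bar>t\<bar> / 2)) * (G (t, y) * sine k y)" for y
      using z by (auto simp: test_fun_def indicator_def)
    then have "(\<integral>y. G (t, y) * test_fun a b k (t, y) \<partial>lborel) = (\<integral>y. (indicator {a..b} t * exp (\<bar>t\<bar> / 2)) * (G (t, y) * sine k y) \<partial>lborel)"
      by (intro Bochner_Integration.integral_cong refl)
    also have "\<dots> = (indicator {a..b} t * exp (\<bar>t\<bar> / 2)) * (\<integral>y. G (t, y) * sine k y \<partial>lborel)"
      by (rule integral_mult_right_zero)
    finally show ?thesis unfolding borel_inH(3)[OF sm spec[OF z]] by simp
  qed
  have I: "integrable lborel (\<lambda>t. indicator {a..b} t *\<^sub>R (exp (\<bar>t\<bar> / 2) * coef (\<lambda>y. G (t, y)) k))"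
    using lborel_pair.integrable_fst'[OF i] unfolding s .
  have "(\<integral>p. G p * test_fun a b k p \<partial>(lborel \<Otimes>\<^sub>M lborel)) = (\<integral>t. indicator {a..b} t *\<^sub>R (exp (\<bar>t\<bar> / 2) * coef (\<lambda>y. G (t, y)) k) \<partial>lborel)"
    using lborel_pair.integral_fst'[OF i] unfolding s by simp
  also have "\<dots> = integral {a..b} (\<lambda>t. exp (\<bar>t\<bar> / 2) * coef (\<lambda>y. G (t, y)) k)"
    using set_borel_integral_eq_integral(2)[of "{a..b}" "\<lambda>t. exp (\<bar>t\<bar> / 2) * coef (\<lambda>y. G (t, y)) k"] I
    unfolding set_integrable_def set_lebesgue_integral_def by simp
  finally show ?thesis .
qed

section \<open>Compactness of bounded families of trajectories\<close>

lemma integral_const_Icc: "a \<le> b \<Longrightarrow> integral {a..b} (\<lambda>x. c) = (b - a) * (c :: real)"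
  unfolding integral_const_real by simp

lemma coef_lipschitz:
  assumes m: "mild \<tau> r u" and R: "AE t in lborel. t > \<tau> \<longrightarrow> inH (r t) \<and> normH (r t) \<le> R"
    and M: "\<And>t. t \<ge> \<tau> \<Longrightarrow> normH (u t) \<le> M" and st: "\<tau> \<le> s" "s \<le> t"
  shows "\<bar>coef (u t) k - coef (u s) k\<bar> \<le> (R + lam k * M) * (t - s)"
proof -
  define w where "w x = coef (r x) k - lam k * coef (u x) k" for x
  define c where "c = R + lam k * M"
  note D = mildD[OF m]
  have wi: "(w has_integral (coef (u t) k - coef (u s) k)) {s..t}"
    unfolding w_def by (rule D(3)[OF st])
  obtain N where N: "negligible N" "\<And>x. x \<notin> N \<Longrightarrow> x > \<tau> \<longrightarrow> inH (r x) \<and> normH (r x) \<le> R"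
    using AE_lborel_negligible[OF R] by blast
  have b: "\<bar>w x\<bar> \<le> c" if "x \<in> {s..t} - (N \<union> {\<tau>})" for x
  proof -
    have x: "x > \<tau>" "x \<notin> N" using that st by auto
    then have r: "inH (r x)" "normH (r x) \<le> R" using N(2) by auto
    have "\<bar>coef (r x) k\<bar> \<le> R" using coef_bound[of "r x" k] r by (simp add: inH_iff normH_eq)
    moreover have "\<bar>coef (u x) k\<bar> \<le> M" using coef_bound[of "u x" k] D(2)[of x] M[of x] x by (simp add: inH_iff normH_eq)
    then have "lam k * \<bar>coef (u x) k\<bar> \<le> lam k * M" using lam_pos[of k] by (intro mult_left_mono) (simp_all add: less_imp_le)
    moreover have "\<bar>w x\<bar> \<le> \<bar>coef (r x) k\<bar> + lam k * \<bar>coef (u x) k\<bar>"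
      unfolding w_def using abs_triangle_ineq4[of "coef (r x) k" "lam k * coef (u x) k"] lam_pos[of k] by (simp add: abs_mult)
    ultimately show ?thesis unfolding c_def by linarith
  qed
  have N': "negligible (N \<union> {\<tau>})" using N(1) by (intro negligible_Un) auto
  have ci: "(\<lambda>x. c') integrable_on {s..t}" for c' :: real by (rule integrable_const_ivl)
  have i: "w integrable_on {s..t}" using wi by (auto simp: integrable_on_def)
  have "integral {s..t} w \<le> integral {s..t} (\<lambda>x. c)"
    by (rule integral_le_spike[OF i ci N']) (use b in \<open>force simp: abs_le_iff\<close>)
  moreover have "integral {s..t} (\<lambda>x. - c) \<le> integral {s..t} w"
  proof (rule integral_le_spike[OF ci i N'])
    fix x assume "x \<in> {s..t} - (N \<union> {\<tau>})"
    then show "- c \<le> w x" using b[of x] by linarith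
  qed
  ultimately have "\<bar>integral {s..t} w\<bar> \<le> (t - s) * c"
    unfolding integral_const_Icc[OF st(2)] by (simp add: abs_le_iff)
  then show ?thesis using wi by (simp add: integral_unique c_def mult.commute)
qed

lemma mild_tail_le:
  assumes m: "mild \<tau> r u" and R: "AE t in lborel. t > \<tau> \<longrightarrow> inH (r t) \<and> normH (r t) \<le> R"
    and M: "\<And>t. t \<ge> \<tau> \<Longrightarrow> normH (u t) \<le> M" and t: "\<tau> \<le> t - 1"
  shows "real (Suc n) * ((normH (u t))^2 - (\<Sum>k<n. (coef (u t) k)^2)) \<le> M^2 + 2 * R^2"
proof -
  note D = mildD[OF m]
  have R0: "R \<ge> 0"
  proof -
    obtain N where N: "negligible N" "\<And>x. x \<notin> N \<Longrightarrow> x > \<tau> \<longrightarrow> inH (r x) \<and> normH (r x) \<le> R"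
      using AE_lborel_negligible[OF R] by blast
    have "\<not> {\<tau><..<\<tau>+1} \<subseteq> N"
      using N(1) negligible_subset[of N "{\<tau><..<\<tau>+1}"] open_not_negligible[of "{\<tau><..<\<tau>+1}"] by auto
    then obtain x where "x \<in> {\<tau><..<\<tau>+1}" "x \<notin> N" by blast
    then have "x > \<tau>" "x \<notin> N" by auto
    then show ?thesis using N(2)[of x] normH_nonneg[of "r x"] by linarith
  qed
  have Ht: "inH (u t)" using D(2) t by simp
  have "(normH (u (t - 1)))^2 \<le> M^2" using M[OF t] by (intro power_mono) auto
  moreover have "integral {t - 1..t} (\<lambda>t. (normH (r t))^2) \<le> R^2"
  proof -
    obtain N where N: "negligible N" "\<And>x. x \<notin> N \<Longrightarrow> x > \<tau> \<longrightarrow> inH (r x) \<and> normH (r x) \<le> R"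
      using AE_lborel_negligible[OF R] by blast
    have N': "negligible (N \<union> {\<tau>})" using N(1) by (intro negligible_Un) auto
    have "integral {t - 1..t} (\<lambda>t. (normH (r t))^2) \<le> integral {t - 1..t} (\<lambda>x. R^2)"
    proof (rule integral_le_spike[OF forcing_norm_integrable[OF D(1) t] integrable_const_ivl N'])
      fix x assume "x \<in> {t - 1..t} - (N \<union> {\<tau>})"
      then have "x > \<tau>" "x \<notin> N" using t by auto
      then show "(normH (r x))^2 \<le> R^2" using N(2)[of x] by (intro power_mono) auto
    qed simp
    then show ?thesis by (simp add: integral_const_Icc)
  qed
  ultimately have S: "(\<Sum>k<p. lam k * (coef (u t) k)^2) \<le> M^2 + 2 * R^2" for p
    using mild_smoothing[OF m t, of t p] by simp
  have "real (Suc n) * ((\<Sum>k<p. (coef (u t) k)^2) - (\<Sum>k<n. (coef (u t) k)^2)) \<le> M^2 + 2 * R^2" if np: "n \<le> p" for p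
  proof -
    have "(\<Sum>k<p. (coef (u t) k)^2) - (\<Sum>k<n. (coef (u t) k)^2) = (\<Sum>k\<in>{n..<p}. (coef (u t) k)^2)"
      using sum_diff_nat_ivl[of 0 n p "\<lambda>k. (coef (u t) k)^2"] np by (simp add: atLeast0LessThan)
    then have "real (Suc n) * ((\<Sum>k<p. (coef (u t) k)^2) - (\<Sum>k<n. (coef (u t) k)^2)) = (\<Sum>k\<in>{n..<p}. real (Suc n) * (coef (u t) k)^2)"
      by (simp only: sum_distrib_left)
    also have "\<dots> \<le> (\<Sum>k\<in>{n..<p}. lam k * (coef (u t) k)^2)"
    proof (intro sum_mono mult_right_mono)
      fix k assume "k \<in> {n..<p}"
      then have "real (Suc n) \<le> real (Suc k)" by simp
      then show "real (Suc n) \<le> lam k" using lam_ge_Suc[of k] by linarith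
    qed simp
    also have "\<dots> \<le> (\<Sum>k<p. lam k * (coef (u t) k)^2)"
      using lam_pos by (intro sum_mono2) (auto simp: less_imp_le)
    also have "\<dots> \<le> M^2 + 2 * R^2" by (rule S)
    finally show ?thesis .
  qed
  note le = this
  have "(\<lambda>p. real (Suc n) * ((\<Sum>k<p. (coef (u t) k)^2) - (\<Sum>k<n. (coef (u t) k)^2))) \<longlonglongrightarrow>
      real (Suc n) * ((normH (u t))^2 - (\<Sum>k<n. (coef (u t) k)^2))"
    using normH_sums[OF Ht] unfolding sums_def by (intro tendsto_intros)
  then show ?thesis by (rule LIMSEQ_le_const2) (use le in blast)
qed

lemma pointwise_limits:
  fixes \<tau> :: "nat \<Rightarrow> real"
  assumes \<tau>: "filterlim \<tau> at_bot sequentially"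
    and m: "\<And>n. mild (\<tau> n) (r n) (u n)"
    and R: "\<And>n. AE t in lborel. t > \<tau> n \<longrightarrow> inH (r n t) \<and> normH (r n t) \<le> R"
    and M: "\<And>n t. t \<ge> \<tau> n \<Longrightarrow> normH (u n t) \<le> M"
    and R0: "R \<ge> 0" and M0: "M \<ge> 0"
  obtains k :: "nat \<Rightarrow> nat" and \<phi> where "strict_mono k" "\<And>t. inH (\<phi> t)" "\<And>t. (\<lambda>n. distH (u (k n) t) (\<phi> t)) \<longlonglongrightarrow> 0"
proof -
  note D = mildD[OF m]
  define f where "f n = (\<lambda>(j, q). if \<tau> n \<le> q then coef (u n q) j else 0)" for n
  have cM: "\<bar>coef (u n t) j\<bar> \<le> M" if "\<tau> n \<le> t" for n t j
    using coef_bound[of "u n t" j] D(2)[OF that] M[OF that] by (simp add: inH_iff normH_eq)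
  have "countable ((UNIV :: nat set) \<times> (\<rat> :: real set))" by (simp add: countable_rat)
  moreover have "norm (f n x) \<le> M" for n x using cM M0 by (cases x) (auto simp: f_def)
  ultimately obtain k :: "nat \<Rightarrow> nat" where k: "strict_mono k"
    and kl: "\<And>x. x \<in> (UNIV :: nat set) \<times> (\<rat> :: real set) \<Longrightarrow> \<exists>l. (\<lambda>n. f (k n) x) \<longlonglongrightarrow> l"
    using function_convergent_subsequence[of "(UNIV :: nat set) \<times> (\<rat> :: real set)" f M] by blast
  have \<tau>k: "filterlim (\<lambda>n. \<tau> (k n)) at_bot sequentially"
    by (rule filterlim_compose[OF \<tau> filterlim_subseq[OF k]])
  have ev: "\<exists>n0. \<forall>n\<ge>n0. \<tau> (k n) \<le> t" for t
    using \<tau>k by (auto simp: filterlim_at_bot eventually_sequentially)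
  have "convergent (\<lambda>n. coef (u (k n) t) j)" for t j
  proof (rule real_Cauchy_convergent, rule CauchyI)
    fix e :: real assume e: "e > 0"
    define L where "L = R + lam j * M"
    have L: "L \<ge> 0" using R0 mult_nonneg_nonneg[OF less_imp_le[OF lam_pos[of j]] M0] by (simp add: L_def)
    define d where "d = e / (3 * (L + 1))"
    have d: "d > 0" using e L by (simp add: d_def)
    obtain q where q: "q \<in> \<rat>" "t < q" "q < t + d" using Rats_dense_in_real[of t "t + d"] d by auto
    have Lq: "L * (q - t) \<le> e / 3"
    proof -
      have "L * (q - t) \<le> (L + 1) * d" using L q by (intro mult_mono) auto
      also have "\<dots> = e / 3" using L by (simp add: d_def field_simps)
      finally show ?thesis .
    qed
    have "(j, q) \<in> UNIV \<times> \<rat>" using q by simp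
    then obtain l where "(\<lambda>n. f (k n) (j, q)) \<longlonglongrightarrow> l" using kl by blast
    then have "Cauchy (\<lambda>n. f (k n) (j, q))" by (rule LIMSEQ_imp_Cauchy)
    then obtain n1 where n1: "\<And>m n. m \<ge> n1 \<Longrightarrow> n \<ge> n1 \<Longrightarrow> \<bar>f (k m) (j, q) - f (k n) (j, q)\<bar> < e / 3"
      using e CauchyD[of "\<lambda>n. f (k n) (j, q)" "e / 3"] by auto
    obtain n2 where n2: "\<And>n. n \<ge> n2 \<Longrightarrow> \<tau> (k n) \<le> t" using ev by blast
    have "norm (coef (u (k m) t) j - coef (u (k n) t) j) < e" if mn: "m \<ge> max n1 n2" "n \<ge> max n1 n2" for m n
    proof -
      have \<tau>mn: "\<tau> (k m) \<le> t" "\<tau> (k n) \<le> t" using n2 mn by auto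
      have "\<bar>coef (u (k i) q) j - coef (u (k i) t) j\<bar> \<le> e / 3" if "\<tau> (k i) \<le> t" for i
        using coef_lipschitz[OF m R M that less_imp_le[OF q(2)], of j] Lq unfolding L_def by simp
      from this[OF \<tau>mn(1)] this[OF \<tau>mn(2)]
      have "\<bar>coef (u (k m) q) j - coef (u (k m) t) j\<bar> \<le> e / 3" "\<bar>coef (u (k n) q) j - coef (u (k n) t) j\<bar> \<le> e / 3" .
      moreover have "\<bar>coef (u (k m) q) j - coef (u (k n) q) j\<bar> < e / 3"
        using n1[of m n] mn \<tau>mn q by (simp add: f_def)
      ultimately show ?thesis unfolding real_norm_def by linarith
    qed
    then show "\<exists>M. \<forall>m\<ge>M. \<forall>n\<ge>M. norm (coef (u (k m) t) j - coef (u (k n) t) j) < e" by blast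
  qed
  then obtain c where c: "\<And>t j. (\<lambda>n. coef (u (k n) t) j) \<longlonglongrightarrow> c t j" unfolding convergent_def by metis
  have "\<exists>g. inH g \<and> (\<forall>j. coef g j = c t j)" for t
  proof -
    have "(\<Sum>j<p. (c t j)^2) \<le> M^2" for p
    proof (rule LIMSEQ_le_const2)
      show "(\<lambda>n. \<Sum>j<p. (coef (u (k n) t) j)^2) \<longlonglongrightarrow> (\<Sum>j<p. (c t j)^2)" by (intro tendsto_intros c)
      obtain n0 where n0: "\<And>n. n \<ge> n0 \<Longrightarrow> \<tau> (k n) \<le> t" using ev by blast
      have "(\<Sum>j<p. (coef (u (k n) t) j)^2) \<le> M^2" if "n \<ge> n0" for n
      proof -
        have "(\<Sum>j<p. (coef (u (k n) t) j)^2) \<le> (normH (u (k n) t))^2"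
          by (rule partial_sum_le_sums[OF normH_sums[OF D(2)[OF n0[OF that]]]]) simp
        also have "\<dots> \<le> M^2" by (intro power_mono M n0 that) simp
        finally show ?thesis .
      qed
      then show "\<exists>N. \<forall>n\<ge>N. (\<Sum>j<p. (coef (u (k n) t) j)^2) \<le> M^2" by blast
    qed
    then have "summable (\<lambda>j. (c t j)^2)" by (intro summableI_nonneg_bounded[of _ "M^2"]) auto
    then show ?thesis using inH_of_coef[of "c t"] by metis
  qed
  then obtain \<phi> where \<phi>: "\<And>t. inH (\<phi> t)" "\<And>t j. coef (\<phi> t) j = c t j" by metis
  have "(\<lambda>n. distH (u (k n) t) (\<phi> t)) \<longlonglongrightarrow> 0" for t
  proof (rule distH_tendsto_coef[OF _ \<phi>(1)])
    obtain n0 where n0: "\<And>n. n \<ge> n0 \<Longrightarrow> \<tau> (k n) \<le> t - 1" using ev by blast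
    have n0': "\<tau> (k n) \<le> t" if "n \<ge> n0" for n using n0[OF that] by simp
    show "\<forall>\<^sub>F n in sequentially. inH (u (k n) t)"
      using D(2) n0' by (auto simp: eventually_sequentially)
    show "(\<lambda>n. coef (u (k n) t) j) \<longlonglongrightarrow> coef (\<phi> t) j" for j using c \<phi>(2) by simp
    fix \<epsilon> :: real assume "\<epsilon> > 0"
    define S where "S = M^2 + 2 * R^2"
    obtain p0 :: nat where p0: "S < real p0 * \<epsilon>" using reals_Archimedean3[OF \<open>\<epsilon> > 0\<close>] by blast
    have "\<forall>\<^sub>F n in sequentially. (normH (u (k n) t))^2 - (\<Sum>j<p. (coef (u (k n) t) j)^2) \<le> \<epsilon>" if "p \<ge> p0" for p
    proof -
      have "(normH (u (k n) t))^2 - (\<Sum>j<p. (coef (u (k n) t) j)^2) \<le> \<epsilon>" if "n \<ge> n0" for n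
      proof -
        have "real (Suc p) * ((normH (u (k n) t))^2 - (\<Sum>j<p. (coef (u (k n) t) j)^2)) \<le> S"
          unfolding S_def by (rule mild_tail_le[OF m R M n0[OF that]])
        also have "\<dots> < real p0 * \<epsilon>" by (rule p0)
        also have "\<dots> \<le> real (Suc p) * \<epsilon>" using \<open>p \<ge> p0\<close> \<open>\<epsilon> > 0\<close> by (intro mult_right_mono) auto
        finally show ?thesis by (simp del: of_nat_Suc)
      qed
      then show ?thesis by (auto simp: eventually_sequentially)
    qed
    then show "\<exists>n0. \<forall>p\<ge>n0. \<forall>\<^sub>F n in sequentially. (normH (u (k n) t))^2 - (\<Sum>j<p. (coef (u (k n) t) j)^2) \<le> \<epsilon>" by blast
  qed
  then show ?thesis using that k \<phi>(1) by blast
qed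

lemma tail_weights_antimono: "tail_weights m N w \<Longrightarrow> n \<le> m \<Longrightarrow> tail_weights n N w"
  by (auto simp: tail_weights_def)

lemma weighted_zero: "\<forall>t y. y \<notin> {0..1} \<longrightarrow> weighted \<tau> r (t, y) = 0"
  by (simp add: weighted_def)

lemma forcing_unweighted:
  assumes g: "L2 (lborel \<Otimes>\<^sub>M lborel) g"
  shows "forcing s (\<lambda>t y. exp (\<bar>t\<bar> / 2) * g (t, y))"
  unfolding forcing_def
proof (intro allI impI conjI)
  fix T assume T: "s < T"
  have [measurable]: "g \<in> borel_measurable (lborel \<Otimes>\<^sub>M lborel)" and gi: "integrable (lborel \<Otimes>\<^sub>M lborel) (\<lambda>p. (g p)^2)"
    using g by (auto simp: L2_def)
  show "set_borel_measurable (lborel \<Otimes>\<^sub>M lborel) ({s..T} \<times> {0..1}) (\<lambda>p. exp (\<bar>fst p\<bar> / 2) * g (fst p, snd p))"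
    unfolding set_borel_measurable_def by measurable
  define c where "c = exp (max \<bar>s\<bar> \<bar>T\<bar>)"
  show "set_integrable (lborel \<Otimes>\<^sub>M lborel) ({s..T} \<times> {0..1}) (\<lambda>p. (exp (\<bar>fst p\<bar> / 2) * g (fst p, snd p))\<^sup>2)"
    unfolding set_integrable_def
  proof (rule Bochner_Integration.integrable_bound)
    show "integrable (lborel \<Otimes>\<^sub>M lborel) (\<lambda>p. c * (g p)^2)" using gi by simp
    show "(\<lambda>p. indicator ({s..T} \<times> {0..1}) p *\<^sub>R (exp (\<bar>fst p\<bar> / 2) * g (fst p, snd p))\<^sup>2) \<in> borel_measurable (lborel \<Otimes>\<^sub>M lborel)"
      by measurable
    have "norm (indicator ({s..T} \<times> {0..1}) p *\<^sub>R (exp (\<bar>fst p\<bar> / 2) * g (fst p, snd p))\<^sup>2) \<le> norm (c * (g p)^2)" for p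
    proof (cases "p \<in> {s..T} \<times> {0..1::real}")
      case True
      then have "exp \<bar>fst p\<bar> \<le> c" by (auto simp: c_def abs_le_iff)
      moreover have "(exp (\<bar>fst p\<bar> / 2) * g (fst p, snd p))\<^sup>2 = exp \<bar>fst p\<bar> * (g p)^2"
        by (simp add: power_mult_distrib exp_double[symmetric])
      ultimately show ?thesis using True by (simp add: mult_right_mono abs_mult c_def)
    qed (simp add: c_def)
    then show "AE p in lborel \<Otimes>\<^sub>M lborel. norm (indicator ({s..T} \<times> {0..1}) p *\<^sub>R (exp (\<bar>fst p\<bar> / 2) * g (fst p, snd p))\<^sup>2) \<le> norm (c * (g p)^2)"
      by simp
  qed
qed

text \<open>The coefficient equations pass to the limit because the pairings of the forcing terms with
  the test functions converge; strong convergence of convex combinations identifies their limit.\<close>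
lemma limit_trajectory:
  fixes \<tau> :: "nat \<Rightarrow> real"
  assumes \<tau>: "filterlim \<tau> at_bot sequentially"
    and m: "\<And>n. mild (\<tau> n) (r n) (u n)"
    and inc: "\<And>n. inclusion (\<tau> n) (\<sigma> n) (u n) (r n)"
    and R: "\<And>n. AE t in lborel. t > \<tau> n \<longrightarrow> inH (r n t) \<and> normH (r n t) \<le> R"
    and M: "\<And>n t. t \<ge> \<tau> n \<Longrightarrow> normH (u n t) \<le> M"
    and H\<phi>: "\<And>t. inH (\<phi> t)" and lim: "\<And>t. (\<lambda>n. distH (u n t) (\<phi> t)) \<longlonglongrightarrow> 0"
    and \<sigma>: "\<And>t. (\<lambda>n. \<sigma> n t) \<longlonglongrightarrow> \<sigma>' t"
    and pos: "\<And>t. fst (\<sigma>' t) > 0" "\<And>t. snd (\<sigma>' t) \<ge> 0"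
  shows "traj s \<sigma>' \<phi>"
proof -
  note D = mildD[OF m]
  let ?P = "lborel \<Otimes>\<^sub>M lborel :: (real \<times> real) measure"
  define G where "G n = weighted (\<tau> n) (r n)" for n
  have LG: "L2 ?P (G n)" for n unfolding G_def by (rule weighted_L2(1)[OF D(1) R])
  have bG: "(\<integral>p. (G n p)^2 \<partial>?P) \<le> R^2 * (\<integral>t. exp (- \<bar>t\<bar>) \<partial>lborel)" for n
    unfolding G_def by (rule weighted_L2(2)[OF D(1) R])
  obtain w N g0 where w: "\<And>n. tail_weights n (N n) (w n)" and g0: "L2 ?P g0"
    and lg0: "(\<lambda>n. \<integral>p. ((\<Sum>i<N n. w n i * G i p) - g0 p)^2 \<partial>?P) \<longlonglongrightarrow> 0"
    by (rule convex_tails_convergent[OF LG bG]) (rule that)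
  define g where "g p = indicator (UNIV \<times> {0..1}) p * g0 p" for p :: "real \<times> real"
  have gz: "\<forall>t y. y \<notin> {0..1} \<longrightarrow> g (t, y) = 0" by (simp add: g_def)
  have gm: "g \<in> borel_measurable ?P"
  proof -
    have [measurable]: "g0 \<in> borel_measurable ?P" using g0 by (simp add: L2_def)
    show ?thesis unfolding g_def[abs_def] by measurable
  qed
  have Lg: "L2 ?P g"
    unfolding L2_def
  proof (intro conjI gm Bochner_Integration.integrable_bound[OF L2_sq_integrable[OF g0]])
    show "(\<lambda>p. (g p)^2) \<in> borel_measurable ?P" using gm by measurable
    show "AE p in ?P. norm ((g p)^2) \<le> norm ((g0 p)^2)" by (auto simp: g_def indicator_def)
  qed
  define S where "S n p = (\<Sum>i<N n. w n i * G i p)" for n p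
  have LS: "L2 ?P (S n)" for n unfolding S_def[abs_def] by (intro L2_sum L2_cmult LG)
  have Sz: "S n (t, y) = 0" if "y \<notin> {0..1}" for n t y
    using that unfolding S_def G_def by (simp add: weighted_def)
  have lg: "(\<lambda>n. \<integral>p. (S n p - g p)^2 \<partial>?P) \<longlonglongrightarrow> 0"
  proof (rule Lim_null_comparison[OF _ lg0[folded S_def]])
    have "(\<integral>p. (S n p - g p)^2 \<partial>?P) \<le> (\<integral>p. (S n p - g0 p)^2 \<partial>?P)" for n
    proof (intro integral_mono L2_sq_integrable L2_diff LS Lg g0)
      fix p :: "real \<times> real"
      show "(S n p - g p)\<^sup>2 \<le> (S n p - g0 p)\<^sup>2"
        using Sz[of "snd p" n "fst p"] by (cases "snd p \<in> {0..1}") (auto simp: g_def indicator_def mem_Times_iff)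
    qed
    then show "\<forall>\<^sub>F n in sequentially. norm (\<integral>p. (S n p - g p)^2 \<partial>?P) \<le> (\<integral>p. (S n p - g0 p)^2 \<partial>?P)" by simp
  qed
  define r' where "r' t y = exp (\<bar>t\<bar> / 2) * g (t, y)" for t y
  have f: "forcing s r'" for s unfolding r'_def[abs_def] by (rule forcing_unweighted[OF Lg])
  have cr': "coef (r' t) k = exp (\<bar>t\<bar> / 2) * coef (\<lambda>y. g (t, y)) k" for t k
    unfolding r'_def[abs_def] by (rule coef_cmult)
  have cl: "(\<lambda>n. coef (u n t) k) \<longlonglongrightarrow> coef (\<phi> t) k" for t k
  proof (rule LIM_zero_cancel, rule Lim_null_comparison[OF _ lim])
    have "\<forall>\<^sub>F n in sequentially. \<tau> n \<le> t" using \<tau> by (simp add: filterlim_at_bot)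
    then show "\<forall>\<^sub>F n in sequentially. norm (coef (u n t) k - coef (\<phi> t) k) \<le> distH (u n t) (\<phi> t)"
      by eventually_elim (use distH_coef_le D(2) H\<phi> in auto)
  qed
  have ode: "((\<lambda>x. coef (r' x) k - lam k * coef (\<phi> x) k) has_integral (coef (\<phi> b) k - coef (\<phi> a) k)) {a..b}"
    if ab: "a \<le> b" for a b k
  proof -
    define X where "X i = (\<integral>p. G i p * test_fun a b k p \<partial>?P)" for i
    obtain n0 where n0: "\<And>n. n \<ge> n0 \<Longrightarrow> \<tau> n \<le> a"
      using \<tau> by (auto simp: filterlim_at_bot eventually_sequentially)
    have cU: "continuous_on {a..b} (\<lambda>t. coef (u n t) k)" if "n \<ge> n0" for n
      by (rule mild_continuous_coef[OF m n0[OF that] ab])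
    have dc: "(\<lambda>t. coef (\<phi> t) k) integrable_on {a..b}"
      "(\<lambda>n. integral {a..b} (\<lambda>t. coef (u (n + n0) t) k)) \<longlonglongrightarrow> integral {a..b} (\<lambda>t. coef (\<phi> t) k)"
    proof -
      have 1: "(\<lambda>t. coef (u (n + n0) t) k) integrable_on {a..b}" for n
        by (intro integrable_continuous_interval cU) simp
      have 2: "norm (coef (u (n + n0) t) k) \<le> M" if "t \<in> {a..b}" for n t
      proof -
        have "\<tau> (n + n0) \<le> t" using n0[of "n + n0"] that by auto
        then show ?thesis using coef_bound[of "u (n + n0) t" k] D(2) M by (fastforce simp: inH_iff normH_eq)
      qed
      have 3: "(\<lambda>n. coef (u (n + n0) t) k) \<longlonglongrightarrow> coef (\<phi> t) k" for t by (rule LIMSEQ_ignore_initial_segment[OF cl])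
      show "(\<lambda>t. coef (\<phi> t) k) integrable_on {a..b}"
        "(\<lambda>n. integral {a..b} (\<lambda>t. coef (u (n + n0) t) k)) \<longlonglongrightarrow> integral {a..b} (\<lambda>t. coef (\<phi> t) k)"
        using dominated_convergence[OF 1 integrable_const_ivl 2 3] by blast+
    qed
    have Xe: "X i = (coef (u i b) k - coef (u i a) k) + lam k * integral {a..b} (\<lambda>t. coef (u i t) k)" if i: "i \<ge> n0" for i
    proof -
      have "X i = integral {a..b} (\<lambda>t. exp (\<bar>t\<bar> / 2) * coef (\<lambda>y. G i (t, y)) k)"
        unfolding X_def by (rule test_fun_pairing[OF LG]) (unfold G_def, rule weighted_zero)
      also have "\<dots> = integral {a..b} (\<lambda>t. coef (r i t) k)"
      proof (rule integral_cong)
        fix t assume "t \<in> {a..b}"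
        then have "\<tau> i \<le> t" using n0[OF i] by auto
        then show "exp (\<bar>t\<bar> / 2) * coef (\<lambda>y. G i (t, y)) k = coef (r i t) k"
          unfolding G_def by (simp add: weighted_slice(3) mult.assoc[symmetric] exp_add[symmetric])
      qed
      finally have Xi: "X i = integral {a..b} (\<lambda>t. coef (r i t) k)" .
      have "((\<lambda>t. (coef (r i t) k - lam k * coef (u i t) k) + lam k * coef (u i t) k) has_integral
         (coef (u i b) k - coef (u i a) k) + lam k * integral {a..b} (\<lambda>t. coef (u i t) k)) {a..b}"
        by (intro has_integral_add has_integral_mult_right D(3)[OF n0[OF i] ab] integrable_integral
            integrable_continuous_interval cU i)
      then show ?thesis unfolding Xi by (simp add: integral_unique)
    qed
    define X' where "X' = (coef (\<phi> b) k - coef (\<phi> a) k) + lam k * integral {a..b} (\<lambda>t. coef (\<phi> t) k)"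
    have "(\<lambda>n. X (n + n0)) \<longlonglongrightarrow> X'"
    proof -
      have "(\<lambda>n. (coef (u (n + n0) b) k - coef (u (n + n0) a) k) + lam k * integral {a..b} (\<lambda>t. coef (u (n + n0) t) k)) \<longlonglongrightarrow> X'"
        unfolding X'_def by (intro tendsto_intros LIMSEQ_ignore_initial_segment[OF cl] dc(2))
      then show ?thesis by (simp add: Xe)
    qed
    then have "X \<longlonglongrightarrow> X'" by (rule LIMSEQ_offset)
    then have 1: "(\<lambda>n. \<Sum>i<N n. w n i * X i) \<longlonglongrightarrow> X'" by (rule tail_weights_tendsto[OF w])
    have SX: "(\<Sum>i<N n. w n i * X i) = (\<integral>p. S n p * test_fun a b k p \<partial>?P)" for n
    proof -
      have "(\<integral>p. S n p * test_fun a b k p \<partial>?P) = (\<integral>p. (\<Sum>i<N n. w n i * (G i p * test_fun a b k p)) \<partial>?P)"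
        unfolding S_def sum_distrib_right by (simp add: mult.assoc)
      also have "\<dots> = (\<Sum>i<N n. w n i * X i)"
        unfolding X_def using L2_mult_integrable[OF LG test_fun_L2] by (simp add: Bochner_Integration.integral_sum)
      finally show ?thesis by simp
    qed
    have 2: "(\<lambda>n. \<integral>p. S n p * test_fun a b k p \<partial>?P) \<longlonglongrightarrow> (\<integral>p. g p * test_fun a b k p \<partial>?P)"
    proof (rule LIM_zero_cancel, rule Lim_null_comparison)
      have "(\<lambda>n. nrm ?P (\<lambda>p. S n p - g p)) \<longlonglongrightarrow> sqrt 0"
        unfolding nrm_def by (intro tendsto_real_sqrt lg)
      then have "(\<lambda>n. nrm ?P (\<lambda>p. S n p - g p) * nrm ?P (test_fun a b k)) \<longlonglongrightarrow> sqrt 0 * nrm ?P (test_fun a b k)"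
        by (intro tendsto_intros)
      then show "(\<lambda>n. nrm ?P (\<lambda>p. S n p - g p) * nrm ?P (test_fun a b k)) \<longlonglongrightarrow> 0" by simp
      have "\<bar>(\<integral>p. S n p * test_fun a b k p \<partial>?P) - (\<integral>p. g p * test_fun a b k p \<partial>?P)\<bar>
          \<le> nrm ?P (\<lambda>p. S n p - g p) * nrm ?P (test_fun a b k)" for n
        using L2_Cauchy_Schwarz[OF L2_diff[OF LS Lg] test_fun_L2, of n a b k]
          L2_mult_integrable[OF LS test_fun_L2] L2_mult_integrable[OF Lg test_fun_L2]
        by (simp add: left_diff_distrib)
      then show "\<forall>\<^sub>F n in sequentially. norm ((\<integral>p. S n p * test_fun a b k p \<partial>?P) - (\<integral>p. g p * test_fun a b k p \<partial>?P))
          \<le> nrm ?P (\<lambda>p. S n p - g p) * nrm ?P (test_fun a b k)" by simp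
    qed
    have "(\<integral>p. g p * test_fun a b k p \<partial>?P) = X'" using LIMSEQ_unique[OF 2 1[unfolded SX]] .
    moreover have "(\<integral>p. g p * test_fun a b k p \<partial>?P) = integral {a..b} (\<lambda>t. coef (r' t) k)"
      unfolding cr' by (rule test_fun_pairing[OF Lg gz])
    moreover have "(\<lambda>t. coef (r' t) k) integrable_on {a..b}"
      by (rule L2_on_integrable(2)[OF forcing_L2[OF f order.refl ab]])
    ultimately have "((\<lambda>t. coef (r' t) k) has_integral X') {a..b}" by (simp add: has_integral_iff)
    from has_integral_diff[OF this has_integral_mult_right[OF integrable_integral[OF dc(1)], of "lam k"]]
    show ?thesis by (simp add: X'_def)
  qed
  have mild': "mild s r' \<phi>" unfolding mild_def using f H\<phi> ode by blast
  have "inclusion s \<sigma>' \<phi> r'"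
  proof -
    define A where "A n t = (normH (\<lambda>y. S n (t, y) - g (t, y)))^2" for n t
    have SL: "L2 ?P (\<lambda>p. S n p - g p)" and Sgz: "\<forall>t y. y \<notin> {0..1} \<longrightarrow> S n (t, y) - g (t, y) = 0" for n
      using LS Lg Sz gz by (auto intro: L2_diff)
    have Ai: "integrable lborel (A n)" for n unfolding A_def by (rule slices(2)[OF SL Sgz])
    have "(\<integral>t. norm (A n t) \<partial>lborel) = (\<integral>p. (S n p - g p)^2 \<partial>?P)" for n
      using slices(3)[OF SL Sgz, of n] by (simp add: A_def)
    then have "(\<lambda>n. \<integral>t. norm (A n t) \<partial>lborel) \<longlonglongrightarrow> 0" using lg by simp
    from tendsto_L1_AE_subseq[OF Ai this] obtain q :: "nat \<Rightarrow> nat"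
      where q: "strict_mono q" "AE t in lborel. (\<lambda>n. A (q n) t) \<longlonglongrightarrow> 0" by blast
    have all: "AE t in lborel. \<forall>i. t > \<tau> i \<longrightarrow> (inH (r i t) \<and> normH (r i t) \<le> R) \<and>
       (AE y in lebesgue. y \<in> {0..1} \<longrightarrow> (\<exists>h\<in>H0 (u i t y). r i t y = fst (\<sigma> i t) * h + snd (\<sigma> i t) * u i t y))"
    proof (subst AE_all_countable, intro allI)
      fix i
      show "AE t in lborel. t > \<tau> i \<longrightarrow> (inH (r i t) \<and> normH (r i t) \<le> R) \<and>
       (AE y in lebesgue. y \<in> {0..1} \<longrightarrow> (\<exists>h\<in>H0 (u i t y). r i t y = fst (\<sigma> i t) * h + snd (\<sigma> i t) * u i t y))"
        using R[of i] inc[of i, unfolded inclusion_def] by eventually_elim blast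
    qed
    show ?thesis
      unfolding inclusion_def using q(2) all slices(1)[OF Lg gz]
    proof eventually_elim
      case (elim t)
      have "\<forall>\<^sub>F n in sequentially. \<tau> n \<le> t - 1" using \<tau> by (simp add: filterlim_at_bot)
      then obtain n0 where "\<And>n. n \<ge> n0 \<Longrightarrow> \<tau> n \<le> t - 1" by (auto simp: eventually_sequentially)
      then have n0: "\<tau> n < t" if "n \<ge> n0" for n using that by fastforce
      define j where "j i = max i n0" for i :: nat
      have \<tau>j: "\<tau> (j i) < t" for i by (intro n0) (simp add: j_def)
      have jinf: "filterlim j sequentially sequentially"
        by (rule filterlim_at_top_mono[OF filterlim_ident]) (simp add: j_def)
      have Hr: "inH (r' t)" unfolding r'_def[abs_def] using elim(3) by (simp add: inH_iff L2_cmult)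
      have Hrj: "inH (r (j i) t)" for i using elim(2) \<tau>j by blast
      have incj: "AE y in I01. \<exists>h\<in>H0 (u (j i) t y). r (j i) t y = fst (\<sigma> (j i) t) * h + snd (\<sigma> (j i) t) * u (j i) t y" for i
      proof -
        have "AE y in lebesgue. y \<in> {0..1} \<longrightarrow> (\<exists>h\<in>H0 (u (j i) t y). r (j i) t y = fst (\<sigma> (j i) t) * h + snd (\<sigma> (j i) t) * u (j i) t y)"
          using elim(2) \<tau>j by blast
        then show ?thesis by (subst AE_restrict_space_iff) simp_all
      qed
      have \<sigma>j: "(\<lambda>i. \<sigma> (j i) t) \<longlonglongrightarrow> \<sigma>' t" by (rule filterlim_compose[OF \<sigma> jinf])
      have uj: "(\<lambda>i. distH (u (j i) t) (\<phi> t)) \<longlonglongrightarrow> 0" by (rule filterlim_compose[OF lim jinf])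
      define Q where "Q n = q (n + n0)" for n
      have Qn: "n + n0 \<le> Q n" for n unfolding Q_def by (rule seq_suble[OF q(1)])
      have wQ: "tail_weights n (N (Q n)) (w (Q n))" for n
        by (rule tail_weights_antimono[OF w]) (use Qn[of n] in simp)
      have eq: "S (Q n) (t, y) - g (t, y) = exp (- \<bar>t\<bar> / 2) * ((\<Sum>i<N (Q n). w (Q n) i * r (j i) t y) - r' t y)"
        if y: "y \<in> {0..1}" for n y
      proof -
        have "w (Q n) i * G i (t, y) = exp (- \<bar>t\<bar> / 2) * (w (Q n) i * r (j i) t y)" for i
        proof (cases "i < Q n")
          case True
          then show ?thesis using w[of "Q n"] by (simp add: tail_weights_def)
        next
          case False
          then have "j i = i" "\<tau> i < t" using Qn[of n] n0[of i] by (auto simp: j_def max_def)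
          then show ?thesis using y by (simp add: G_def weighted_def)
        qed
        then have "S (Q n) (t, y) = exp (- \<bar>t\<bar> / 2) * (\<Sum>i<N (Q n). w (Q n) i * r (j i) t y)"
          unfolding S_def sum_distrib_left by (rule sum.cong[OF refl])
        moreover have "g (t, y) = exp (- \<bar>t\<bar> / 2) * r' t y"
          by (simp add: r'_def mult.assoc[symmetric] exp_add[symmetric])
        ultimately show ?thesis by (simp add: right_diff_distrib)
      qed
      have "distH (\<lambda>y. \<Sum>i<N (Q n). w (Q n) i * r (j i) t y) (r' t) = exp (\<bar>t\<bar> / 2) * sqrt (A (Q n) t)" for n
      proof -
        have "sqrt (A (Q n) t) = normH (\<lambda>y. S (Q n) (t, y) - g (t, y))" by (simp add: A_def)
        also have "\<dots> = normH (\<lambda>y. exp (- \<bar>t\<bar> / 2) * ((\<Sum>i<N (Q n). w (Q n) i * r (j i) t y) - r' t y))"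
          by (rule inH_cong(2)) (rule eq)
        also have "\<dots> = exp (- \<bar>t\<bar> / 2) * distH (\<lambda>y. \<Sum>i<N (Q n). w (Q n) i * r (j i) t y) (r' t)"
          by (simp add: normH_eq nrm_cmult distH_eq)
        finally show ?thesis by (simp add: mult.assoc[symmetric] exp_add[symmetric])
      qed
      moreover have "(\<lambda>n. exp (\<bar>t\<bar> / 2) * sqrt (A (Q n) t)) \<longlonglongrightarrow> exp (\<bar>t\<bar> / 2) * sqrt 0"
        unfolding Q_def by (intro tendsto_intros LIMSEQ_ignore_initial_segment[OF elim(1)])
      ultimately have lQ: "(\<lambda>n. distH (\<lambda>y. \<Sum>i<N (Q n). w (Q n) i * r (j i) t y) (r' t)) \<longlonglongrightarrow> 0" by simp
      have "AE y in I01. \<exists>h\<in>H0 (\<phi> t y). r' t y = fst (\<sigma>' t) * h + snd (\<sigma>' t) * \<phi> t y"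
        by (rule inclusion_limit[OF _ Hrj H\<phi> Hr incj tendsto_fst[OF \<sigma>j] pos(1) tendsto_snd[OF \<sigma>j] pos(2) uj wQ lQ])
          (use D(2) \<tau>j in \<open>simp add: less_imp_le\<close>)
      then have "AE y in lebesgue. y \<in> {0..1} \<longrightarrow> (\<exists>h\<in>H0 (\<phi> t y). r' t y = fst (\<sigma>' t) * h + snd (\<sigma>' t) * \<phi> t y)"
        by (subst (asm) AE_restrict_space_iff) simp_all
      then show ?case by blast
    qed
  qed
  with mild' show ?thesis by (auto simp: traj_def)
qed

section \<open>Complete bounded trajectories\<close>

definition ctraj :: "(real \<Rightarrow> real \<times> real) \<Rightarrow> (real \<Rightarrow> real \<Rightarrow> real) \<Rightarrow> bool" where
  "ctraj \<sigma> \<phi> \<longleftrightarrow> (\<forall>s. traj s \<sigma> \<phi>) \<and> (\<exists>C. \<forall>t. (normH (\<phi> t))^2 \<le> C)"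

lemma traj_inH: "traj \<tau> \<sigma> u \<Longrightarrow> t \<ge> \<tau> \<Longrightarrow> inH (u t)"
  using mildD(2) by (auto simp: traj_def)

lemma ctraj_inH: "ctraj \<sigma> \<phi> \<Longrightarrow> inH (\<phi> t)"
  using traj_inH[of t] by (auto simp: ctraj_def)

context coefficient_bounds
begin

theorem trajectories_compact:
  fixes \<tau> :: "nat \<Rightarrow> real"
  assumes \<tau>: "filterlim \<tau> at_bot sequentially"
    and u: "\<And>n. traj (\<tau> n) (\<sigma> n) (u n)"
    and a: "\<And>n. adm (\<sigma> n)" and \<sigma>: "\<And>t. (\<lambda>n. \<sigma> n t) \<longlonglongrightarrow> \<sigma>' t"
    and C: "\<And>n t. t \<ge> \<tau> n \<Longrightarrow> (normH (u n t))^2 \<le> C"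
  obtains k :: "nat \<Rightarrow> nat" and \<phi> where "strict_mono k" "ctraj \<sigma>' \<phi>" "\<And>t. (\<lambda>n. distH (u (k n) t) (\<phi> t)) \<longlonglongrightarrow> 0"
proof -
  obtain r where r: "\<And>n. mild (\<tau> n) (r n) (u n)" "\<And>n. inclusion (\<tau> n) (\<sigma> n) (u n) (r n)"
    using u unfolding traj_def by metis
  define M where "M = sqrt C"
  have M: "normH (u n t) \<le> M" if "t \<ge> \<tau> n" for n t
    unfolding M_def by (rule real_le_rsqrt[OF C[OF that]])
  have M0: "M \<ge> 0" using M[of 0 "\<tau> 0"] normH_nonneg[of "u 0 (\<tau> 0)"] by linarith
  define R where "R = b1 + w1 * M"
  have R0: "R \<ge> 0" using b1_pos w1 M0 by (simp add: R_def)
  have R: "AE t in lborel. t > \<tau> n \<longrightarrow> inH (r n t) \<and> normH (r n t) \<le> R" for n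
    using forcing_bound[OF r(1)[of n] r(2) a]
  proof eventually_elim
    case (elim t)
    show ?case
    proof
      assume t: "t > \<tau> n"
      then have "w1 * normH (u n t) \<le> w1 * M" using w1 by (intro mult_left_mono M) auto
      then show "inH (r n t) \<and> normH (r n t) \<le> R" using elim t by (simp add: R_def)
    qed
  qed
  obtain k :: "nat \<Rightarrow> nat" and \<phi> where k: "strict_mono k" "\<And>t. inH (\<phi> t)" "\<And>t. (\<lambda>n. distH (u (k n) t) (\<phi> t)) \<longlonglongrightarrow> 0"
    using pointwise_limits[OF \<tau> r(1) R M R0 M0] by blast
  have \<tau>k: "filterlim (\<lambda>n. \<tau> (k n)) at_bot sequentially"
    by (rule filterlim_compose[OF \<tau> filterlim_subseq[OF k(1)]])
  have \<sigma>k: "(\<lambda>n. \<sigma> (k n) t) \<longlonglongrightarrow> \<sigma>' t" for t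
    by (rule filterlim_compose[OF \<sigma> filterlim_subseq[OF k(1)]])
  have "b0 \<le> fst (\<sigma>' t)" for t
    by (rule LIMSEQ_le_const[OF tendsto_fst[OF \<sigma>]]) (use a in \<open>auto simp: adm_def\<close>)
  then have p1: "fst (\<sigma>' t) > 0" for t using b0 by (meson less_le_trans)
  have p2: "snd (\<sigma>' t) \<ge> 0" for t
    by (rule LIMSEQ_le_const[OF tendsto_snd[OF \<sigma>]]) (use a in \<open>auto simp: adm_def\<close>)
  have "traj s \<sigma>' \<phi>" for s
    by (rule limit_trajectory[OF \<tau>k r(1) r(2) R M k(2,3) \<sigma>k p1 p2])
  moreover have "normH (\<phi> t) \<le> M" for t
  proof -
    have "(\<lambda>n. M + distH (u (k n) t) (\<phi> t)) \<longlonglongrightarrow> M + 0" by (intro tendsto_intros k(3))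
    moreover have "\<forall>\<^sub>F n in sequentially. \<tau> (k n) \<le> t" using \<tau>k by (simp add: filterlim_at_bot)
    then have "\<forall>\<^sub>F n in sequentially. normH (\<phi> t) \<le> M + distH (u (k n) t) (\<phi> t)"
    proof eventually_elim
      case (elim n)
      have L: "L2 I01 (u (k n) t)" "L2 I01 (\<phi> t)" using traj_inH[OF u elim] k(2) by (simp_all add: inH_iff)
      show ?case
        using nrm_triangle[OF L(1) L2_diff[OF L(2,1)]] M[OF elim] nrm_minus_commute[of I01 "u (k n) t" "\<phi> t"]
        by (simp add: normH_eq distH_eq)
    qed
    ultimately have "normH (\<phi> t) \<le> M + 0" by (intro tendsto_lowerbound[OF _ _ sequentially_bot]) auto
    then show ?thesis by simp
  qed
  then have "(normH (\<phi> t))^2 \<le> M^2" for t by (intro power_mono) auto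
  ultimately have "ctraj \<sigma>' \<phi>" unfolding ctraj_def by blast
  with k that show ?thesis by blast
qed

lemma ctraj_normH_le:
  assumes c: "ctraj \<sigma> \<phi>" and a: "adm \<sigma>"
  shows "(normH (\<phi> t))^2 \<le> K"
proof -
  obtain C where C: "\<And>t. (normH (\<phi> t))^2 \<le> C" using c by (auto simp: ctraj_def)
  have "(normH (\<phi> t))^2 \<le> exp (- \<delta> * real n) * C + K" for n
  proof -
    have "(normH (\<phi> t))^2 \<le> exp (- \<delta> * (t - (t - real n))) * (normH (\<phi> (t - real n)))^2 + K"
      using c by (intro energy_decay[OF _ a order.refl]) (auto simp: ctraj_def)
    also have "\<dots> \<le> exp (- \<delta> * real n) * C + K" by (simp add: C)
    finally show ?thesis .
  qed
  moreover have "(\<lambda>n. exp (- \<delta> * real n) * C + K) \<longlonglongrightarrow> 0 * C + K"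
  proof (intro tendsto_intros)
    have "(\<lambda>n. exp (- \<delta>) ^ n) \<longlonglongrightarrow> 0" using \<delta>_pos by (intro LIMSEQ_realpow_zero) auto
    then show "(\<lambda>n. exp (- \<delta> * real n)) \<longlonglongrightarrow> 0" by (simp add: exp_of_nat_mult[symmetric] mult.commute)
  qed
  ultimately show ?thesis using LIMSEQ_le_const[of "\<lambda>n. exp (- \<delta> * real n) * C + K" "0 * C + K"] by auto
qed

end

section \<open>The metric of locally uniform convergence\<close>

definition rho_term :: "(real \<Rightarrow> real \<times> real) \<Rightarrow> (real \<Rightarrow> real \<times> real) \<Rightarrow> nat \<Rightarrow> real" where
  "rho_term f g n = (1/2)^(Suc n) * min 1 (SUP t\<in>{- real (Suc n)..real (Suc n)}. norm (f t - g t))"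

lemma rho_eq: "rho f g = (\<Sum>n. rho_term f g n)"
  by (simp add: rho_def rho_term_def)

lemma bdd_above_norm_diff:
  fixes f g :: "real \<Rightarrow> real \<times> real"
  assumes "continuous_on UNIV f" "continuous_on UNIV g"
  shows "bdd_above ((\<lambda>t. norm (f t - g t)) ` {a..b})"
proof -
  have "continuous_on {a..b} (\<lambda>t. norm (f t - g t))"
    by (intro continuous_intros continuous_on_subset[OF assms(1)] continuous_on_subset[OF assms(2)]) auto
  then have "compact ((\<lambda>t. norm (f t - g t)) ` {a..b})" by (rule compact_continuous_image) simp
  then show ?thesis by (intro bounded_imp_bdd_above compact_imp_bounded)
qed

lemma norm_le_SUP:
  fixes f g :: "real \<Rightarrow> real \<times> real"
  assumes "continuous_on UNIV f" "continuous_on UNIV g" "t \<in> {- real (Suc n)..real (Suc n)}"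
  shows "norm (f t - g t) \<le> (SUP t\<in>{- real (Suc n)..real (Suc n)}. norm (f t - g t))"
  by (rule cSUP_upper[OF assms(3) bdd_above_norm_diff[OF assms(1,2)]])

lemma rho_term_bounds:
  assumes "continuous_on UNIV f" "continuous_on UNIV g"
  shows "0 \<le> rho_term f g n" "rho_term f g n \<le> (1/2)^(Suc n)"
proof -
  have "0 \<le> (SUP t\<in>{- real (Suc n)..real (Suc n)}. norm (f t - g t))"
    by (rule order.trans[OF norm_ge_zero norm_le_SUP[OF assms, of 0 n]]) simp
  then show "0 \<le> rho_term f g n" unfolding rho_term_def by (intro mult_nonneg_nonneg) auto
  have "(1/2)^(Suc n) * min 1 (SUP t\<in>{- real (Suc n)..real (Suc n)}. norm (f t - g t)) \<le> (1/2)^(Suc n) * 1"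
    by (intro mult_left_mono) auto
  then show "rho_term f g n \<le> (1/2)^(Suc n)" by (simp add: rho_term_def)
qed

lemma summable_half: "summable (\<lambda>n. (1/2::real)^(Suc n))"
  using summable_mult[OF summable_geometric[of "1/2::real"], of "1/2"] by simp

lemma rho_summable:
  assumes "continuous_on UNIV f" "continuous_on UNIV g" shows "summable (rho_term f g)"
  by (rule summable_comparison_test'[OF summable_half, of 0]) (use rho_term_bounds[OF assms] in auto)

lemma rho_nonneg: "continuous_on UNIV f \<Longrightarrow> continuous_on UNIV g \<Longrightarrow> 0 \<le> rho f g"
  unfolding rho_eq by (intro suminf_nonneg rho_summable rho_term_bounds)

lemma rho_commute: "rho f g = rho g f"
  unfolding rho_def by (simp add: norm_minus_commute)

lemma rho_triangle:
  assumes f: "continuous_on UNIV f" and g: "continuous_on UNIV g" and h: "continuous_on UNIV h"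
  shows "rho f h \<le> rho f g + rho g h"
proof -
  have "rho_term f h n \<le> rho_term f g n + rho_term g h n" for n
  proof -
    define S where "S p q = (SUP t\<in>{- real (Suc n)..real (Suc n)}. norm (p t - q t))" for p q :: "real \<Rightarrow> real \<times> real"
    have "S f h \<le> S f g + S g h"
      unfolding S_def[of f h]
    proof (rule cSUP_least)
      fix t assume t: "t \<in> {- real (Suc n)..real (Suc n)}"
      have "norm (f t - h t) \<le> norm (f t - g t) + norm (g t - h t)" using norm_triangle_ineq[of "f t - g t" "g t - h t"] by simp
      also have "\<dots> \<le> S f g + S g h" unfolding S_def by (intro add_mono norm_le_SUP f g h t)
      finally show "norm (f t - h t) \<le> S f g + S g h" .
    qed simp
    moreover have "0 \<le> S f g" "0 \<le> S g h"
      unfolding S_def by (rule order.trans[OF norm_ge_zero norm_le_SUP[of _ _ 0]]; use f g h in simp)+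
    ultimately have "min 1 (S f h) \<le> min 1 (S f g) + min 1 (S g h)" by linarith
    then have "(1/2)^(Suc n) * min 1 (S f h) \<le> (1/2)^(Suc n) * (min 1 (S f g) + min 1 (S g h))"
      by (intro mult_left_mono) auto
    then show ?thesis by (simp add: rho_term_def S_def distrib_left)
  qed
  then have "rho f h \<le> (\<Sum>n. rho_term f g n + rho_term g h n)"
    unfolding rho_eq by (intro suminf_le summable_add rho_summable f g h)
  also have "\<dots> = rho f g + rho g h"
    unfolding rho_eq by (intro suminf_add[symmetric] rho_summable f g h)
  finally show ?thesis .
qed

lemma rho_tendsto_pointwise:
  assumes f: "\<And>k. continuous_on UNIV (f k)" and g: "continuous_on UNIV g" and lim: "(\<lambda>k. rho (f k) g) \<longlonglongrightarrow> 0"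
  shows "(\<lambda>k. f k t) \<longlonglongrightarrow> g t"
proof -
  obtain n :: nat where n: "\<bar>t\<bar> < real n" using reals_Archimedean2 by blast
  then have t: "t \<in> {- real (Suc n)..real (Suc n)}" by auto
  have le: "min 1 (norm (f k t - g t)) \<le> 2^(Suc n) * rho (f k) g" for k
  proof -
    have "(1/2)^(Suc n) * min 1 (norm (f k t - g t)) \<le> rho_term (f k) g n"
      unfolding rho_term_def using norm_le_SUP[OF f g t, of k] by (intro mult_left_mono) auto
    also have "\<dots> \<le> rho (f k) g"
      unfolding rho_eq using sum_le_suminf[OF rho_summable[OF f g], of "{n}" k] rho_term_bounds[OF f g] by simp
    finally show ?thesis by (simp add: field_simps power_divide)
  qed
  have lim': "(\<lambda>k. 2^(Suc n) * rho (f k) g) \<longlonglongrightarrow> 0" using tendsto_mult[OF tendsto_const lim] by simp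
  show ?thesis
  proof (rule LIMSEQ_I)
    fix e :: real assume "e > 0"
    then have "\<forall>\<^sub>F k in sequentially. 2^(Suc n) * rho (f k) g < min 1 e" by (intro order_tendstoD(2)[OF lim']) auto
    then obtain k0 where k0: "\<And>k. k \<ge> k0 \<Longrightarrow> 2^(Suc n) * rho (f k) g < min 1 e" by (auto simp: eventually_sequentially)
    have "norm (f k t - g t) < e" if "k \<ge> k0" for k using le[of k] k0[OF that] by linarith
    then show "\<exists>no. \<forall>k\<ge>no. norm (f k t - g t) < e" by blast
  qed
qed

lemma norm_add_diff_le: "norm (x - y + z) \<le> norm x + norm y + norm (z :: 'a :: real_normed_vector)"
  using norm_triangle_ineq[of "x - y" z] norm_triangle_ineq4[of x y] by linarith

lemma rho_tendstoI:
  fixes f :: "nat \<Rightarrow> real \<Rightarrow> real \<times> real"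
  assumes eq: "\<And>e. e > 0 \<Longrightarrow> \<exists>d>0. \<forall>k s t. dist s t < d \<longrightarrow> norm (f k s - f k t) < e"
    and lim: "\<And>t. (\<lambda>k. f k t) \<longlonglongrightarrow> g t"
  shows "continuous_on UNIV g" "(\<lambda>k. rho (f k) g) \<longlonglongrightarrow> 0"
proof -
  have eg: "\<exists>d>0. \<forall>s t. dist s t < d \<longrightarrow> (\<forall>k. norm (f k s - f k t) < e) \<and> norm (g s - g t) \<le> e" if e: "e > 0" for e
  proof -
    obtain d where d: "d > 0" "\<And>k s t. dist s t < d \<Longrightarrow> norm (f k s - f k t) < e" using eq[OF e] by blast
    have "norm (g s - g t) \<le> e" if "dist s t < d" for s t
    proof (rule LIMSEQ_le_const2)
      show "(\<lambda>k. norm (f k s - f k t)) \<longlonglongrightarrow> norm (g s - g t)" by (intro tendsto_intros lim)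
      show "\<exists>N. \<forall>n\<ge>N. norm (f n s - f n t) \<le> e" using d(2)[OF that] by (auto intro: less_imp_le)
    qed
    then show ?thesis using d by blast
  qed
  show cg: "continuous_on UNIV g"
    unfolding continuous_on_iff
  proof (intro ballI allI impI)
    fix x e :: real assume "e > 0"
    then have "e / 2 > 0" by simp
    then obtain d where "d > 0" "\<And>s t. dist s t < d \<Longrightarrow> norm (g s - g t) \<le> e / 2" using eg by blast
    then show "\<exists>d>0. \<forall>x'\<in>UNIV. dist x' x < d \<longrightarrow> dist (g x') (g x) < e"
      using \<open>e > 0\<close> by (intro exI[of _ d]) (fastforce simp: dist_norm)
  qed
  have cf: "continuous_on UNIV (f k)" for k
    unfolding continuous_on_iff
  proof (intro ballI allI impI)
    fix x e :: real assume "e > 0"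
    then obtain d where "d > 0" "\<And>s t. dist s t < d \<Longrightarrow> norm (f k s - f k t) < e" using eq[OF \<open>e > 0\<close>] by blast
    then show "\<exists>d>0. \<forall>x'\<in>UNIV. dist x' x < d \<longrightarrow> dist (f k x') (f k x) < e"
      by (intro exI[of _ d]) (simp add: dist_norm)
  qed
  have trm: "(\<lambda>k. rho_term (f k) g n) \<longlonglongrightarrow> 0" for n
  proof (rule LIMSEQ_I)
    fix e :: real assume "e > 0"
    define e' where "e' = e / 4"
    have e': "e' > 0" using \<open>e > 0\<close> by (simp add: e'_def)
    obtain d where d: "d > 0" "\<And>s t k. dist s t < d \<Longrightarrow> norm (f k s - f k t) < e'"
      "\<And>s t. dist s t < d \<Longrightarrow> norm (g s - g t) \<le> e'"
      using eg[OF e'] by blast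
    have "compact {- real (Suc n)..real (Suc n)}" by simp
    then obtain C where C: "finite C" "{- real (Suc n)..real (Suc n)} \<subseteq> (\<Union>x\<in>C. ball x d)"
      unfolding compact_eq_totally_bounded using d(1) by blast
    have "\<forall>\<^sub>F k in sequentially. \<forall>c\<in>C. dist (f k c) (g c) < e'"
      by (intro eventually_ball_finite C(1) ballI tendstoD[OF lim e'])
    then obtain k0 where k0: "\<And>k c. k \<ge> k0 \<Longrightarrow> c \<in> C \<Longrightarrow> dist (f k c) (g c) < e'"
      by (auto simp: eventually_sequentially)
    have "norm (rho_term (f k) g n - 0) < e" if k: "k \<ge> k0" for k
    proof -
      have "(SUP t\<in>{- real (Suc n)..real (Suc n)}. norm (f k t - g t)) \<le> 3 * e'"
      proof (rule cSUP_least)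
        fix t assume "t \<in> {- real (Suc n)..real (Suc n)}"
        then obtain c where c: "c \<in> C" "dist c t < d" using C(2) by auto
        have "norm (f k c - g c) < e'" using k0[OF k c(1)] by (simp add: dist_norm)
        moreover have "norm (f k c - f k t) < e'" "norm (g c - g t) \<le> e'" using d(2,3) c(2) by blast+
        moreover have "f k t - g t = (f k c - g c) - (f k c - f k t) + (g c - g t)" by simp
        then have "norm (f k t - g t) \<le> norm (f k c - g c) + norm (f k c - f k t) + norm (g c - g t)"
          by (simp only: norm_add_diff_le)
        ultimately show "norm (f k t - g t) \<le> 3 * e'" by linarith
      qed simp
      then have "min 1 (SUP t\<in>{- real (Suc n)..real (Suc n)}. norm (f k t - g t)) \<le> 3 * e'" by linarith
      then have "rho_term (f k) g n \<le> (1/2)^(Suc n) * (3 * e')" unfolding rho_term_def by (intro mult_left_mono) auto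
      also have "\<dots> \<le> 1 * (3 * e')" using e' by (intro mult_right_mono power_le_one) auto
      finally show ?thesis using rho_term_bounds(1)[OF cf cg, of k n] \<open>e > 0\<close> by (simp add: e'_def)
    qed
    then show "\<exists>no. \<forall>k\<ge>no. norm (rho_term (f k) g n - 0) < e" by blast
  qed
  have "(\<lambda>k. \<Sum>n. rho_term (f k) g n) \<longlonglongrightarrow> (\<Sum>n. 0)"
  proof (rule tannerys_theorem[where M = "\<lambda>n. (1/2)^(Suc n)", THEN conjunct2, THEN conjunct2])
    show "\<forall>\<^sub>F (n, k) in sequentially \<times>\<^sub>F sequentially. norm (rho_term (f k) g n) \<le> (1/2)^(Suc n)"
      using rho_term_bounds[OF cf cg] by (intro always_eventually) auto
  qed (use trm summable_half in auto)
  then show "(\<lambda>k. rho (f k) g) \<longlonglongrightarrow> 0" by (simp add: rho_eq)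
qed

section \<open>The hull of the coefficients\<close>

locale hull =
  fixes b \<omega> :: "real \<Rightarrow> real"
  assumes ub: "uniformly_continuous_on UNIV b" and u\<omega>: "uniformly_continuous_on UNIV \<omega>"
begin

definition \<beta> :: "real \<Rightarrow> real \<times> real" where "\<beta> = (\<lambda>s. (b s, \<omega> s))"

lemma \<beta>_uc: "e > 0 \<Longrightarrow> \<exists>d>0. \<forall>s t. dist s t < d \<longrightarrow> norm (\<beta> s - \<beta> t) < e"
proof -
  assume e: "e > 0"
  then have e2: "e / 2 > 0" by simp
  obtain d1 where d1: "d1 > 0" "\<And>s t. dist s t < d1 \<Longrightarrow> dist (b s) (b t) < e / 2"
    using ub e2 unfolding uniformly_continuous_on_def by (metis UNIV_I dist_commute)
  obtain d2 where d2: "d2 > 0" "\<And>s t. dist s t < d2 \<Longrightarrow> dist (\<omega> s) (\<omega> t) < e / 2"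
    using u\<omega> e2 unfolding uniformly_continuous_on_def by (metis UNIV_I dist_commute)
  have "norm (\<beta> s - \<beta> t) < e" if "dist s t < min d1 d2" for s t
  proof -
    have "norm (\<beta> s - \<beta> t) \<le> norm (b s - b t) + norm (\<omega> s - \<omega> t)"
      unfolding \<beta>_def using norm_Pair_le[of "b s - b t" "\<omega> s - \<omega> t"] by simp
    moreover have "norm (b s - b t) < e / 2" "norm (\<omega> s - \<omega> t) < e / 2"
      using d1(2)[of s t] d2(2)[of s t] that by (simp_all add: dist_norm)
    ultimately show ?thesis by linarith
  qed
  then show ?thesis using d1(1) d2(1) by (intro exI[of _ "min d1 d2"]) auto
qed

lemma translates_equicontinuous: "e > 0 \<Longrightarrow> \<exists>d>0. \<forall>k s t. dist s t < d \<longrightarrow> norm (theta (ts k) \<beta> s - theta (ts k) \<beta> t) < e"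
proof -
  assume "e > 0"
  then obtain d where d: "d > 0" "\<And>s t. dist s t < d \<Longrightarrow> norm (\<beta> s - \<beta> t) < e" using \<beta>_uc by blast
  have "norm (theta (ts k) \<beta> s - theta (ts k) \<beta> t) < e" if "dist s t < d" for k s t
    unfolding theta_def by (rule d(2)) (use that in \<open>simp add: dist_real_def\<close>)
  then show ?thesis using d(1) by blast
qed

lemma continuous_translate: "continuous_on UNIV (theta s \<beta>)"
  using rho_tendstoI(1)[OF translates_equicontinuous[of _ "\<lambda>_. s"], of "theta s \<beta>"] by simp

lemma Hull_iff: "\<sigma> \<in> Hull b \<omega> \<longleftrightarrow> (\<exists>ts :: nat \<Rightarrow> real. \<forall>t. (\<lambda>k. theta (ts k) \<beta> t) \<longlonglongrightarrow> \<sigma> t)"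
proof
  assume "\<sigma> \<in> Hull b \<omega>"
  then obtain ts :: "nat \<Rightarrow> real" where c: "continuous_on UNIV \<sigma>" and l: "(\<lambda>k. rho (theta (ts k) \<beta>) \<sigma>) \<longlonglongrightarrow> 0"
    unfolding Hull_def \<beta>_def by blast
  have "(\<lambda>k. theta (ts k) \<beta> t) \<longlonglongrightarrow> \<sigma> t" for t
    by (rule rho_tendsto_pointwise[OF continuous_translate c l])
  then show "\<exists>ts :: nat \<Rightarrow> real. \<forall>t. (\<lambda>k. theta (ts k) \<beta> t) \<longlonglongrightarrow> \<sigma> t" by blast
next
  assume "\<exists>ts :: nat \<Rightarrow> real. \<forall>t. (\<lambda>k. theta (ts k) \<beta> t) \<longlonglongrightarrow> \<sigma> t"
  then obtain ts :: "nat \<Rightarrow> real" where l: "\<And>t. (\<lambda>k. theta (ts k) \<beta> t) \<longlonglongrightarrow> \<sigma> t" by blast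
  show "\<sigma> \<in> Hull b \<omega>"
    unfolding Hull_def \<beta>_def[symmetric]
    using rho_tendstoI[OF translates_equicontinuous l] by blast
qed

lemma Hull_continuous: "\<sigma> \<in> Hull b \<omega> \<Longrightarrow> continuous_on UNIV \<sigma>"
  by (simp add: Hull_def)

lemma theta_Hull: "\<sigma> \<in> Hull b \<omega> \<Longrightarrow> theta s \<sigma> \<in> Hull b \<omega>"
proof -
  assume "\<sigma> \<in> Hull b \<omega>"
  then obtain ts :: "nat \<Rightarrow> real" where l: "\<And>t. (\<lambda>k. theta (ts k) \<beta> t) \<longlonglongrightarrow> \<sigma> t" unfolding Hull_iff by blast
  have "(\<lambda>k. theta (ts k + s) \<beta> t) \<longlonglongrightarrow> theta s \<sigma> t" for t
    using l[of "t + s"] by (simp add: theta_def add_ac)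
  then show ?thesis unfolding Hull_iff by (intro exI[of _ "\<lambda>k. ts k + s"]) blast
qed

lemma Hull_compact:
  assumes \<sigma>: "\<And>n. \<sigma> n \<in> Hull b \<omega>" and bd: "\<And>t. norm (\<beta> t) \<le> B"
  obtains k :: "nat \<Rightarrow> nat" and \<sigma>' where "strict_mono k" "\<sigma>' \<in> Hull b \<omega>"
    "(\<lambda>n. rho (\<sigma> (k n)) \<sigma>') \<longlonglongrightarrow> 0" "\<And>t. (\<lambda>n. \<sigma> (k n) t) \<longlonglongrightarrow> \<sigma>' t"
proof -
  have "\<exists>s. rho (theta s \<beta>) (\<sigma> n) < 1 / real (Suc n)" for n
  proof -
    obtain ts :: "nat \<Rightarrow> real" where "(\<lambda>k. rho (theta (ts k) \<beta>) (\<sigma> n)) \<longlonglongrightarrow> 0"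
      using \<sigma>[of n] unfolding Hull_def \<beta>_def by blast
    then have "\<forall>\<^sub>F k in sequentially. rho (theta (ts k) \<beta>) (\<sigma> n) < 1 / real (Suc n)" by (rule order_tendstoD(2)) simp
    then show ?thesis by (auto simp: eventually_sequentially)
  qed
  then obtain ts where ts: "\<And>n. rho (theta (ts n) \<beta>) (\<sigma> n) < 1 / real (Suc n)" by metis
  define F where "F n = theta (ts n) \<beta>" for n
  have nF: "norm (F n t) \<le> B" for n t unfolding F_def theta_def by (rule bd)
  obtain k :: "nat \<Rightarrow> nat" where k: "strict_mono k" "\<And>x. x \<in> \<rat> \<Longrightarrow> \<exists>l. (\<lambda>n. F (k n) x) \<longlonglongrightarrow> l"
    using function_convergent_subsequence[of "\<rat> :: real set" F B] countable_rat nF by blast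
  have "convergent (\<lambda>n. F (k n) t)" for t
  proof (rule Cauchy_convergent, rule CauchyI)
    fix e :: real assume "e > 0"
    then have e3: "e / 3 > 0" by simp
    obtain d where d: "d > 0" "\<And>n s t. dist s t < d \<Longrightarrow> norm (F n s - F n t) < e / 3"
      using translates_equicontinuous[OF e3, of ts] unfolding F_def by blast
    obtain q where q: "q \<in> \<rat>" "t < q" "q < t + d" using Rats_dense_in_real[of t "t + d"] d(1) by auto
    obtain l where "(\<lambda>n. F (k n) q) \<longlonglongrightarrow> l" using k(2)[OF q(1)] by blast
    then have "Cauchy (\<lambda>n. F (k n) q)" by (rule LIMSEQ_imp_Cauchy)
    from CauchyD[OF this e3] obtain n0 where n0: "\<And>m n. m \<ge> n0 \<Longrightarrow> n \<ge> n0 \<Longrightarrow> norm (F (k m) q - F (k n) q) < e / 3" by blast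
    have "norm (F (k m) t - F (k n) t) < e" if "m \<ge> n0" "n \<ge> n0" for m n
    proof -
      have "dist q t < d" using q by (simp add: dist_real_def)
      then have "norm (F (k m) q - F (k m) t) < e / 3" "norm (F (k n) q - F (k n) t) < e / 3" using d(2) by blast+
      moreover have "norm (F (k m) t - F (k n) t) \<le> norm (F (k m) q - F (k n) q) + norm (F (k m) q - F (k m) t) + norm (F (k n) q - F (k n) t)"
      proof -
        have "F (k m) t - F (k n) t = (F (k m) q - F (k n) q) - (F (k m) q - F (k m) t) + (F (k n) q - F (k n) t)" by simp
        then show ?thesis by (simp only: norm_add_diff_le)
      qed
      ultimately show ?thesis using n0[OF that] by linarith
    qed
    then show "\<exists>M. \<forall>m\<ge>M. \<forall>n\<ge>M. norm (F (k m) t - F (k n) t) < e" by blast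
  qed
  then obtain \<sigma>' where lF: "\<And>t. (\<lambda>n. F (k n) t) \<longlonglongrightarrow> \<sigma>' t" unfolding convergent_def by metis
  then have H: "\<sigma>' \<in> Hull b \<omega>" unfolding Hull_iff F_def by (intro exI[of _ "\<lambda>n. ts (k n)"]) blast
  have cF: "continuous_on UNIV (F n)" for n unfolding F_def by (rule continuous_translate)
  have rF: "(\<lambda>n. rho (F (k n)) \<sigma>') \<longlonglongrightarrow> 0"
    by (rule rho_tendstoI(2)[OF _ lF]) (unfold F_def, rule translates_equicontinuous)
  have "(\<lambda>n. rho (\<sigma> (k n)) \<sigma>') \<longlonglongrightarrow> 0"
  proof (rule Lim_null_comparison)
    have "(\<lambda>n. 1 / real (Suc n)) \<longlonglongrightarrow> 0" using LIMSEQ_inverse_real_of_nat by (simp add: inverse_eq_divide)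
    then show "(\<lambda>n. 1 / real (Suc n) + rho (F (k n)) \<sigma>') \<longlonglongrightarrow> 0" using tendsto_add[OF _ rF] by fastforce
    have "norm (rho (\<sigma> (k n)) \<sigma>') \<le> 1 / real (Suc n) + rho (F (k n)) \<sigma>'" for n
    proof -
      have c: "continuous_on UNIV (\<sigma> (k n))" "continuous_on UNIV \<sigma>'" using \<sigma> H Hull_continuous by auto
      have "rho (\<sigma> (k n)) \<sigma>' \<le> rho (\<sigma> (k n)) (F (k n)) + rho (F (k n)) \<sigma>'" by (rule rho_triangle[OF c(1) cF c(2)])
      moreover have "rho (\<sigma> (k n)) (F (k n)) \<le> 1 / real (Suc (k n))"
        using ts[of "k n"] by (simp add: F_def rho_commute less_imp_le)
      moreover have "1 / real (Suc (k n)) \<le> 1 / real (Suc n)" using seq_suble[OF k(1), of n] by (simp add: frac_le)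
      ultimately show ?thesis using rho_nonneg[OF c] by simp
    qed
    then show "\<forall>\<^sub>F n in sequentially. norm (rho (\<sigma> (k n)) \<sigma>') \<le> 1 / real (Suc n) + rho (F (k n)) \<sigma>'" by simp
  qed
  moreover from this have "(\<lambda>n. \<sigma> (k n) t) \<longlonglongrightarrow> \<sigma>' t" for t
    by (rule rho_tendsto_pointwise[rotated 2]) (use \<sigma> H Hull_continuous in auto)
  ultimately show ?thesis using that k(1) H by blast
qed

end

section \<open>The attractors\<close>

lemma theta_theta: "theta s (theta t \<sigma>) = theta (s + t) \<sigma>"
  by (simp add: theta_def fun_eq_iff add_ac)

lemma theta_0 [simp]: "theta 0 \<sigma> = \<sigma>"
  by (simp add: theta_def)

lemma eqH_refl [simp]: "eqH f f"
  by (simp add: eqH_iff)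

lemma eqH_trans:
  assumes "eqH f g" "eqH g h" shows "eqH f h"
  using assms unfolding eqH_iff
proof eventually_elim
  case (elim x)
  then show ?case by simp
qed

lemma eqH_normH:
  assumes "inH f" "inH g" "eqH f g" shows "normH f = normH g"
proof -
  have "(\<lambda>k. (coef f k)^2) = (\<lambda>k. (coef g k)^2)" using assms eqH_iff_coef by simp
  then have "(normH f)^2 = (normH g)^2"
    using sums_unique2[OF normH_sums[OF assms(1)]] normH_sums[OF assms(2)] by simp
  then show ?thesis by (rule power2_eq_imp_eq) simp_all
qed

lemma distH_zero_imp_eqH:
  assumes "inH f" "inH g" "distH f g = 0" shows "eqH f g"
  using assms distH_coef_le[OF assms(1,2)] by (simp add: eqH_iff_coef)

lemma distH_triangle:
  assumes "inH f" "inH g" "inH h" shows "distH f h \<le> distH f g + distH g h"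
  using nrm_triangle[OF L2_diff[of I01 f g] L2_diff[of I01 g h]] assms by (simp add: inH_iff distH_eq)

lemma traj_upd:
  assumes u: "traj \<tau> \<sigma> u" and z: "inH z" "eqH z (u t0)" and t0: "\<tau> \<le> t0"
  shows "traj \<tau> \<sigma> (u(t0 := z))"
proof -
  obtain r where m: "mild \<tau> r u" and i: "inclusion \<tau> \<sigma> u r" using u by (auto simp: traj_def)
  have c: "coef ((u(t0 := z)) t) k = coef (u t) k" for t k
    using eqH_iff_coef[OF z(1) mildD(2)[OF m t0]] z(2) by simp
  have "mild \<tau> r (u(t0 := z))"
    using m z(1) unfolding mild_def c by auto
  moreover have "AE t in lborel. t \<noteq> t0" by (rule negligible_AE_lborel[OF negligible_sing[of t0]]) simp
  with i have "inclusion \<tau> \<sigma> (u(t0 := z)) r" unfolding inclusion_def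
    by eventually_elim simp
  ultimately show ?thesis by (auto simp: traj_def)
qed

lemma pullback_attractor_saturated:
  assumes P: "pullback_attractor \<sigma> P" and x: "x \<in> P t" and z: "inH z" "eqH z x"
  shows "z \<in> P t"
proof -
  have "P t = U \<sigma> t t (P t)" using P by (simp add: pullback_attractor_def)
  then obtain u x' where u: "x = u t" "x' \<in> P t" "solution t \<sigma> x' u" using x unfolding U_def by blast
  then have s: "inH x'" "eqH (u t) x'" "traj t \<sigma> u" by (simp_all add: solution_iff_traj)
  have "traj t \<sigma> (u(t := z))" using traj_upd[OF s(3) z(1)] z(2) u(1) by simp
  moreover have "eqH z x'" using eqH_trans[OF z(2)] s(2) u(1) by simp
  ultimately have "solution t \<sigma> x' (u(t := z))" using s(1) by (simp add: solution_iff_traj)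
  then have "(u(t := z)) t \<in> U \<sigma> t t (P t)" using u(2) unfolding U_def by blast
  then show ?thesis using \<open>P t = U \<sigma> t t (P t)\<close> by simp
qed

lemma pullback_attractor_unique:
  assumes P: "pullback_attractor \<sigma> P" and Q: "pullback_attractor \<sigma> Q"
  shows "P t = Q t"
proof -
  have sub: "P t \<subseteq> Q t" if P: "pullback_attractor \<sigma> P" and Q: "pullback_attractor \<sigma> Q" for P Q
  proof
    fix y assume y: "y \<in> P t"
    have "\<forall>t. compactH (Q t)" "pullback_attracts \<sigma> Q" using Q by (simp_all add: pullback_attractor_def)
    then obtain z where z: "z \<in> Q t" "eqH y z" using P y unfolding pullback_attractor_def by blast
    have "inH y" using P y by (auto simp: pullback_attractor_def compactH_def)
    then show "y \<in> Q t" by (rule pullback_attractor_saturated[OF Q z(1) _ z(2)])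
  qed
  show ?thesis using sub[OF P Q] sub[OF Q P] by blast
qed

lemma ctraj_shift:
  assumes "ctraj \<sigma> \<phi>" shows "ctraj (theta s \<sigma>) (\<lambda>t. \<phi> (t + s))"
proof -
  have "traj \<tau> (theta s \<sigma>) (\<lambda>t. \<phi> (t + s))" for \<tau>
    using traj_shift[of "\<tau> + s" \<sigma> \<phi> s] assms by (simp add: ctraj_def)
  then show ?thesis using assms unfolding ctraj_def by blast
qed

context coefficient_bounds
begin

lemma ctraj_concat:
  assumes \<phi>: "ctraj \<sigma> \<phi>" and u: "traj s \<sigma> u" and e: "eqH (u s) (\<phi> s)" and a: "adm \<sigma>"
  shows "ctraj \<sigma> (\<lambda>t. if t < s then \<phi> t else u t)"
proof -
  have "traj \<tau> \<sigma> (\<lambda>t. if t < s then \<phi> t else u t)" for \<tau>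
  proof -
    have "traj (min \<tau> s) \<sigma> (\<lambda>t. if t < s then \<phi> t else u t)"
      by (rule traj_concat) (use \<phi> u e in \<open>auto simp: ctraj_def\<close>)
    then show ?thesis by (rule traj_restrict) simp
  qed
  moreover obtain C where C: "\<And>t. (normH (\<phi> t))^2 \<le> C" using \<phi> by (auto simp: ctraj_def)
  have "(normH (u t))^2 \<le> (normH (u s))^2 + K" if "t \<ge> s" for t
  proof -
    have "(normH (u t))^2 \<le> exp (- \<delta> * (t - s)) * (normH (u s))^2 + K"
      by (rule energy_decay[OF u a order.refl that])
    also have "\<dots> \<le> 1 * (normH (u s))^2 + K"
      using \<delta>_pos that by (intro add_right_mono mult_right_mono) auto
    finally show ?thesis by simp
  qed
  then have "(normH (if t < s then \<phi> t else u t))^2 \<le> max C ((normH (u s))^2 + K)" for t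
    using C[of t] by (auto simp: le_max_iff_disj)
  ultimately show ?thesis unfolding ctraj_def by blast
qed

definition sections :: "(real \<Rightarrow> real \<times> real) \<Rightarrow> real \<Rightarrow> (real \<Rightarrow> real) set" where
  "sections \<sigma> t = {\<phi> t | \<phi>. ctraj \<sigma> \<phi>}"

lemma filterlim_minus_real: "filterlim (\<lambda>n. - real n) at_bot sequentially"
  by (rule filterlim_compose[OF filterlim_uminus_at_bot_at_top filterlim_real_sequentially])

lemma compactH_sections:
  assumes a: "adm \<sigma>" shows "compactH (sections \<sigma> t)"
  unfolding compactH_def
proof (intro conjI ballI allI impI)
  fix s :: "nat \<Rightarrow> real \<Rightarrow> real" assume "\<forall>n. s n \<in> sections \<sigma> t"
  then have "\<forall>n. \<exists>\<phi>. s n = \<phi> t \<and> ctraj \<sigma> \<phi>" unfolding sections_def by blast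
  then obtain \<phi> where \<phi>: "\<And>n. s n = \<phi> n t" "\<And>n. ctraj \<sigma> (\<phi> n)" by metis
  have tr: "traj (- real n) \<sigma> (\<phi> n)" for n using \<phi>(2) by (simp add: ctraj_def)
  obtain k :: "nat \<Rightarrow> nat" and \<psi> where "strict_mono k" "ctraj \<sigma> \<psi>" "\<And>t. (\<lambda>n. distH (\<phi> (k n) t) (\<psi> t)) \<longlonglongrightarrow> 0"
    using trajectories_compact[OF filterlim_minus_real tr a tendsto_const ctraj_normH_le[OF \<phi>(2) a]] by blast
  then show "\<exists>l\<in>sections \<sigma> t. \<exists>r. strict_mono r \<and> (\<lambda>n. distH (s (r n)) l) \<longlonglongrightarrow> 0"
    unfolding sections_def \<phi>(1) by blast
qed (auto simp: sections_def ctraj_inH)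

lemma sections_invariant:
  assumes a: "adm \<sigma>" and st: "s \<le> t" shows "sections \<sigma> t = U \<sigma> t s (sections \<sigma> s)"
proof
  show "sections \<sigma> t \<subseteq> U \<sigma> t s (sections \<sigma> s)"
  proof
    fix y assume "y \<in> sections \<sigma> t"
    then obtain \<phi> where \<phi>: "y = \<phi> t" "ctraj \<sigma> \<phi>" by (auto simp: sections_def)
    then have "solution s \<sigma> (\<phi> s) \<phi>" by (simp add: solution_iff_traj ctraj_inH) (simp add: ctraj_def)
    then show "y \<in> U \<sigma> t s (sections \<sigma> s)" using \<phi> unfolding U_def sections_def by blast
  qed
  show "U \<sigma> t s (sections \<sigma> s) \<subseteq> sections \<sigma> t"
  proof
    fix y assume "y \<in> U \<sigma> t s (sections \<sigma> s)"
    then obtain u \<phi> where u: "y = u t" "solution s \<sigma> (\<phi> s) u" "ctraj \<sigma> \<phi>" unfolding U_def sections_def by blast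
    define \<psi> where "\<psi> = (\<lambda>t. if t < s then \<phi> t else u t)"
    have "ctraj \<sigma> \<psi>" unfolding \<psi>_def
      using u by (intro ctraj_concat[OF _ _ _ a]) (simp_all add: solution_iff_traj)
    then have "\<psi> t \<in> sections \<sigma> t" unfolding sections_def by blast
    then show "y \<in> sections \<sigma> t" using st u by (simp add: \<psi>_def)
  qed
qed

lemma solution_normH_le:
  assumes u: "solution \<tau> \<sigma> x u" and a: "adm \<sigma>" and x: "normH x \<le> R" and t: "t \<ge> \<tau>"
  shows "(normH (u t))^2 \<le> R^2 + K"
proof -
  have s: "inH x" "eqH (u \<tau>) x" "traj \<tau> \<sigma> u" using u by (simp_all add: solution_iff_traj)
  have "normH (u \<tau>) = normH x" by (rule eqH_normH[OF traj_inH[OF s(3) order.refl] s(1,2)])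
  then have n: "(normH (u \<tau>))^2 \<le> R^2" using x by (intro power_mono) auto
  have "(normH (u t))^2 \<le> exp (- \<delta> * (t - \<tau>)) * (normH (u \<tau>))^2 + K"
    by (rule energy_decay[OF s(3) a order.refl t])
  also have "\<dots> \<le> 1 * (normH (u \<tau>))^2 + K" using \<delta>_pos t by (intro add_right_mono mult_right_mono) auto
  finally show ?thesis using n by simp
qed

lemma sections_attract:
  assumes a: "adm \<sigma>" shows "pullback_attracts \<sigma> (sections \<sigma>)"
  unfolding pullback_attracts_def
proof (intro allI impI)
  fix t B and \<epsilon> :: real assume B: "boundedH B" and e: "\<epsilon> > 0"
  show "\<exists>s0\<le>t. \<forall>s\<le>s0. \<forall>y\<in>U \<sigma> t s B. \<exists>a\<in>sections \<sigma> t. distH y a < \<epsilon>"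
  proof (rule ccontr)
    assume neg: "\<not> ?thesis"
    have "\<exists>s y. s \<le> min t (- real n) \<and> y \<in> U \<sigma> t s B \<and> (\<forall>a\<in>sections \<sigma> t. \<not> distH y a < \<epsilon>)" for n
      using neg by (meson min.cobounded1)
    then obtain s y where s: "\<And>n. s n \<le> min t (- real n)" and y: "\<And>n. y n \<in> U \<sigma> t (s n) B"
      "\<And>n a. a \<in> sections \<sigma> t \<Longrightarrow> \<not> distH (y n) a < \<epsilon>" by metis
    have "\<exists>u x. y n = u t \<and> x \<in> B \<and> solution (s n) \<sigma> x u" for n using y(1)[of n] unfolding U_def by blast
    then obtain u x where u: "\<And>n. y n = u n t" "\<And>n. x n \<in> B" "\<And>n. solution (s n) \<sigma> (x n) (u n)" by metis
    obtain R where R: "\<And>f. f \<in> B \<Longrightarrow> normH f \<le> R" using B by (auto simp: boundedH_def)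
    have sb: "filterlim s at_bot sequentially"
      by (rule filterlim_at_bot_mono[OF filterlim_minus_real]) (use s in auto)
    have tr: "traj (s n) \<sigma> (u n)" for n using u(3) by (simp add: solution_iff_traj)
    have nb: "(normH (u n r))^2 \<le> R^2 + K" if "r \<ge> s n" for n r
      by (rule solution_normH_le[OF u(3) a R[OF u(2)] that])
    obtain k :: "nat \<Rightarrow> nat" and \<psi> where k: "ctraj \<sigma> \<psi>" "\<And>t. (\<lambda>n. distH (u (k n) t) (\<psi> t)) \<longlonglongrightarrow> 0"
      using trajectories_compact[OF sb tr a tendsto_const nb] by blast
    have "\<forall>\<^sub>F n in sequentially. distH (u (k n) t) (\<psi> t) < \<epsilon>" by (rule order_tendstoD(2)[OF k(2) e])
    then obtain n where "distH (u (k n) t) (\<psi> t) < \<epsilon>" by (auto simp: eventually_sequentially)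
    moreover have "\<psi> t \<in> sections \<sigma> t" using k(1) unfolding sections_def by blast
    ultimately show False using y(2) u(1) by metis
  qed
qed

theorem pullback_attractor_sections:
  assumes a: "adm \<sigma>" shows "pullback_attractor \<sigma> (sections \<sigma>)"
  unfolding pullback_attractor_def
proof (intro conjI allI impI ballI)
  show "compactH (sections \<sigma> t)" for t by (rule compactH_sections[OF a])
  show "sections \<sigma> t = U \<sigma> t s (sections \<sigma> s)" if "s \<le> t" for s t by (rule sections_invariant[OF a that])
  show "pullback_attracts \<sigma> (sections \<sigma>)" by (rule sections_attract[OF a])
  fix Q t y assume Q: "(\<forall>t. compactH (Q t)) \<and> pullback_attracts \<sigma> Q" and y: "y \<in> sections \<sigma> t"
  obtain \<phi> where \<phi>: "y = \<phi> t" "ctraj \<sigma> \<phi>" using y by (auto simp: sections_def)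
  have Hy: "inH y" using \<phi> ctraj_inH by simp
  define B where "B = range \<phi>"
  have "normH (\<phi> s) \<le> sqrt K" for s by (rule real_le_rsqrt[OF ctraj_normH_le[OF \<phi>(2) a]])
  then have B: "boundedH B" using ctraj_inH[OF \<phi>(2)] by (auto simp: boundedH_def B_def)
  have yU: "y \<in> U \<sigma> t s B" for s
  proof -
    have "solution s \<sigma> (\<phi> s) \<phi>" using \<phi>(2) by (simp add: solution_iff_traj ctraj_inH) (simp add: ctraj_def)
    then show ?thesis using \<phi>(1) unfolding U_def B_def by blast
  qed
  have "\<exists>z\<in>Q t. distH y z < 1 / real (Suc n)" for n
  proof -
    have "1 / real (Suc n) > 0" by simp
    then obtain s0 where "\<forall>s\<le>s0. \<forall>y\<in>U \<sigma> t s B. \<exists>a\<in>Q t. distH y a < 1 / real (Suc n)"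
      using Q B unfolding pullback_attracts_def by blast
    then show ?thesis using yU by blast
  qed
  then obtain z where z: "\<And>n. z n \<in> Q t" "\<And>n. distH y (z n) < 1 / real (Suc n)" by metis
  have cQ: "compactH (Q t)" using Q by blast
  then obtain l r where l: "l \<in> Q t" "strict_mono (r :: nat \<Rightarrow> nat)" "(\<lambda>n. distH (z (r n)) l) \<longlonglongrightarrow> 0"
    unfolding compactH_def using z(1) by metis
  have HQ: "inH f" if "f \<in> Q t" for f using cQ that by (simp add: compactH_def)
  have "distH y l \<le> 0"
  proof (rule LIMSEQ_le_const)
    have "(\<lambda>n. 1 / real (Suc n)) \<longlonglongrightarrow> 0" using LIMSEQ_inverse_real_of_nat by (simp add: inverse_eq_divide)
    from tendsto_add[OF this l(3)] show "(\<lambda>n. 1 / real (Suc n) + distH (z (r n)) l) \<longlonglongrightarrow> 0" by simp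
    have "distH y l \<le> 1 / real (Suc n) + distH (z (r n)) l" for n
    proof -
      have "distH y l \<le> distH y (z (r n)) + distH (z (r n)) l" by (rule distH_triangle[OF Hy HQ[OF z(1)] HQ[OF l(1)]])
      moreover have "1 / real (Suc (r n)) \<le> 1 / real (Suc n)" using seq_suble[OF l(2), of n] by (simp add: frac_le)
      ultimately show ?thesis using z(2)[of "r n"] by linarith
    qed
    then show "\<exists>N. \<forall>n\<ge>N. distH y l \<le> 1 / real (Suc n) + distH (z (r n)) l" by blast
  qed
  then have "distH y l = 0" using distH_nonneg[of y l] by linarith
  then have "eqH y l" by (rule distH_zero_imp_eqH[OF Hy HQ[OF l(1)]])
  then show "\<exists>z\<in>Q t. eqH y z" using l(1) by blast
qed

end

locale reaction_diffusion = coefficient_bounds b0 b1 w1 + hull b \<omega>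
  for b0 b1 w1 :: real and b \<omega> :: "real \<Rightarrow> real" +
  assumes range: "\<And>t. b0 \<le> b t \<and> b t \<le> b1 \<and> 0 \<le> \<omega> t \<and> \<omega> t \<le> w1"
begin

lemma Hull_adm: "\<sigma> \<in> Hull b \<omega> \<Longrightarrow> adm \<sigma>"
proof -
  assume "\<sigma> \<in> Hull b \<omega>"
  then obtain ts :: "nat \<Rightarrow> real" where l: "\<And>t. (\<lambda>k. theta (ts k) \<beta> t) \<longlonglongrightarrow> \<sigma> t" unfolding Hull_iff by blast
  have l1: "(\<lambda>k. b (t + ts k)) \<longlonglongrightarrow> fst (\<sigma> t)" and l2: "(\<lambda>k. \<omega> (t + ts k)) \<longlonglongrightarrow> snd (\<sigma> t)" for t
    using tendsto_fst[OF l[of t]] tendsto_snd[OF l[of t]] by (simp_all add: theta_def \<beta>_def)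
  show "adm \<sigma>"
    unfolding adm_def
  proof (intro allI conjI)
    fix t
    show "b0 \<le> fst (\<sigma> t)" by (rule LIMSEQ_le_const[OF l1]) (use range in auto)
    show "fst (\<sigma> t) \<le> b1" by (rule LIMSEQ_le_const2[OF l1]) (use range in auto)
    show "0 \<le> snd (\<sigma> t)" by (rule LIMSEQ_le_const[OF l2]) (use range in auto)
    show "snd (\<sigma> t) \<le> w1" by (rule LIMSEQ_le_const2[OF l2]) (use range in auto)
  qed
qed

lemma \<beta>_bounded: "norm (\<beta> t) \<le> b1 + w1"
proof -
  have "norm (\<beta> t) \<le> \<bar>b t\<bar> + \<bar>\<omega> t\<bar>" unfolding \<beta>_def using norm_Pair_le[of "b t" "\<omega> t"] by simp
  then show ?thesis using range[of t] b0 by simp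
qed

definition attractor :: "xpt set" where
  "attractor = (\<Union>\<sigma>\<in>Hull b \<omega>. sections \<sigma> 0 \<times> {\<sigma>})"

lemma attractor_iff: "(x, \<sigma>) \<in> attractor \<longleftrightarrow> \<sigma> \<in> Hull b \<omega> \<and> (\<exists>\<phi>. x = \<phi> 0 \<and> ctraj \<sigma> \<phi>)"
  unfolding attractor_def sections_def by blast

lemma trajectories_compact_hull:
  assumes \<tau>: "filterlim \<tau> at_bot sequentially"
    and \<sigma>: "\<And>n. \<sigma> n \<in> Hull b \<omega>" and u: "\<And>n. traj (\<tau> n) (\<sigma> n) (u n)"
    and C: "\<And>n t. t \<ge> \<tau> n \<Longrightarrow> (normH (u n t))^2 \<le> C"
  obtains k :: "nat \<Rightarrow> nat" and l where "strict_mono k" "l \<in> attractor" "(\<lambda>n. distX (u (k n) 0, \<sigma> (k n)) l) \<longlonglongrightarrow> 0"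
proof -
  obtain k :: "nat \<Rightarrow> nat" and \<sigma>' where k: "strict_mono k" "\<sigma>' \<in> Hull b \<omega>"
    "(\<lambda>n. rho (\<sigma> (k n)) \<sigma>') \<longlonglongrightarrow> 0" "\<And>t. (\<lambda>n. \<sigma> (k n) t) \<longlonglongrightarrow> \<sigma>' t"
    by (rule Hull_compact[OF \<sigma> \<beta>_bounded]) (rule that)
  have \<tau>k: "filterlim (\<lambda>n. \<tau> (k n)) at_bot sequentially"
    by (rule filterlim_compose[OF \<tau> filterlim_subseq[OF k(1)]])
  obtain j :: "nat \<Rightarrow> nat" and \<phi> where j: "strict_mono j" "ctraj \<sigma>' \<phi>" "\<And>t. (\<lambda>n. distH (u (k (j n)) t) (\<phi> t)) \<longlonglongrightarrow> 0"
    using trajectories_compact[OF \<tau>k u Hull_adm[OF \<sigma>] k(4) C] by blast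
  have "(\<lambda>n. rho (\<sigma> (k (j n))) \<sigma>') \<longlonglongrightarrow> 0"
    by (rule filterlim_compose[OF k(3) filterlim_subseq[OF j(1)]])
  from tendsto_add[OF j(3)[of 0] this]
  have "(\<lambda>n. distX (u (k (j n)) 0, \<sigma> (k (j n))) (\<phi> 0, \<sigma>')) \<longlonglongrightarrow> 0" by (simp add: distX_def)
  moreover have "(\<phi> 0, \<sigma>') \<in> attractor" unfolding attractor_iff using k(2) j(2) by blast
  moreover have "strict_mono (\<lambda>n. k (j n))" using strict_mono_o[OF k(1) j(1)] by (simp add: o_def)
  ultimately show ?thesis using that[of "\<lambda>n. k (j n)"] by blast
qed

lemma compactX_attractor: "compactX b \<omega> attractor"
  unfolding compactX_def
proof (intro conjI allI impI)
  show "attractor \<subseteq> Xspace b \<omega>" by (auto simp: attractor_iff Xspace_def ctraj_inH)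
  fix s :: "nat \<Rightarrow> xpt" assume "\<forall>n. s n \<in> attractor"
  then have "\<forall>n. \<exists>\<sigma> \<phi>. s n = (\<phi> 0, \<sigma>) \<and> \<sigma> \<in> Hull b \<omega> \<and> ctraj \<sigma> \<phi>"
    by (metis attractor_iff surj_pair)
  then obtain \<sigma> \<phi> where s: "\<And>n. s n = (\<phi> n 0, \<sigma> n)" "\<And>n. \<sigma> n \<in> Hull b \<omega>" "\<And>n. ctraj (\<sigma> n) (\<phi> n)" by metis
  have tr: "traj (- real n) (\<sigma> n) (\<phi> n)" for n using s(3) by (simp add: ctraj_def)
  obtain k :: "nat \<Rightarrow> nat" and l where "strict_mono k" "l \<in> attractor" "(\<lambda>n. distX (\<phi> (k n) 0, \<sigma> (k n)) l) \<longlonglongrightarrow> 0"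
    using trajectories_compact_hull[OF filterlim_minus_real s(2) tr ctraj_normH_le[OF s(3) Hull_adm[OF s(2)]]] by blast
  then show "\<exists>l\<in>attractor. \<exists>r. strict_mono r \<and> (\<lambda>n. distX (s (r n)) l) \<longlonglongrightarrow> 0" unfolding s(1) by blast
qed

lemma attractor_invariant:
  assumes t: "t \<ge> 0" shows "Pi_set t attractor = attractor"
proof
  show "Pi_set t attractor \<subseteq> attractor"
  proof
    fix y assume "y \<in> Pi_set t attractor"
    then obtain p where p: "p \<in> attractor" "y \<in> Pi t p" unfolding Pi_set_def by blast
    obtain x \<sigma> where px: "p = (x, \<sigma>)" by force
    obtain u where u: "y = (u t, theta t \<sigma>)" "solution 0 \<sigma> x u" using p(2) px unfolding Pi_def by auto
    obtain \<phi> where \<phi>: "\<sigma> \<in> Hull b \<omega>" "x = \<phi> 0" "ctraj \<sigma> \<phi>" using p(1) px attractor_iff by auto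
    have "ctraj \<sigma> (\<lambda>t. if t < 0 then \<phi> t else u t)"
      using u(2) \<phi> by (intro ctraj_concat[OF \<phi>(3) _ _ Hull_adm]) (simp_all add: solution_iff_traj)
    define \<psi> where "\<psi> s = (if s + t < 0 then \<phi> (s + t) else u (s + t))" for s
    have "ctraj (theta t \<sigma>) \<psi>" unfolding \<psi>_def[abs_def] by (rule ctraj_shift) fact
    moreover have "u t = \<psi> 0" using t by (simp add: \<psi>_def)
    ultimately show "y \<in> attractor" unfolding u(1) attractor_iff using theta_Hull[OF \<phi>(1)] by blast
  qed
  show "attractor \<subseteq> Pi_set t attractor"
  proof
    fix y assume y: "y \<in> attractor"
    obtain x \<sigma> where yx: "y = (x, \<sigma>)" by force
    obtain \<phi> where \<phi>: "\<sigma> \<in> Hull b \<omega>" "x = \<phi> 0" "ctraj \<sigma> \<phi>" using y yx attractor_iff by auto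
    define \<sigma>' where "\<sigma>' = theta (- t) \<sigma>"
    define u where "u s = \<phi> (s - t)" for s
    have u: "ctraj \<sigma>' u" using ctraj_shift[OF \<phi>(3), of "- t"] by (simp add: \<sigma>'_def u_def[abs_def])
    have "\<sigma>' \<in> Hull b \<omega>" unfolding \<sigma>'_def by (rule theta_Hull[OF \<phi>(1)])
    then have 1: "(u 0, \<sigma>') \<in> attractor" unfolding attractor_iff using u by blast
    have "solution 0 \<sigma>' (u 0) u" using u by (simp add: solution_iff_traj ctraj_inH) (simp add: ctraj_def)
    moreover have "y = (u t, theta t \<sigma>')" using yx \<phi>(2) by (simp add: u_def \<sigma>'_def theta_theta)
    ultimately have "y \<in> Pi t (u 0, \<sigma>')" unfolding Pi_def by auto
    then show "y \<in> Pi_set t attractor" using 1 unfolding Pi_set_def by blast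
  qed
qed

lemma attractor_attracts:
  assumes BB: "boundedX b \<omega> BB" and e: "\<epsilon> > 0"
  shows "\<exists>T. \<forall>t\<ge>T. \<forall>y\<in>Pi_set t BB. \<exists>a\<in>attractor. distX y a < \<epsilon>"
proof (rule ccontr)
  assume "\<not> ?thesis"
  then have "\<exists>t y. t \<ge> real n \<and> y \<in> Pi_set t BB \<and> (\<forall>a\<in>attractor. \<not> distX y a < \<epsilon>)" for n by blast
  then obtain t y where t: "\<And>n. t n \<ge> real n" and y: "\<And>n. y n \<in> Pi_set (t n) BB"
    "\<And>n a. a \<in> attractor \<Longrightarrow> \<not> distX (y n) a < \<epsilon>" by metis
  have "\<exists>x \<sigma> u. y n = (u (t n), theta (t n) \<sigma>) \<and> (x, \<sigma>) \<in> BB \<and> solution 0 \<sigma> x u" for n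
    using y(1)[of n] unfolding Pi_set_def Pi_def by fastforce
  then obtain x \<sigma> u where u: "\<And>n. y n = (u n (t n), theta (t n) (\<sigma> n))" "\<And>n. (x n, \<sigma> n) \<in> BB"
    "\<And>n. solution 0 (\<sigma> n) (x n) (u n)" by metis
  obtain R where R: "\<And>p q. p \<in> BB \<Longrightarrow> q \<in> BB \<Longrightarrow> distX p q \<le> R" and sub: "BB \<subseteq> Xspace b \<omega>"
    using BB unfolding boundedX_def by blast
  have X: "inH (x n)" "\<sigma> n \<in> Hull b \<omega>" for n using u(2)[of n] sub by (auto simp: Xspace_def)
  have nx: "normH (x n) \<le> normH (x 0) + R" for n
  proof -
    have "distH (x n) (x 0) + rho (\<sigma> n) (\<sigma> 0) \<le> R" using R[OF u(2)[of n] u(2)[of 0]] by (simp add: distX_def)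
    moreover have "rho (\<sigma> n) (\<sigma> 0) \<ge> 0" by (intro rho_nonneg Hull_continuous X)
    moreover have "normH (x n) \<le> normH (x 0) + distH (x n) (x 0)"
      using nrm_triangle[OF _ L2_diff, of I01 "x 0" "x n" "x 0"] X(1) by (simp add: inH_iff normH_eq distH_eq)
    ultimately show ?thesis by linarith
  qed
  have tr: "traj (- t n) (theta (t n) (\<sigma> n)) (\<lambda>s. u n (s + t n))" for n
    using traj_shift[of 0 "\<sigma> n" "u n" "t n"] u(3)[of n] by (simp add: solution_iff_traj)
  have tb: "filterlim (\<lambda>n. - t n) at_bot sequentially"
    by (rule filterlim_at_bot_mono[OF filterlim_minus_real]) (use t in auto)
  have nb: "(normH (u n (s + t n)))^2 \<le> (normH (x 0) + R)^2 + K" if "s \<ge> - t n" for n s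
    by (rule solution_normH_le[OF u(3) Hull_adm[OF X(2)] nx]) (use that in simp)
  obtain k :: "nat \<Rightarrow> nat" and l where k: "l \<in> attractor"
    "(\<lambda>n. distX (u (k n) (0 + t (k n)), theta (t (k n)) (\<sigma> (k n))) l) \<longlonglongrightarrow> 0"
    using trajectories_compact_hull[OF tb theta_Hull[OF X(2)] tr nb] by blast
  have "\<forall>\<^sub>F n in sequentially. distX (u (k n) (0 + t (k n)), theta (t (k n)) (\<sigma> (k n))) l < \<epsilon>"
    by (rule order_tendstoD(2)[OF k(2) e])
  then obtain n where "distX (u (k n) (0 + t (k n)), theta (t (k n)) (\<sigma> (k n))) l < \<epsilon>"
    by (auto simp: eventually_sequentially)
  then have "distX (y (k n)) l < \<epsilon>" by (simp add: u(1))
  then show False using y(2)[OF k(1)] by blast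
qed

lemma global_attractor_attractor: "global_attractor b \<omega> attractor"
  unfolding global_attractor_def
  using compactX_attractor attractor_invariant attractor_attracts by blast

end

theorem theorem3:
  fixes b \<omega> :: "real \<Rightarrow> real" and b0 b1 \<omega>0 \<omega>1 :: real
  assumes "uniformly_continuous_on UNIV b" and "uniformly_continuous_on UNIV \<omega>"
    and "0 < b0" and "\<And>t. b0 \<le> b t \<and> b t \<le> b1"
    and "0 \<le> \<omega>0" and "\<And>t. \<omega>0 \<le> \<omega> t \<and> \<omega> t \<le> \<omega>1" and "\<omega>1 < pi^2"
  shows "\<exists>AA. global_attractor b \<omega> AA \<and>
           (\<forall>\<sigma>\<in>Hull b \<omega>. \<exists>P. pullback_attractor \<sigma> P) \<and>
           (\<forall>P. (\<forall>\<sigma>\<in>Hull b \<omega>. pullback_attractor \<sigma> (P \<sigma>)) \<longrightarrow>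
                AA = (\<Union>\<sigma>\<in>Hull b \<omega>. P \<sigma> 0 \<times> {\<sigma>}))"
proof -
  interpret reaction_diffusion b0 b1 \<omega>1 b \<omega>
    using assms order.trans[of b0 "b 0" b1] order.trans[of 0 \<omega>0 "\<omega> 0"] order.trans[of 0 "\<omega> 0" \<omega>1]
    by unfold_locales (auto intro: order.trans[of 0 \<omega>0])
  have pa: "pullback_attractor \<sigma> (sections \<sigma>)" if "\<sigma> \<in> Hull b \<omega>" for \<sigma>
    by (rule pullback_attractor_sections[OF Hull_adm[OF that]])
  have "attractor = (\<Union>\<sigma>\<in>Hull b \<omega>. P \<sigma> 0 \<times> {\<sigma>})"
    if P: "\<forall>\<sigma>\<in>Hull b \<omega>. pullback_attractor \<sigma> (P \<sigma>)" for P
  proof -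
    have "sections \<sigma> 0 = P \<sigma> 0" if "\<sigma> \<in> Hull b \<omega>" for \<sigma>
      using pullback_attractor_unique[OF pa[OF that]] P that by blast
    then show ?thesis unfolding attractor_def by simp
  qed
  then show ?thesis using global_attractor_attractor pa by blast
qed

end
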